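(* Under the standing assumptions below, for each $1\le i\le r$ and each $1\le j\le \ell$, as $n\to\infty$: $$\lambda_{\lceil nc_{j-1}\rceil+i}(\widetilde X_n)\xrightarrow{a.s.}\begin{cases} G^{-1}_{\mu_X,(b_j,a_{j-1})}(1/\theta_i) & \text{if } G_{\mu_X}(a_{j-1}^-)<1/\theta_i<G_{\mu_X}(b_j^+),\\ b_j & \text{if } 1/\theta_i\ge G_{\mu_X}(b_j^+),\\ a_{j-1} & \text{if } 1/\theta_i\le G_{\mu_X}(a_{j-1}^-).\end{cases}$$
   Context: Standing assumptions (Hermitian setting). For each $n$, $X_n$ is an $n\times n$ real symmetric (resp. complex Hermitian) random matrix whose distribution is invariant under conjugation by orthogonal (resp. unitary) matrices, with ordered eigenvalues $\lambda_1(X_n)\ge\cdots\ge\lambda_n(X_n)$. The empirical eigenvalue distribution $\mu_{X_n}=\frac1n\sum_{i=1}^n\delta_{\lambda_i(X_n)}$ converges almost surely weakly to a non-random compactly supported probability measure $\mu_X=\sum_{j=1}^{\ell}p_j\mu_j$, where $p_j>0$, $\sum_j p_j=1$, each $\mu_j$ is a non-random probability measure supported on $[a_j,b_j]$ with $d\mu_j(z)>0$ for $z\in(a_j,b_j)$, and $a_\ell<b_\ell<a_{\ell-1}<b_{\ell-1}<\cdots<a_1<b_1$. Set $c_0=0$, $c_k=\sum_{i=1}^k p_i$ (so $c_\ell=1$). It is assumed that for $j=1,\dots,\ell$, $\lambda_{\lceil nc_{j-1}\rceil+1}(X_n)\to b_j$ and $\lambda_{\lceil nc_j\rceil}(X_n)\to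 a_j$ almost surely. Fix $r\ge1$ and deterministic reals $\theta_1\ge\cdots\ge\theta_r>0$ independent of $n$; $P_n$ is a deterministic $n\times n$ symmetric (resp. Hermitian) matrix of rank $r$ whose nonzero eigenvalues are $\theta_1,\dots,\theta_r$; $X_n$ and $P_n$ are independent; $\widetilde X_n=X_n+P_n$ with ordered eigenvalues $\lambda_1(\widetilde X_n)\ge\cdots\ge\lambda_n(\widetilde X_n)$. $G_{\mu_X}(z)=\int\frac{1}{z-t}d\mu_X(t)$ for $z\notin\mathrm{supp}\,\mu_X$ is the Cauchy transform; $f(c^+)=\lim_{z\downarrow c}f(z)$, $f(c^-)=\lim_{z\uparrow c}f(z)$; $a_0:=+\infty$ (so $G_{\mu_X}(a_0^-)=0$). $G^{-1}_{\mu_X,(b_j,a_{j-1})}$ denotes the inverse of the (strictly decreasing) restriction of $G_{\mu_X}$ to the interval $(b_j,a_{j-1})$. *)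

theory Defs
  imports "HOL-Probability.Probability" "Jordan_Normal_Form.Char_Poly"
begin

text \<open>Square matrices of varying size n are represented as functions
  nat => nat => complex, only the entries with indices < n being relevant
  (indices are 0-based internally; eigenvalue indices are 1-based as in the paper).\<close>

definition to_mat :: "nat \<Rightarrow> (nat \<Rightarrow> nat \<Rightarrow> complex) \<Rightarrow> complex mat" where
  "to_mat n A = mat n n (\<lambda>(i, j). A i j)"

definition hermitian_n :: "nat \<Rightarrow> (nat \<Rightarrow> nat \<Rightarrow> complex) \<Rightarrow> bool" where
  "hermitian_n n A \<longleftrightarrow> (\<forall>i<n. \<forall>j<n. A i j = cnj (A j i))"

definition real_entries_n :: "nat \<Rightarrow> (nat \<Rightarrow> nat \<Rightarrow> complex) \<Rightarrow> bool" where
  "real_entries_n n A \<longleftrightarrow> (\<forall>i<n. \<forall>j<n. A i j \<in> \<real>)"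

definition supported_n :: "nat \<Rightarrow> (nat \<Rightarrow> nat \<Rightarrow> complex) \<Rightarrow> bool" where
  "supported_n n A \<longleftrightarrow> (\<forall>i j. (n \<le> i \<or> n \<le> j) \<longrightarrow> A i j = 0)"

definition unitary_n :: "nat \<Rightarrow> (nat \<Rightarrow> nat \<Rightarrow> complex) \<Rightarrow> bool" where
  "unitary_n n U \<longleftrightarrow>
     (\<forall>i<n. \<forall>j<n. (\<Sum>k<n. U i k * cnj (U j k)) = (if i = j then 1 else 0))"

definition mat_conj_n :: "nat \<Rightarrow> (nat \<Rightarrow> nat \<Rightarrow> complex) \<Rightarrow> (nat \<Rightarrow> nat \<Rightarrow> complex)
    \<Rightarrow> (nat \<Rightarrow> nat \<Rightarrow> complex)" where
  "mat_conj_n n U A = (\<lambda>i j. if i < n \<and> j < n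
      then (\<Sum>k<n. \<Sum>l<n. U i k * A k l * cnj (U j l)) else 0)"

definition mat_add :: "(nat \<Rightarrow> nat \<Rightarrow> complex) \<Rightarrow> (nat \<Rightarrow> nat \<Rightarrow> complex)
    \<Rightarrow> (nat \<Rightarrow> nat \<Rightarrow> complex)" where
  "mat_add A B = (\<lambda>i j. A i j + B i j)"

definition mat_space :: "(nat \<Rightarrow> nat \<Rightarrow> complex) measure" where
  "mat_space = Pi\<^sub>M UNIV (\<lambda>_. Pi\<^sub>M UNIV (\<lambda>_. (borel :: complex measure)))"

text \<open>Eigenvalues = roots (with multiplicity) of the characteristic polynomial;
  for a Hermitian matrix they are real. Listed in non-increasing order.\<close>
definition eigs_desc :: "nat \<Rightarrow> (nat \<Rightarrow> nat \<Rightarrow> complex) \<Rightarrow> real list" where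
  "eigs_desc n A = rev (sorted_list_of_multiset (image_mset Re (proots (char_poly (to_mat n A)))))"

definition eig :: "nat \<Rightarrow> (nat \<Rightarrow> nat \<Rightarrow> complex) \<Rightarrow> nat \<Rightarrow> real" where
  "eig n A i = eigs_desc n A ! (i - 1)"

definition cauchy_transform :: "real measure \<Rightarrow> real \<Rightarrow> real" where
  "cauchy_transform \<mu> z = (\<integral>t. 1 / (z - t) \<partial>\<mu>)"

text \<open>G(b^+) and G(a^-) as extended reals (they may be infinite).\<close>
definition G_right :: "real measure \<Rightarrow> real \<Rightarrow> ereal" where
  "G_right \<mu> c = Lim (at_right c) (\<lambda>z. ereal (cauchy_transform \<mu> z))"

definition G_left :: "real measure \<Rightarrow> real \<Rightarrow> ereal" where
  "G_left \<mu> c = Lim (at_left c) (\<lambda>z. ereal (cauchy_transform \<mu> z))"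

text \<open>G(a_{j-1}^-) with the convention a_0 = +infinity, G(a_0^-) = 0.\<close>
definition G_left_edge :: "real measure \<Rightarrow> (nat \<Rightarrow> real) \<Rightarrow> nat \<Rightarrow> ereal" where
  "G_left_edge \<mu> a j = (if j = 1 then 0 else G_left \<mu> (a (j - 1)))"

text \<open>The gap (b_j, a_{j-1}), with a_0 = +infinity.\<close>
definition gap_interval :: "(nat \<Rightarrow> real) \<Rightarrow> (nat \<Rightarrow> real) \<Rightarrow> nat \<Rightarrow> real set" where
  "gap_interval a b j = (if j = 1 then {b 1<..} else {b j<..<a (j - 1)})"

end

theory Submission
  imports Defs
begin

text \<open>
  Conjugating by a unitary that diagonalises \<open>P\<^sub>n\<close> preserves the law of \<open>X\<^sub>n\<close>, so
  \<open>P\<^sub>n = diag(\<theta>\<^sub>1, \<dots>, \<theta>\<^sub>r, 0, \<dots>)\<close> without loss of generality. Let \<open>z\<close> lie in a gap of the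
  spectrum. Invariance under reflections in coordinate planes bounds fourth moments of the entries
  of \<open>(z - X\<^sub>n)\<^sup>-\<^sup>1\<close> by \<open>O(n\<^sup>-\<^sup>2)\<close>, apart from the mean on the diagonal; by Borel-Cantelli the corner
  of size \<open>r\<close> of the resolvent converges almost surely to \<open>G(z)\<close> times the identity. If \<open>m\<close> eigenvalues of
  \<open>X\<^sub>n\<close> exceed \<open>z\<close>, a Schur complement argument then places the eigenvalue of index \<open>m + i\<close> of \<open>X\<^sub>n + P\<^sub>n\<close> above
  or below \<open>z\<close> according as \<open>G(z) > 1/\<theta>\<^sub>i\<close> or \<open>G(z) < 1/\<theta>\<^sub>i\<close>. Since \<open>G\<close> decreases on the gap, testing
  all rational \<open>z\<close> locates the limit; the Weyl inequalities keep it from leaving the closed gap.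
\<close>

section \<open>Spectral decomposition of Hermitian matrices\<close>

text \<open>Second moments of the resolvent entries are only \<open>O(1/n)\<close>, which is not
  summable in \<open>n\<close>; fourth moments are the first even ones that are. The reflections are
  real, so orthogonal and unitary invariance are handled by one argument. The inverse of
  \<open>z - X n\<close> is unbounded when an eigenvalue comes near \<open>z\<close>, so moments are
  taken of \<open>h(X n)\<close> for a bounded continuous \<open>h\<close> that agrees with
  \<open>1 / (z - x)\<close> away from \<open>z\<close>. The mean on the diagonal is never computed:
  each diagonal entry is compared with the normalised trace, whose limit is given by weak
  convergence. The positions of the perturbed eigenvalues come from dimension counts: a homogeneous
  system with more unknowns than equations supplies a test vector, so repeated values of
  \<open>\<theta>\<close> need no separate treatment. Null sets depend on \<open>z\<close>, which is
  why only countably many \<open>z\<close> are tested. Points of the gap cannot stop an eigenvalue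
  from escaping through the edge it converges to; this is where the Weyl inequalities are
  needed.\<close>

lemma homogeneous_system_nontrivial_solution:
  fixes A :: "'f \<Rightarrow> 'i \<Rightarrow> 'a::field"
  assumes "finite F" "finite I" "card F < card I"
  shows "\<exists>x. (\<exists>i\<in>I. x i \<noteq> 0) \<and> (\<forall>f\<in>F. (\<Sum>i\<in>I. A f i * x i) = 0)"
  using assms
proof (induction F arbitrary: I A rule: finite_induct)
  case empty
  then obtain i where "i \<in> I" by fastforce
  then show ?case by (intro exI[of _ "\<lambda>_. 1"]) auto
next
  case (insert g F)
  show ?case
  proof (cases "\<forall>i\<in>I. A g i = 0")
    case True
    have "card F < card I" using insert by simp
    from insert.IH[OF insert.prems(1) this, of A]
    obtain x where x: "\<exists>i\<in>I. x i \<noteq> 0" "\<forall>f\<in>F. (\<Sum>i\<in>I. A f i * x i) = 0"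
      by auto
    then show ?thesis using True by (intro exI[of _ x]) auto
  next
    case False
    then obtain q where q: "q \<in> I" "A g q \<noteq> 0" by auto
    let ?J = "I - {q}"
    \<comment> \<open>Gaussian elimination: equation \<open>g\<close> is solved for the unknown
      \<open>q\<close> and substituted into the others; \<open>y\<close> below restores the
      eliminated coordinate.\<close>
    let ?B = "\<lambda>f i. A f i - A f q * A g i / A g q"
    have fJ: "finite ?J" using insert by simp
    have "card F < card ?J" using insert q by simp
    from insert.IH[OF fJ this, of ?B]
    obtain x where x: "\<exists>i\<in>?J. x i \<noteq> 0" "\<And>f. f\<in>F \<Longrightarrow> (\<Sum>i\<in>?J. ?B f i * x i) = 0"
      by blast
    define y where "y = x(q := - (\<Sum>i\<in>?J. A g i * x i) / A g q)"
    have sum_y: "(\<Sum>i\<in>I. A f i * y i)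
        = A f q * (- (\<Sum>i\<in>?J. A g i * x i) / A g q) + (\<Sum>i\<in>?J. A f i * x i)" for f
    proof -
      have "(\<Sum>i\<in>?J. A f i * y i) = (\<Sum>i\<in>?J. A f i * x i)"
        by (rule sum.cong) (auto simp: y_def)
      then show ?thesis
        using sum.remove[OF insert.prems(1) q(1), of "\<lambda>i. A f i * y i"] by (simp add: y_def)
    qed
    have "(\<Sum>i\<in>I. A f i * y i) = 0" if "f \<in> insert g F" for f
    proof (cases "f = g")
      case True
      then show ?thesis using q by (simp add: sum_y)
    next
      case False
      then have "(\<Sum>i\<in>?J. ?B f i * x i) = 0" using x that by blast
      then have "(\<Sum>i\<in>?J. A f i * x i) = (\<Sum>i\<in>?J. A f q * A g i / A g q * x i)"
        by (simp add: left_diff_distrib sum_subtractf)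
      also have "\<dots> = A f q * (\<Sum>i\<in>?J. A g i * x i) / A g q"
        by (simp add: sum_distrib_left sum_divide_distrib mult_ac)
      finally show ?thesis by (simp add: sum_y)
    qed
    moreover have "\<exists>i\<in>I. y i \<noteq> 0" using x(1) by (auto simp: y_def)
    ultimately show ?thesis by blast
  qed
qed

section \<open>Standard inner product and existence of eigenvectors\<close>

definition mat_vec :: "nat \<Rightarrow> (nat \<Rightarrow> nat \<Rightarrow> complex) \<Rightarrow> (nat \<Rightarrow> complex) \<Rightarrow> nat \<Rightarrow> complex"
  where "mat_vec n A x = (\<lambda>k. \<Sum>j<n. A k j * x j)"

definition inner_n :: "nat \<Rightarrow> (nat \<Rightarrow> complex) \<Rightarrow> (nat \<Rightarrow> complex) \<Rightarrow> complex"
  where "inner_n n x y = (\<Sum>k<n. cnj (x k) * y k)"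

lemma inner_n_mat_vec:
  assumes "hermitian_n n A"
  shows "inner_n n x (mat_vec n A y) = inner_n n (mat_vec n A x) y"
proof -
  have "inner_n n x (mat_vec n A y) = (\<Sum>k<n. \<Sum>j<n. cnj (x k) * (A k j * y j))"
    by (simp add: inner_n_def mat_vec_def sum_distrib_left)
  also have "\<dots> = (\<Sum>j<n. \<Sum>k<n. cnj (x k) * (A k j * y j))"
    by (rule sum.swap)
  also have "\<dots> = (\<Sum>j<n. \<Sum>k<n. cnj (A j k * x k) * y j)"
  proof (intro sum.cong refl)
    fix j k assume "j \<in> {..<n}" "k \<in> {..<n}"
    then have "A k j = cnj (A j k)" using assms unfolding hermitian_n_def by blast
    then show "cnj (x k) * (A k j * y j) = cnj (A j k * x k) * y j" by simp
  qed
  also have "\<dots> = inner_n n (mat_vec n A x) y"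
    by (simp add: inner_n_def mat_vec_def sum_distrib_right)
  finally show ?thesis .
qed

lemma inner_n_cnj: "cnj (inner_n n x y) = inner_n n y x"
  by (simp add: inner_n_def mult.commute)

lemma inner_n_self: "inner_n n x x = of_real (\<Sum>k<n. (cmod (x k))\<^sup>2)"
proof -
  have "cnj z * z = of_real ((cmod z)\<^sup>2)" for z
    using complex_norm_square[of z] by (metis mult.commute)
  then show ?thesis unfolding inner_n_def of_real_sum by presburger
qed

lemma inner_n_self_eq_0: "inner_n n x x = 0 \<longleftrightarrow> (\<forall>k<n. x k = 0)"
proof -
  have "inner_n n x x = 0 \<longleftrightarrow> (\<Sum>k<n. (cmod (x k))\<^sup>2) = 0"
    by (simp only: inner_n_self of_real_eq_0_iff)
  also have "\<dots> \<longleftrightarrow> (\<forall>k<n. x k = 0)"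
    by (subst sum_nonneg_eq_0_iff) auto
  finally show ?thesis .
qed

lemma inner_n_cong_right: "(\<And>k. k < n \<Longrightarrow> y k = y' k) \<Longrightarrow> inner_n n x y = inner_n n x y'"
  by (simp add: inner_n_def)

lemma inner_n_cong_left: "(\<And>k. k < n \<Longrightarrow> y k = y' k) \<Longrightarrow> inner_n n y x = inner_n n y' x"
  by (simp add: inner_n_def)

lemma inner_n_scale_right: "inner_n n x (\<lambda>k. z * y k) = z * inner_n n x y"
  by (simp add: inner_n_def sum_distrib_left mult_ac)

lemma inner_n_scale_left: "inner_n n (\<lambda>k. z * x k) y = cnj z * inner_n n x y"
  by (simp add: inner_n_def sum_distrib_left mult_ac)

lemma inner_n_diff_right: "inner_n n x (\<lambda>k. y k - y' k) = inner_n n x y - inner_n n x y'"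
  by (simp add: inner_n_def algebra_simps sum_subtractf)

lemma mat_vec_funpow_shift:
  "(mat_vec n A ^^ t) (\<lambda>k. mat_vec n A x k - z * x k) =
     (\<lambda>k. (mat_vec n A ^^ Suc t) x k - z * (mat_vec n A ^^ t) x k)"
proof (induction t)
  case (Suc t)
  show ?case
    apply (subst funpow.simps, subst o_apply, subst Suc)
    by (simp add: mat_vec_def algebra_simps sum_subtractf sum_distrib_left fun_eq_iff)
qed simp

text \<open>With \<open>s t\<close> a coordinate of \<open>A^t x\<close>, this reads
  \<open>p(A) x = q(A) (A - z) x\<close> for \<open>p = (T - z) q\<close>. Scalar sequences avoid
  forming polynomials of matrices.\<close>

lemma sum_coeff_mult_linear:
  fixes q :: "complex poly" and s :: "nat \<Rightarrow> complex"
  assumes "q \<noteq> 0"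
  shows "(\<Sum>t\<le>degree ([:-z, 1:] * q). coeff ([:-z, 1:] * q) t * s t)
     = (\<Sum>t\<le>degree q. coeff q t * (s (Suc t) - z * s t))"
proof -
  let ?p = "[:-z, 1:] * q"
  have deg: "degree ?p = Suc (degree q)"
    using assms by (subst degree_mult_eq) auto
  have p: "?p = pCons 0 q - Polynomial.smult z q" by simp
  have "(\<Sum>t\<le>degree ?p. coeff ?p t * s t)
     = (\<Sum>t\<le>Suc (degree q). coeff (pCons 0 q) t * s t) - (\<Sum>t\<le>Suc (degree q). z * coeff q t * s t)"
    unfolding deg unfolding p by (simp only: coeff_diff coeff_smult left_diff_distrib sum_subtractf)
  also have "(\<Sum>t\<le>Suc (degree q). coeff (pCons 0 q) t * s t) = (\<Sum>t\<le>degree q. coeff q t * s (Suc t))"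
    by (subst sum.atMost_Suc_shift) simp
  also have "(\<Sum>t\<le>Suc (degree q). z * coeff q t * s t) = (\<Sum>t\<le>degree q. z * coeff q t * s t)"
    by (simp add: coeff_eq_0)
  finally show ?thesis by (simp add: algebra_simps sum_subtractf)
qed

text \<open>Roots of \<open>p\<close> are split off one at a time: for a root \<open>z\<close>,
  either \<open>x\<close> is an eigenvector or \<open>(A - z) x\<close> is a nonzero vector
  annihilated by a polynomial of lower degree. \<open>V\<close> only has to be stable under
  \<open>A - z\<close>, so the eigenvector can be found inside an orthogonal complement.\<close>

lemma invariant_subspace_eigenvector:
  fixes p :: "complex poly"
  assumes V: "\<And>x z. V x \<Longrightarrow> V (\<lambda>k. mat_vec n A x k - z * x k)"
    and "p \<noteq> 0" "V x" "\<exists>l<n. x l \<noteq> 0"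
    and "\<forall>l<n. (\<Sum>t\<le>degree p. coeff p t * (mat_vec n A ^^ t) x l) = 0"
  shows "\<exists>y z. V y \<and> (\<exists>l<n. y l \<noteq> 0) \<and> (\<forall>l<n. mat_vec n A y l = z * y l)"
  using assms(2-)
proof (induction "degree p" arbitrary: p x)
  case 0
  then obtain c where "p = [:c:]" by (metis degree_eq_zeroE)
  with 0 show ?case by auto
next
  case (Suc N)
  have "\<not> constant (poly p)" using Suc(2) by (simp add: constant_degree)
  then obtain z where "poly p z = 0" using fundamental_theorem_of_algebra by blast
  then obtain q where q: "p = [:-z, 1:] * q" by (auto simp: poly_eq_0_iff_dvd)
  have q0: "q \<noteq> 0" using q Suc.prems by auto
  have degp: "degree p = Suc (degree q)" unfolding q using q0 by (subst degree_mult_eq) auto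
  define x' where "x' = (\<lambda>k. mat_vec n A x k - z * x k)"
  show ?case
  proof (cases "\<exists>l<n. x' l \<noteq> 0")
    case False
    then have "\<forall>l<n. mat_vec n A x l = z * x l" by (simp add: x'_def)
    then show ?thesis using Suc.prems by blast
  next
    case True
    have "(\<Sum>t\<le>degree q. coeff q t * (mat_vec n A ^^ t) x' l) = 0" if "l < n" for l
      using Suc.prems(4) that sum_coeff_mult_linear[OF q0, of z "\<lambda>t. (mat_vec n A ^^ t) x l"]
      unfolding q x'_def mat_vec_funpow_shift by simp
    then show ?thesis
      using Suc.hyps(1)[of q x'] Suc.hyps(2) degp q0 True V[OF Suc.prems(2)] by (simp add: x'_def)
  qed
qed

text \<open>The \<open>n + 1\<close> vectors \<open>x, A x, ..., A^n x\<close> lie in dimension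
  \<open>n\<close>, so they satisfy a nontrivial linear relation.\<close>

lemma exists_annihilating_poly:
  "\<exists>p :: complex poly. p \<noteq> 0 \<and> (\<forall>l<n. (\<Sum>t\<le>degree p. coeff p t * (mat_vec n A ^^ t) x l) = 0)"
proof -
  obtain c where c: "\<exists>t\<le>n. c t \<noteq> 0" "\<And>l. l < n \<Longrightarrow> (\<Sum>t\<le>n. (mat_vec n A ^^ t) x l * c t) = 0"
    using homogeneous_system_nontrivial_solution[of "{..<n}" "{..n}" "\<lambda>l t. (mat_vec n A ^^ t) x l"]
    by auto
  define p where "p = (\<Sum>t\<le>n. monom (c t) t)"
  have coeff_p: "coeff p t = (if t \<le> n then c t else 0)" for t
    by (auto simp: p_def coeff_sum if_distrib cong: if_cong)
  then have deg: "degree p \<le> n" by (simp add: degree_le)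
  have "p \<noteq> 0" using c(1) coeff_p by (metis coeff_0)
  moreover have "(\<Sum>t\<le>degree p. coeff p t * (mat_vec n A ^^ t) x l) = 0" if "l < n" for l
  proof -
    have "(\<Sum>t\<le>degree p. coeff p t * (mat_vec n A ^^ t) x l) = (\<Sum>t\<le>n. coeff p t * (mat_vec n A ^^ t) x l)"
      by (rule sum.mono_neutral_left) (use deg in \<open>auto simp: coeff_eq_0\<close>)
    also have "\<dots> = (\<Sum>t\<le>n. (mat_vec n A ^^ t) x l * c t)"
      by (rule sum.cong) (auto simp: coeff_p)
    finally show ?thesis using c(2)[OF that] by simp
  qed
  ultimately show ?thesis by blast
qed

text \<open>The orthogonal complement of eigenvectors with real eigenvalues is stable under
  \<open>A\<close>, so \<open>invariant_subspace_eigenvector\<close> applies to it. The flag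
  \<open>real_case\<close> lets one induction serve symmetric and Hermitian matrices.\<close>

lemma hermitian_eigenvector_orthogonal:
  assumes herm: "hermitian_n n A" and "k < n"
    and u: "\<And>i l. i < k \<Longrightarrow> l < n \<Longrightarrow> mat_vec n A (u i) l = of_real (lam i) * u i l"
    and re: "real_case \<Longrightarrow> real_entries_n n A \<and> (\<forall>i<k. \<forall>l<n. u i l \<in> \<real>)"
  shows "\<exists>y z. inner_n n y y = 1 \<and> (\<forall>i<k. inner_n n (u i) y = 0)
    \<and> (\<forall>l<n. mat_vec n A y l = of_real z * y l) \<and> (real_case \<longrightarrow> (\<forall>l<n. y l \<in> \<real>))"
proof -
  let ?V = "\<lambda>x. \<forall>i<k. inner_n n (u i) x = 0"
  have inv: "?V (\<lambda>k. mat_vec n A x k - z * x k)" if "?V x" for x z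
  proof (intro allI impI)
    fix i assume i: "i < k"
    have "inner_n n (u i) (mat_vec n A x) = inner_n n (\<lambda>l. of_real (lam i) * u i l) x"
      unfolding inner_n_mat_vec[OF herm] by (rule inner_n_cong_left) (use u i in auto)
    then show "inner_n n (u i) (\<lambda>k. mat_vec n A x k - z * x k) = 0"
      using that i by (simp add: inner_n_diff_right inner_n_scale_right inner_n_scale_left)
  qed
  obtain x0 where x0: "\<exists>l<n. x0 l \<noteq> 0" "?V x0"
    using homogeneous_system_nontrivial_solution[of "{..<k}" "{..<n}" "\<lambda>i l. cnj (u i l)"] \<open>k < n\<close>
    by (auto simp: inner_n_def)
  obtain p :: "complex poly" where p: "p \<noteq> 0" "\<forall>l<n. (\<Sum>t\<le>degree p. coeff p t * (mat_vec n A ^^ t) x0 l) = 0"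
    using exists_annihilating_poly by blast
  obtain y z where y: "?V y" "\<exists>l<n. y l \<noteq> 0" "\<And>l. l < n \<Longrightarrow> mat_vec n A y l = z * y l"
    using invariant_subspace_eigenvector[of ?V, OF inv p(1) x0(2,1) p(2)] by blast
  have y0: "inner_n n y y \<noteq> 0" using y(2) by (auto simp: inner_n_self_eq_0)
  have "z * inner_n n y y = inner_n n y (mat_vec n A y)"
    using y(3) by (simp add: inner_n_scale_right[symmetric] cong: inner_n_cong_right)
  also have "\<dots> = cnj z * inner_n n y y"
    unfolding inner_n_mat_vec[OF herm]
    using y(3) by (simp add: inner_n_scale_left[symmetric] cong: inner_n_cong_left)
  finally have zr: "z = of_real (Re z)"
    using y0 by (metis Reals_cnj_iff mult_cancel_right of_real_Re)
  have "\<exists>y. ?V y \<and> (\<exists>l<n. y l \<noteq> 0) \<and> (\<forall>l<n. mat_vec n A y l = z * y l)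
     \<and> (real_case \<longrightarrow> (\<forall>l<n. y l \<in> \<real>))"
  proof (cases real_case)
    case False
    then show ?thesis using y by blast
  next
    case True
    have conj: "inner_n n (u i) (\<lambda>l. cnj (y l)) = 0" if "i < k" for i
    proof -
      have "inner_n n (u i) (\<lambda>l. cnj (y l)) = cnj (inner_n n (u i) y)"
        unfolding inner_n_def using re[OF True] that by (auto simp: Reals_cnj_iff intro!: sum.cong)
      then show ?thesis using y(1) that by simp
    qed
    have conjA: "mat_vec n A (\<lambda>l. cnj (y l)) l = z * cnj (y l)" if "l < n" for l
    proof -
      have "mat_vec n A (\<lambda>l. cnj (y l)) l = cnj (mat_vec n A y l)"
        unfolding mat_vec_def using re[OF True] that
        by (auto simp: Reals_cnj_iff real_entries_n_def intro!: sum.cong)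
      then show ?thesis using y(3)[OF that] zr by (metis complex_cnj_complex_of_real complex_cnj_mult)
    qed
    \<comment> \<open>Since \<open>z\<close> is real, the conjugate of \<open>y\<close> is an
      eigenvector in the same complement. Up to factors 2 and -2, \<open>a\<close> and
      \<open>b\<close> are the real and imaginary parts of \<open>y\<close>, which cannot both
      vanish.\<close>
    define a where "a = (\<lambda>l. y l + cnj (y l))"
    define b where "b = (\<lambda>l. \<i> * (y l - cnj (y l)))"
    have Va: "?V a" "?V b"
      using y(1) conj by (auto simp: a_def b_def inner_n_def algebra_simps sum.distrib sum_subtractf
        sum_distrib_left[symmetric])
    have Ea: "\<forall>l<n. mat_vec n A a l = z * a l"
      using y(3) conjA by (simp add: a_def mat_vec_def algebra_simps sum.distrib)
    have Eb: "\<forall>l<n. mat_vec n A b l = z * b l"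
    proof (intro allI impI)
      fix l assume "l < n"
      have "mat_vec n A b l = \<i> * (mat_vec n A y l - mat_vec n A (\<lambda>l. cnj (y l)) l)"
        by (simp add: b_def mat_vec_def algebra_simps sum_subtractf sum_distrib_left)
      then show "mat_vec n A b l = z * b l"
        using y(3) conjA \<open>l < n\<close> by (simp add: b_def algebra_simps)
    qed
    have R: "a l \<in> \<real>" "b l \<in> \<real>" for l
      by (auto simp: a_def b_def complex_is_Real_iff)
    have "(\<exists>l<n. a l \<noteq> 0) \<or> (\<exists>l<n. b l \<noteq> 0)"
      using y(2) by (auto simp: a_def b_def complex_eq_iff)
    then show ?thesis using Va Ea Eb R by blast
  qed
  then obtain y where y: "?V y" "\<exists>l<n. y l \<noteq> 0" "\<And>l. l < n \<Longrightarrow> mat_vec n A y l = z * y l"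
     "real_case \<longrightarrow> (\<forall>l<n. y l \<in> \<real>)" by blast
  define s where "s = (\<Sum>k<n. (cmod (y k))\<^sup>2)"
  have "inner_n n y y \<noteq> 0" using y(2) by (auto simp: inner_n_self_eq_0)
  then have "s \<noteq> 0" unfolding inner_n_self s_def by (metis of_real_0)
  then have s: "s > 0" unfolding s_def by (simp add: sum_nonneg order_less_le)
  define c where "c = 1 / sqrt s"
  define w where "w = (\<lambda>l. complex_of_real c * y l)"
  have "inner_n n w w = of_real c * (of_real c * of_real s)"
    unfolding w_def by (simp only: inner_n_scale_left inner_n_scale_right)
      (simp only: inner_n_self s_def complex_cnj_complex_of_real)
  also have "\<dots> = 1"
    unfolding of_real_mult[symmetric] using s by (simp add: c_def)
  finally have "inner_n n w w = 1" .
  moreover have "\<forall>i<k. inner_n n (u i) w = 0" using y(1) by (simp add: w_def inner_n_scale_right)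
  moreover have "mat_vec n A w l = of_real (Re z) * w l" if "l < n" for l
  proof -
    have "mat_vec n A w l = of_real c * mat_vec n A y l"
      by (simp add: w_def mat_vec_def sum_distrib_left mult_ac)
    then show ?thesis using y(3)[OF that] zr by (simp add: w_def)
  qed
  moreover have "real_case \<longrightarrow> (\<forall>l<n. w l \<in> \<real>)"
    using y(4) by (auto simp: w_def)
  ultimately show ?thesis by blast
qed

text \<open>\<open>unitary_n\<close> speaks of rows. Orthonormality of the columns rests on the fact
  that a one-sided inverse of a square matrix is two-sided.\<close>

lemma unitary_n_adjoint:
  assumes "unitary_n n U"
  shows "unitary_n n (\<lambda>i j. cnj (U j i))"
proof -
  let ?A = "mat n n (\<lambda>(i, j). U i j)" and ?B = "mat n n (\<lambda>(i, j). cnj (U j i))"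
  have "?A * ?B = 1\<^sub>m n"
    using assms by (intro eq_matI) (auto simp: unitary_n_def scalar_prod_def lessThan_atLeast0)
  then have BA: "?B * ?A = 1\<^sub>m n"
    by (rule mat_mult_left_right_inverse[rotated 2]) auto
  have "(\<Sum>k<n. cnj (U k i) * U k j) = (if i = j then 1 else 0)" if "i < n" "j < n" for i j
    using arg_cong[OF BA, of "\<lambda>M. M $$ (i, j)"] that by (auto simp: scalar_prod_def lessThan_atLeast0)
  then show ?thesis by (simp add: unitary_n_def)
qed

lemma unitary_n_cols:
  assumes "unitary_n n U" "i < n" "j < n"
  shows "(\<Sum>k<n. cnj (U k i) * U k j) = (if i = j then 1 else 0)"
  using unitary_n_adjoint[OF assms(1)] assms(2,3) by (simp add: unitary_n_def)

section \<open>Diagonalisation and the sorted spectrum\<close>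

definition eig_decomp :: "nat \<Rightarrow> (nat \<Rightarrow> nat \<Rightarrow> complex) \<Rightarrow> (nat \<Rightarrow> nat \<Rightarrow> complex) \<Rightarrow> (nat \<Rightarrow> real) \<Rightarrow> bool"
  where "eig_decomp n A U lam \<longleftrightarrow> unitary_n n U \<and>
    (\<forall>k<n. \<forall>l<n. A k l = (\<Sum>i<n. of_real (lam i) * (U k i * cnj (U l i))))"

lemma hermitian_orthonormal_eigenvectors:
  assumes herm: "hermitian_n n A" and re: "real_case \<Longrightarrow> real_entries_n n A" and "k \<le> n"
  shows "\<exists>u lam. (\<forall>i<k. \<forall>j<k. inner_n n (u i) (u j) = (if i = j then 1 else 0)) \<and>
    (\<forall>i<k. \<forall>l<n. mat_vec n A (u i) l = of_real (lam i) * u i l) \<and>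
    (real_case \<longrightarrow> (\<forall>i<k. \<forall>l<n. u i l \<in> \<real>))"
  using \<open>k \<le> n\<close>
proof (induction k)
  case (Suc k)
  have "k \<le> n" using Suc.prems by simp
  from Suc.IH[OF this] obtain u lam where u: "\<forall>i<k. \<forall>j<k. inner_n n (u i) (u j) = (if i = j then 1 else 0)"
    "\<And>i l. i < k \<Longrightarrow> l < n \<Longrightarrow> mat_vec n A (u i) l = complex_of_real (lam i) * u i l"
    "real_case \<longrightarrow> (\<forall>i<k. \<forall>l<n. u i l \<in> \<real>)" by blast
  obtain y z where y: "inner_n n y y = 1" "\<forall>i<k. inner_n n (u i) y = 0"
    "\<forall>l<n. mat_vec n A y l = complex_of_real z * y l" "real_case \<longrightarrow> (\<forall>l<n. y l \<in> \<real>)"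
    using hermitian_eigenvector_orthogonal[where real_case = real_case and u = u and lam = lam and k = k,
      OF herm _ u(2)] u(3) re Suc.prems by auto
  have "\<forall>i<k. inner_n n y (u i) = 0"
    using y(2) by (metis inner_n_cnj complex_cnj_zero)
  then show ?case
    using u y by (intro exI[of _ "u(k := y)"] exI[of _ "lam(k := z)"]) (auto simp: less_Suc_eq)
qed auto

lemma hermitian_eig_decomp_unsorted:
  assumes herm: "hermitian_n n A" and re: "real_case \<Longrightarrow> real_entries_n n A"
  shows "\<exists>U lam. eig_decomp n A U lam \<and> (real_case \<longrightarrow> real_entries_n n U)"
proof -
  obtain u lam where u: "\<forall>i<n. \<forall>j<n. inner_n n (u i) (u j) = (if i = j then 1 else 0)"
    "\<And>i l. i < n \<Longrightarrow> l < n \<Longrightarrow> mat_vec n A (u i) l = complex_of_real (lam i) * u i l"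
    "real_case \<longrightarrow> (\<forall>i<n. \<forall>l<n. u i l \<in> \<real>)"
    using hermitian_orthonormal_eigenvectors[of n A real_case n, OF herm re order_refl] by blast
  let ?U = "\<lambda>l i. u i l"
  have cols: "unitary_n n (\<lambda>i l. cnj (u i l))"
    using u(1) by (auto simp: unitary_n_def inner_n_def)
  have uni: "unitary_n n ?U"
    using unitary_n_adjoint[OF cols] by simp
  have "A k l = (\<Sum>i<n. of_real (lam i) * (u i k * cnj (u i l)))" if "k < n" "l < n" for k l
  proof -
    have "(\<Sum>i<n. of_real (lam i) * (u i k * cnj (u i l))) = (\<Sum>i<n. mat_vec n A (u i) k * cnj (u i l))"
      using u(2) that by (simp add: mult.assoc)
    also have "\<dots> = (\<Sum>i<n. \<Sum>j<n. A k j * (u i j * cnj (u i l)))"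
      by (simp add: mat_vec_def sum_distrib_right mult.assoc)
    also have "\<dots> = (\<Sum>j<n. \<Sum>i<n. A k j * (u i j * cnj (u i l)))"
      by (rule sum.swap)
    also have "\<dots> = (\<Sum>j<n. if j = l then A k j else 0)"
      using uni that by (intro sum.cong refl) (auto simp: unitary_n_def sum_distrib_left[symmetric])
    also have "\<dots> = A k l" using that by simp
    finally show ?thesis by simp
  qed
  then show ?thesis using uni u(3)
    by (intro exI[of _ ?U] exI[of _ lam]) (auto simp: eig_decomp_def real_entries_n_def)
qed

lemma eig_decomp_char_poly:
  assumes "eig_decomp n A U lam"
  shows "char_poly (to_mat n A) = (\<Prod>i\<leftarrow>[0..<n]. [:- of_real (lam i), 1:])"
proof -
  let ?U = "mat n n (\<lambda>(i, j). U i j)" and ?V = "mat n n (\<lambda>(i, j). cnj (U j i))"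
  let ?D = "mat n n (\<lambda>(i, j). if i = j then complex_of_real (lam i) else 0)"
  have uni: "unitary_n n U" using assms by (simp add: eig_decomp_def)
  have UV: "?U * ?V = 1\<^sub>m n"
    using uni by (intro eq_matI) (auto simp: unitary_n_def scalar_prod_def lessThan_atLeast0)
  then have VU: "?V * ?U = 1\<^sub>m n"
    by (rule mat_mult_left_right_inverse[rotated 2]) auto
  have UD: "?U * ?D = mat n n (\<lambda>(i, j). U i j * of_real (lam j))"
    by (intro eq_matI) (auto simp: scalar_prod_def if_distrib cong: if_cong)
  have "to_mat n A = ?U * ?D * ?V"
    unfolding UD using assms
    by (intro eq_matI) (auto simp: to_mat_def scalar_prod_def eig_decomp_def lessThan_atLeast0 mult_ac)
  then have "similar_mat (to_mat n A) ?D"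
    using UV VU by (intro similar_matI[of _ _ ?U ?V n]) (auto simp: to_mat_def)
  then have "char_poly (to_mat n A) = char_poly ?D" by (rule char_poly_similar)
  also have "\<dots> = (\<Prod>a\<leftarrow>diag_mat ?D. [:- a, 1:])"
    by (rule char_poly_upper_triangular) auto
  also have "diag_mat ?D = map (\<lambda>i. of_real (lam i)) [0..<n]"
    by (auto simp: diag_mat_def)
  finally show ?thesis by (simp add: o_def)
qed

text \<open>Ties the eigenvalues of any decomposition, in whatever order \<open>lam\<close> lists
  them, to the roots of the characteristic polynomial.\<close>

lemma eig_decomp_mset_eigs_desc:
  assumes "eig_decomp n A U lam"
  shows "mset (eigs_desc n A) = mset (map lam [0..<n])"
proof -
  have "proots (\<Prod>i\<leftarrow>xs. [:- of_real (lam i), 1::complex:]) = mset (map (\<lambda>i. of_real (lam i)) xs)" for xs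
  proof (induction xs)
    case (Cons x xs)
    have "(\<Prod>i\<leftarrow>xs. [:- of_real (lam i), 1::complex:]) \<noteq> 0" by (auto simp: prod_list_zero_iff)
    then have "proots (\<Prod>i\<leftarrow>(x#xs). [:- of_real (lam i), 1::complex:])
        = proots [:- of_real (lam x), 1::complex:] + proots (\<Prod>i\<leftarrow>xs. [:- of_real (lam i), 1::complex:])"
      unfolding list.map prod_list.Cons by (intro proots_mult) auto
    also have "proots [:- of_real (lam x), 1::complex:] = {#of_real (lam x)#}"
      using proots_linear_factor[of "- of_real (lam x)"] by simp
    finally show ?case using Cons by simp
  qed simp
  then show ?thesis
    by (simp add: eigs_desc_def eig_decomp_char_poly[OF assms] image_mset.compositionality o_def)
qed

text \<open>The permutation that sorts the eigenvalues is applied to the columns of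
  \<open>U\<close>, which yields a matching eigenbasis. \<open>Suc\<close> passes from 0-based
  columns to the 1-based \<open>eig\<close>.\<close>

lemma hermitian_eig_decomp:
  assumes herm: "hermitian_n n A" and re: "real_case \<Longrightarrow> real_entries_n n A"
  shows "\<exists>U. eig_decomp n A U (\<lambda>i. eig n A (Suc i)) \<and> (real_case \<longrightarrow> real_entries_n n U)"
    and eig_antimono: "1 \<le> i \<Longrightarrow> i \<le> j \<Longrightarrow> j \<le> n \<Longrightarrow> eig n A j \<le> eig n A i"
proof -
  obtain U lam where U: "eig_decomp n A U lam" "real_case \<longrightarrow> real_entries_n n U"
    using hermitian_eig_decomp_unsorted[OF assms] by blast
  note ms = eig_decomp_mset_eigs_desc[OF U(1)]
  have len: "length (eigs_desc n A) = n" using arg_cong[OF ms, of size] by simp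
  have srt: "sorted (rev (eigs_desc n A))" by (simp add: eigs_desc_def)
  show "eig n A j \<le> eig n A i" if ij: "1 \<le> i" "i \<le> j" "j \<le> n"
    using sorted_nth_mono[OF srt, of "n - j" "n - i"] ij len
    by (simp add: eig_def rev_nth Suc_diff_le[symmetric] diff_diff_cancel)
  obtain \<pi> where \<pi>: "bij_betw \<pi> {..<n} {..<n}" "\<And>i. i < n \<Longrightarrow> eigs_desc n A ! i = lam (\<pi> i)"
  proof -
    obtain p where p: "p permutes {..<length (map lam [0..<n])}"
        "permute_list p (map lam [0..<n]) = eigs_desc n A"
      using mset_eq_permutation[OF ms] .
    show thesis
    proof (rule that)
      show "bij_betw p {..<n} {..<n}" using permutes_imp_bij[OF p(1)] by simp
      fix i assume "i < n"
      moreover have "p i < n" using permutes_in_image[OF p(1), of i] \<open>i < n\<close> by simp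
      ultimately show "eigs_desc n A ! i = lam (p i)"
        unfolding p(2)[symmetric] using permute_list_nth[OF p(1), of i] by simp
    qed
  qed
  have \<pi>n: "\<pi> i < n" if "i < n" for i using \<pi>(1) that by (auto simp: bij_betw_def)
  let ?U = "\<lambda>k i. U k (\<pi> i)"
  have "(\<Sum>k<n. U i (\<pi> k) * cnj (U j (\<pi> k))) = (\<Sum>k<n. U i k * cnj (U j k))" for i j
    by (rule sum.reindex_bij_betw[OF \<pi>(1)])
  then have "unitary_n n ?U" using U(1) by (simp add: eig_decomp_def unitary_n_def)
  moreover have "A k l = (\<Sum>i<n. of_real (eig n A (Suc i)) * (?U k i * cnj (?U l i)))"
    if "k < n" "l < n" for k l
  proof -
    have "A k l = (\<Sum>i<n. of_real (lam i) * (U k i * cnj (U l i)))"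
      using U(1) that by (simp add: eig_decomp_def)
    also have "\<dots> = (\<Sum>i<n. of_real (lam (\<pi> i)) * (U k (\<pi> i) * cnj (U l (\<pi> i))))"
      by (rule sum.reindex_bij_betw[OF \<pi>(1), symmetric])
    finally show ?thesis by (simp add: eig_def \<pi>(2))
  qed
  ultimately have "eig_decomp n A ?U (\<lambda>i. eig n A (Suc i))" by (simp add: eig_decomp_def)
  moreover have "real_case \<longrightarrow> real_entries_n n ?U"
    using U(2) \<pi>n by (auto simp: real_entries_n_def)
  ultimately show "\<exists>U. eig_decomp n A U (\<lambda>i. eig n A (Suc i)) \<and> (real_case \<longrightarrow> real_entries_n n U)"
    by blast
qed

section \<open>Eigenvalues under a diagonal perturbation\<close>

text \<open>The two blocks of equations may be indexed by different types, so the sum type merges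
  them. Meant for dimension counts that impose conditions of two kinds.\<close>

lemma homogeneous_system_two_families:
  fixes A :: "'f \<Rightarrow> 'i \<Rightarrow> 'a::field" and B :: "'g \<Rightarrow> 'i \<Rightarrow> 'a"
  assumes "finite F" "finite G" "finite I" "card F + card G < card I"
  shows "\<exists>x. (\<exists>i\<in>I. x i \<noteq> 0) \<and> (\<forall>f\<in>F. (\<Sum>i\<in>I. A f i * x i) = 0) \<and> (\<forall>g\<in>G. (\<Sum>i\<in>I. B g i * x i) = 0)"
proof -
  obtain x where x: "\<exists>i\<in>I. x i \<noteq> 0" "\<And>h. h \<in> F <+> G \<Longrightarrow> (\<Sum>i\<in>I. case_sum A B h i * x i) = 0"
    using homogeneous_system_nontrivial_solution[of "F <+> G" I "case_sum A B"] assms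
    by (auto simp: card_Plus)
  show ?thesis using x(1) x(2)[OF InlI] x(2)[OF InrI] by auto
qed

section \<open>Quadratic forms in eigenvector coordinates\<close>

definition coord :: "nat \<Rightarrow> (nat \<Rightarrow> nat \<Rightarrow> complex) \<Rightarrow> (nat \<Rightarrow> complex) \<Rightarrow> nat \<Rightarrow> complex"
  where "coord n U x i = (\<Sum>k<n. cnj (U k i) * x k)"

text \<open>Arbitrary weights \<open>w\<close> make one computation serve the inner product
  (\<open>w = 1\<close>), the form of \<open>A\<close> and the form of its resolvent.\<close>

lemma sesquilinear_coord:
  "(\<Sum>k<n. \<Sum>l<n. cnj (x k) * (\<Sum>i<n. w i * (U k i * cnj (U l i))) * y l)
     = (\<Sum>i<n. w i * (cnj (coord n U x i) * coord n U y i))"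
proof -
  have "(\<Sum>k<n. \<Sum>l<n. cnj (x k) * (\<Sum>i<n. w i * (U k i * cnj (U l i))) * y l)
      = (\<Sum>k<n. \<Sum>l<n. \<Sum>i<n. w i * ((U k i * cnj (x k)) * (cnj (U l i) * y l)))"
    by (simp add: sum_distrib_left sum_distrib_right mult_ac)
  also have "\<dots> = (\<Sum>k<n. \<Sum>i<n. \<Sum>l<n. w i * ((U k i * cnj (x k)) * (cnj (U l i) * y l)))"
    by (rule sum.cong[OF refl], rule sum.swap)
  also have "\<dots> = (\<Sum>i<n. \<Sum>k<n. \<Sum>l<n. w i * ((U k i * cnj (x k)) * (cnj (U l i) * y l)))"
    by (rule sum.swap)
  also have "\<dots> = (\<Sum>i<n. w i * ((\<Sum>k<n. U k i * cnj (x k)) * (\<Sum>l<n. cnj (U l i) * y l)))"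
    unfolding sum_product by (simp only: sum_distrib_left)
  finally show ?thesis by (simp add: coord_def)
qed

lemma inner_n_coord:
  assumes "unitary_n n U"
  shows "(\<Sum>i<n. cnj (coord n U x i) * coord n U y i) = inner_n n x y"
proof -
  have "(\<Sum>i<n. cnj (coord n U x i) * coord n U y i)
      = (\<Sum>k<n. \<Sum>l<n. cnj (x k) * (\<Sum>i<n. U k i * cnj (U l i)) * y l)"
    using sesquilinear_coord[where n = n and x = x and w = "\<lambda>_. 1" and U = U and y = y] by simp
  also have "\<dots> = (\<Sum>k<n. \<Sum>l<n. if l = k then cnj (x k) * y l else 0)"
    by (intro sum.cong refl) (use assms in \<open>auto simp: unitary_n_def\<close>)
  finally show ?thesis by (simp add: inner_n_def)
qed

definition normsq :: "nat \<Rightarrow> (nat \<Rightarrow> complex) \<Rightarrow> real"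
  where "normsq n x = (\<Sum>k<n. (cmod (x k))\<^sup>2)"

text \<open>The form \<open><x, A x>\<close> in eigenvector coordinates, where it is visibly
  real.\<close>

definition spec_form :: "nat \<Rightarrow> (nat \<Rightarrow> nat \<Rightarrow> complex) \<Rightarrow> (nat \<Rightarrow> real) \<Rightarrow> (nat \<Rightarrow> complex) \<Rightarrow> real"
  where "spec_form n U lam x = (\<Sum>i<n. lam i * (cmod (coord n U x i))\<^sup>2)"

lemma normsq_nonneg: "normsq n x \<ge> 0"
  by (simp add: normsq_def sum_nonneg)

lemma normsq_eq_0: "normsq n x = 0 \<longleftrightarrow> (\<forall>k<n. x k = 0)"
  unfolding normsq_def by (subst sum_nonneg_eq_0_iff) auto

lemma cnj_mult_self: "cnj z * z = of_real ((cmod z)\<^sup>2)"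
  using complex_norm_square[of z] by (metis mult.commute)

lemma normsq_coord:
  assumes "unitary_n n U"
  shows "normsq n x = (\<Sum>i<n. (cmod (coord n U x i))\<^sup>2)"
proof -
  have "complex_of_real (normsq n x) = inner_n n x x"
    by (simp only: normsq_def inner_n_self)
  also have "\<dots> = complex_of_real (\<Sum>i<n. (cmod (coord n U x i))\<^sup>2)"
    unfolding inner_n_coord[OF assms, symmetric] cnj_mult_self of_real_sum ..
  finally show ?thesis by (simp only: of_real_eq_iff)
qed

lemma spec_form_eq:
  assumes "eig_decomp n A U lam"
  shows "complex_of_real (spec_form n U lam x) = (\<Sum>k<n. \<Sum>l<n. cnj (x k) * A k l * x l)"
proof -
  have "(\<Sum>k<n. \<Sum>l<n. cnj (x k) * A k l * x l)
     = (\<Sum>k<n. \<Sum>l<n. cnj (x k) * (\<Sum>i<n. of_real (lam i) * (U k i * cnj (U l i))) * x l)"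
    using assms by (intro sum.cong refl) (auto simp: eig_decomp_def)
  also have "\<dots> = (\<Sum>i<n. of_real (lam i) * of_real ((cmod (coord n U x i))\<^sup>2))"
    unfolding sesquilinear_coord cnj_mult_self ..
  also have "\<dots> = complex_of_real (spec_form n U lam x)"
    unfolding spec_form_def of_real_sum of_real_mult ..
  finally show ?thesis ..
qed

definition add_diag :: "(nat \<Rightarrow> nat \<Rightarrow> complex) \<Rightarrow> (nat \<Rightarrow> real) \<Rightarrow> nat \<Rightarrow> nat \<Rightarrow> complex"
  where "add_diag A d = (\<lambda>k l. A k l + (if k = l then of_real (d k) else 0))"

lemma spec_form_add_diag:
  assumes "eig_decomp n A T lam" "eig_decomp n (add_diag A d) Z kap"
  shows "spec_form n Z kap x = spec_form n T lam x + (\<Sum>k<n. d k * (cmod (x k))\<^sup>2)"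
proof -
  have "(\<Sum>l<n. cnj (x k) * add_diag A d k l * x l)
     = (\<Sum>l<n. cnj (x k) * A k l * x l) + of_real (d k * (cmod (x k))\<^sup>2)" if "k < n" for k
  proof -
    have "(\<Sum>l<n. cnj (x k) * add_diag A d k l * x l)
      = (\<Sum>l<n. cnj (x k) * A k l * x l) + (\<Sum>l<n. if l = k then of_real (d k) * (cnj (x k) * x k) else 0)"
      unfolding sum.distrib[symmetric] by (intro sum.cong refl) (auto simp: add_diag_def algebra_simps)
    then show ?thesis unfolding cnj_mult_self using that by simp
  qed
  then have "complex_of_real (spec_form n Z kap x)
     = (\<Sum>k<n. (\<Sum>l<n. cnj (x k) * A k l * x l) + of_real (d k * (cmod (x k))\<^sup>2))"
    unfolding spec_form_eq[OF assms(2)] by (intro sum.cong refl) auto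
  also have "\<dots> = of_real (spec_form n T lam x + (\<Sum>k<n. d k * (cmod (x k))\<^sup>2))"
    unfolding sum.distrib spec_form_eq[OF assms(1), symmetric] by simp
  finally show ?thesis by (simp only: of_real_eq_iff)
qed

text \<open>This and \<open>spec_form_ge\<close> are the easy halves of the Courant-Fischer
  principle. Eigenvalues are compared by a vector lying in such a subspace for \<open>A\<close> and
  in another one for the perturbed matrix.\<close>

lemma spec_form_le:
  assumes "unitary_n n Z" "\<And>t. t < m \<Longrightarrow> t < n \<Longrightarrow> coord n Z x t = 0" "\<And>t. m \<le> t \<Longrightarrow> t < n \<Longrightarrow> kap t \<le> z"
  shows "spec_form n Z kap x \<le> z * normsq n x"
  unfolding spec_form_def normsq_coord[OF assms(1)] sum_distrib_left
proof (rule sum_mono)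
  fix t assume "t \<in> {..<n}"
  then show "kap t * (cmod (coord n Z x t))\<^sup>2 \<le> z * (cmod (coord n Z x t))\<^sup>2"
    using assms(2)[of t] assms(3)[of t] by (cases "t < m") (auto intro: mult_right_mono)
qed

lemma spec_form_ge:
  assumes "unitary_n n Z" "\<And>t. m \<le> t \<Longrightarrow> t < n \<Longrightarrow> coord n Z x t = 0" "\<And>t. t < m \<Longrightarrow> t < n \<Longrightarrow> kap t \<ge> z"
  shows "spec_form n Z kap x \<ge> z * normsq n x"
  unfolding spec_form_def normsq_coord[OF assms(1)] sum_distrib_left
proof (rule sum_mono)
  fix t assume "t \<in> {..<n}"
  then show "z * (cmod (coord n Z x t))\<^sup>2 \<le> kap t * (cmod (coord n Z x t))\<^sup>2"
    using assms(2)[of t] assms(3)[of t] by (cases "t < m") (auto intro: mult_right_mono)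
qed

lemma coord_linear_combination:
  assumes "unitary_n n U" "t < n"
  shows "coord n U (\<lambda>k. \<Sum>i<n. U k i * c i) t = c t"
proof -
  have "coord n U (\<lambda>k. \<Sum>i<n. U k i * c i) t = (\<Sum>k<n. \<Sum>i<n. cnj (U k t) * U k i * c i)"
    by (simp add: coord_def sum_distrib_left mult_ac)
  also have "\<dots> = (\<Sum>i<n. (\<Sum>k<n. cnj (U k t) * U k i) * c i)"
    unfolding sum_distrib_right by (rule sum.swap)
  also have "\<dots> = (\<Sum>i<n. if i = t then c i else 0)"
    using unitary_n_cols[OF assms] by (intro sum.cong refl) auto
  finally show ?thesis using assms(2) by simp
qed

text \<open>The error is at most \<open>e\<close> times the square of the sum of the
  \<open>cmod (y k)\<close>, and Cauchy-Schwarz bounds that square by \<open>s * normsq s y\<close>.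
  The factor \<open>s\<close> is harmless because the corner keeps a fixed size as \<open>n\<close>
  grows.\<close>

lemma quadratic_form_near_scalar:
  fixes y :: "nat \<Rightarrow> complex"
  assumes "\<And>k l. k < s \<Longrightarrow> l < s \<Longrightarrow> cmod (S k l - (if k = l then of_real g else 0)) \<le> e"
  shows "\<bar>Re (\<Sum>k<s. \<Sum>l<s. cnj (y k) * S k l * y l) - g * normsq s y\<bar> \<le> real s * e * normsq s y"
proof (cases "s = 0")
  case False
  have e: "e \<ge> 0" using assms[of 0 0] False norm_ge_zero order_trans by blast
  have "complex_of_real (g * normsq s y) = (\<Sum>k<s. \<Sum>l<s. if l = k then cnj (y k) * of_real g * y l else 0)"
    by (simp add: normsq_def sum_distrib_left mult_ac cnj_mult_self[symmetric] flip: of_real_power)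
  also have "\<dots> = (\<Sum>k<s. \<Sum>l<s. cnj (y k) * (if k = l then of_real g else 0) * y l)"
    by (intro sum.cong refl) auto
  finally have "(\<Sum>k<s. \<Sum>l<s. cnj (y k) * S k l * y l) - of_real (g * normsq s y)
      = (\<Sum>k<s. \<Sum>l<s. cnj (y k) * (S k l - (if k = l then of_real g else 0)) * y l)"
    by (simp add: algebra_simps sum_subtractf[symmetric])
  then have "cmod ((\<Sum>k<s. \<Sum>l<s. cnj (y k) * S k l * y l) - of_real (g * normsq s y))
      \<le> (\<Sum>k<s. \<Sum>l<s. cmod (y k) * e * cmod (y l))"
  proof (simp only:, intro sum_norm_le)
    fix k l assume "k \<in> {..<s}" "l \<in> {..<s}"
    then show "cmod (cnj (y k) * (S k l - (if k = l then of_real g else 0)) * y l) \<le> cmod (y k) * e * cmod (y l)"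
      unfolding norm_mult complex_mod_cnj by (intro mult_right_mono mult_left_mono assms) auto
  qed
  also have "\<dots> = e * (\<Sum>k<s. cmod (y k))\<^sup>2"
    by (simp add: power2_eq_square sum_product sum_distrib_left mult_ac)
  also have "\<dots> \<le> e * (real s * normsq s y)"
    using Cauchy_Schwarz_ineq_sum[of "\<lambda>_. 1" "\<lambda>k. cmod (y k)" "{..<s}"] e
    by (intro mult_left_mono) (auto simp: normsq_def)
  finally have "cmod ((\<Sum>k<s. \<Sum>l<s. cnj (y k) * S k l * y l) - of_real (g * normsq s y)) \<le> real s * e * normsq s y"
    by (simp add: mult_ac)
  moreover have "\<bar>Re (\<Sum>k<s. \<Sum>l<s. cnj (y k) * S k l * y l) - g * normsq s y\<bar>
    \<le> cmod ((\<Sum>k<s. \<Sum>l<s. cnj (y k) * S k l * y l) - of_real (g * normsq s y))"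
    using abs_Re_le_cmod[of "(\<Sum>k<s. \<Sum>l<s. cnj (y k) * S k l * y l) - of_real (g * normsq s y)"] by simp
  ultimately show ?thesis by linarith
qed (simp add: normsq_def)

text \<open>A Weyl inequality: the span of \<open>t + 1\<close> leading eigenvectors of
  \<open>A\<close> meets the orthogonal complement of the \<open>t\<close> leading ones of the
  perturbed matrix, and the form only grows under \<open>d \<ge> 0\<close>.\<close>

lemma eig_add_diag_ge:
  assumes T: "eig_decomp n A T lam" and Z: "eig_decomp n (add_diag A d) Z kap"
    and lam: "\<And>i j. i \<le> j \<Longrightarrow> j < n \<Longrightarrow> lam j \<le> lam i"
    and kap: "\<And>i j. i \<le> j \<Longrightarrow> j < n \<Longrightarrow> kap j \<le> kap i"
    and d: "\<And>k. k < n \<Longrightarrow> d k \<ge> 0" and t: "t < n"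
  shows "lam t \<le> kap t"
proof (rule ccontr)
  assume "\<not> ?thesis"
  have uT: "unitary_n n T" and uZ: "unitary_n n Z" using T Z by (auto simp: eig_decomp_def)
  obtain c where c: "\<exists>i\<le>t. c i \<noteq> 0"
    "\<And>f. f < t \<Longrightarrow> (\<Sum>i\<le>t. (\<Sum>k<n. cnj (Z k f) * T k i) * c i) = 0"
    using homogeneous_system_nontrivial_solution[of "{..<t}" "{..t}" "\<lambda>f i. \<Sum>k<n. cnj (Z k f) * T k i"]
    by auto
  define b where "b = (\<lambda>i. if i \<le> t then c i else 0)"
  define w where "w = (\<lambda>k. \<Sum>i<n. T k i * b i)"
  have cT: "coord n T w i = b i" if "i < n" for i
    unfolding w_def using that by (rule coord_linear_combination[OF uT])
  have "coord n Z w f = 0" if "f < t" for f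
  proof -
    have "coord n Z w f = (\<Sum>k<n. \<Sum>i<n. cnj (Z k f) * T k i * b i)"
      by (simp add: coord_def w_def sum_distrib_left mult_ac)
    also have "\<dots> = (\<Sum>i<n. (\<Sum>k<n. cnj (Z k f) * T k i) * b i)"
      unfolding sum_distrib_right by (rule sum.swap)
    also have "\<dots> = (\<Sum>i\<le>t. (\<Sum>k<n. cnj (Z k f) * T k i) * c i)"
      using t by (intro sum.mono_neutral_cong_right) (auto simp: b_def)
    finally show ?thesis using c(2)[OF that] by simp
  qed
  then have "spec_form n Z kap w \<le> kap t * normsq n w"
    using kap t by (intro spec_form_le[OF uZ, of t]) auto
  moreover have "spec_form n T lam w \<ge> lam t * normsq n w"
    using lam t cT by (intro spec_form_ge[OF uT, of "Suc t"]) (auto simp: b_def)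
  moreover have "spec_form n T lam w \<le> spec_form n Z kap w"
    unfolding spec_form_add_diag[OF T Z] using d by (auto intro!: sum_nonneg)
  moreover have "normsq n w > 0"
  proof -
    obtain i where "i \<le> t" "c i \<noteq> 0" using c(1) by auto
    then have "i < n" "coord n T w i \<noteq> 0" using t cT[of i] by (auto simp: b_def)
    then have "(\<Sum>i<n. (cmod (coord n T w i))\<^sup>2) \<noteq> 0" by (subst sum_nonneg_eq_0_iff) auto
    then show ?thesis using normsq_coord[OF uT, of w] normsq_nonneg[of n w] by linarith
  qed
  ultimately have "lam t * normsq n w \<le> kap t * normsq n w" by linarith
  then have "lam t \<le> kap t" using \<open>normsq n w > 0\<close> by simp
  with \<open>\<not> ?thesis\<close> show False by simp
qed

text \<open>The Weyl inequality for a perturbation of rank at most \<open>r\<close>. Besides being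
  orthogonal to \<open>t\<close> eigenvectors of \<open>A\<close>, the test vector vanishes on the
  first \<open>r\<close> coordinates and so does not see \<open>d\<close>: \<open>t + r\<close>
  equations against \<open>t + r + 1\<close> unknowns.\<close>

lemma eig_add_diag_shift_le:
  assumes T: "eig_decomp n A T lam" and Z: "eig_decomp n (add_diag A d) Z kap"
    and lam: "\<And>i j. i \<le> j \<Longrightarrow> j < n \<Longrightarrow> lam j \<le> lam i"
    and kap: "\<And>i j. i \<le> j \<Longrightarrow> j < n \<Longrightarrow> kap j \<le> kap i"
    and d: "\<And>k. r \<le> k \<Longrightarrow> k < n \<Longrightarrow> d k = 0" and t: "t + r < n"
  shows "kap (t + r) \<le> lam t"
proof (rule ccontr)
  assume "\<not> ?thesis"
  have uT: "unitary_n n T" and uZ: "unitary_n n Z" using T Z by (auto simp: eig_decomp_def)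
  obtain c where c: "\<exists>i\<le>t+r. c i \<noteq> 0"
    "\<And>f. f < t \<Longrightarrow> (\<Sum>i\<le>t+r. (\<Sum>k<n. cnj (T k f) * Z k i) * c i) = 0"
    "\<And>k. k < r \<Longrightarrow> (\<Sum>i\<le>t+r. Z k i * c i) = 0"
    using homogeneous_system_two_families[of "{..<t}" "{..<r}" "{..t+r}"
        "\<lambda>f i. \<Sum>k<n. cnj (T k f) * Z k i" "\<lambda>k i. Z k i"]
    by auto
  define b where "b = (\<lambda>i. if i \<le> t+r then c i else 0)"
  define w where "w = (\<lambda>k. \<Sum>i<n. Z k i * b i)"
  have sum_b: "(\<Sum>i<n. F i * b i) = (\<Sum>i\<le>t+r. F i * c i)" for F :: "nat \<Rightarrow> complex"
    using t by (intro sum.mono_neutral_cong_right) (auto simp: b_def)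
  have cZ: "coord n Z w i = b i" if "i < n" for i
    unfolding w_def using that by (rule coord_linear_combination[OF uZ])
  have wk: "w k = 0" if "k < r" for k using c(3)[OF that] unfolding w_def sum_b .
  have "coord n T w f = 0" if "f < t" for f
  proof -
    have "coord n T w f = (\<Sum>k<n. \<Sum>i<n. cnj (T k f) * Z k i * b i)"
      by (simp add: coord_def w_def sum_distrib_left mult_ac)
    also have "\<dots> = (\<Sum>i<n. (\<Sum>k<n. cnj (T k f) * Z k i) * b i)"
      unfolding sum_distrib_right by (rule sum.swap)
    finally show ?thesis using c(2)[OF that] unfolding sum_b by simp
  qed
  then have "spec_form n T lam w \<le> lam t * normsq n w"
    using lam t by (intro spec_form_le[OF uT, of t]) auto
  moreover have "spec_form n Z kap w \<ge> kap (t+r) * normsq n w"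
    using kap t cZ by (intro spec_form_ge[OF uZ, of "Suc (t+r)"]) (auto simp: b_def)
  moreover have "(\<Sum>k<n. d k * (cmod (w k))\<^sup>2) = 0"
    using d wk by (intro sum.neutral) (metis lessThan_iff linorder_not_le mult_eq_0_iff norm_zero zero_power2)
  then have "spec_form n T lam w = spec_form n Z kap w"
    unfolding spec_form_add_diag[OF T Z] by simp
  moreover have "normsq n w > 0"
  proof -
    obtain i where "i \<le> t+r" "c i \<noteq> 0" using c(1) by auto
    then have "i < n" "coord n Z w i \<noteq> 0" using t cZ[of i] by (auto simp: b_def)
    then have "(\<Sum>i<n. (cmod (coord n Z w i))\<^sup>2) \<noteq> 0" by (subst sum_nonneg_eq_0_iff) auto
    then show ?thesis using normsq_coord[OF uZ, of w] normsq_nonneg[of n w] by linarith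
  qed
  ultimately have "kap (t+r) * normsq n w \<le> lam t * normsq n w" by linarith
  then have "kap (t+r) \<le> lam t" using \<open>normsq n w > 0\<close> by simp
  with \<open>\<not> ?thesis\<close> show False by simp
qed

text \<open>The sign of \<open>p\<close> is left open: it is applied to \<open>d0 > 0\<close> and to
  \<open>z - lam t\<close>, which is negative for eigenvalues above \<open>z\<close>.\<close>

lemma complete_square:
  fixes p h :: real and x y :: complex
  assumes "p * h = 1"
  shows "p * (cmod (x + of_real h * y))\<^sup>2 = p * (cmod x)\<^sup>2 + 2 * Re (cnj x * y) + h * (cmod y)\<^sup>2"
proof -
  have *: "p * (a + h * b)\<^sup>2 = p * a\<^sup>2 + 2 * (a * b) + h * b\<^sup>2" for a b :: real
  proof -
    have "p * (a + h * b)\<^sup>2 = p * a\<^sup>2 + 2 * (p * h) * (a * b) + (p * h) * h * b\<^sup>2"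
      by (simp add: power2_eq_square algebra_simps)
    then show ?thesis using assms by simp
  qed
  show ?thesis
    unfolding cmod_power2 using *[of "Re x" "Re y"] *[of "Im x" "Im y"]
    by (simp add: algebra_simps)
qed

text \<open>For \<open>y\<close> supported on the first \<open>s\<close> coordinates, the form at
  \<open>y\<close> involves only the corner of size \<open>s\<close>. In the applications
  \<open>h i\<close> is \<open>1 / (z - lam i)\<close>, so this is the form of the
  resolvent.\<close>

lemma resolvent_form_near_scalar:
  assumes "s \<le> n" "\<And>k. s \<le> k \<Longrightarrow> k < n \<Longrightarrow> y k = 0"
    and S: "\<And>k l. k < s \<Longrightarrow> l < s \<Longrightarrow>
      cmod ((\<Sum>i<n. of_real (h i) * (T k i * cnj (T l i))) - (if k = l then of_real g else 0)) \<le> e"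
  shows "\<bar>(\<Sum>i<n. h i * (cmod (coord n T y i))\<^sup>2) - g * normsq n y\<bar> \<le> real s * e * normsq n y"
proof -
  let ?S = "\<lambda>k l. \<Sum>i<n. of_real (h i) * (T k i * cnj (T l i))"
  have "complex_of_real (\<Sum>i<n. h i * (cmod (coord n T y i))\<^sup>2)
      = (\<Sum>i<n. of_real (h i) * (cnj (coord n T y i) * coord n T y i))"
    unfolding cnj_mult_self of_real_sum of_real_mult ..
  also have "\<dots> = (\<Sum>k<n. \<Sum>l<n. cnj (y k) * ?S k l * y l)"
    by (rule sesquilinear_coord[symmetric])
  also have "\<dots> = (\<Sum>k<s. \<Sum>l<s. cnj (y k) * ?S k l * y l)"
    using assms(1,2) by (intro sum.mono_neutral_cong_right) (auto intro!: sum.mono_neutral_cong_right)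
  finally have "(\<Sum>i<n. h i * (cmod (coord n T y i))\<^sup>2) = Re (\<Sum>k<s. \<Sum>l<s. cnj (y k) * ?S k l * y l)"
    by (metis Re_complex_of_real)
  moreover have "normsq s y = normsq n y"
    unfolding normsq_def using assms(1,2) by (intro sum.mono_neutral_left) auto
  ultimately show ?thesis using quadratic_form_near_scalar[of s ?S g e y] S by simp
qed

text \<open>Schur complement: on the vectors \<open>x - (z - A)\<^sup>-\<^sup>1 y\<close>, with \<open>x\<close> in the span of the
  eigenvectors of \<open>A\<close> above \<open>z\<close> and \<open>y\<close> supported on the first \<open>s\<close> coordinates, the form of
  \<open>z - A - D\<close> is negative, because the \<open>s \<times> s\<close> corner of \<open>(z - A)\<^sup>-\<^sup>1\<close> exceeds \<open>1/d0\<close>.\<close>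

lemma eig_add_diag_gt:
  assumes T: "eig_decomp n A T lam" and Z: "eig_decomp n (add_diag A d) Z kap"
    and kap: "\<And>i j. i \<le> j \<Longrightarrow> j < n \<Longrightarrow> kap j \<le> kap i"
    and d: "\<And>k. k < n \<Longrightarrow> d k \<ge> 0" "\<And>k. k < s \<Longrightarrow> d k \<ge> d0" "d0 > 0"
    and s: "1 \<le> s" "m + s \<le> n"
    and lam: "\<And>t. t < m \<Longrightarrow> lam t > z" "\<And>t. m \<le> t \<Longrightarrow> t < n \<Longrightarrow> lam t < z"
    and S: "\<And>k l. k < s \<Longrightarrow> l < s \<Longrightarrow>
      cmod ((\<Sum>i<n. of_real (1 / (z - lam i)) * (T k i * cnj (T l i))) - (if k = l then of_real g else 0)) \<le> e"
    and g: "1 / d0 + real s * e < g"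
  shows "kap (m + s - 1) > z"
proof (rule ccontr)
  assume "\<not> ?thesis"
  then have kz: "kap t \<le> z" if "m + s - 1 \<le> t" "t < n" for t using kap that by fastforce
  have uT: "unitary_n n T" and uZ: "unitary_n n Z" using T Z by (auto simp: eig_decomp_def)
  define h where "h = (\<lambda>t. 1 / (z - lam t))"
  have ph: "(z - lam t) * h t = 1" if "t < n" for t
    using lam[of t] that by (cases "t < m") (auto simp: h_def)
  define N where "N = (\<lambda>f t. \<Sum>k<n. cnj (Z k f) * T k t)"
  let ?C = "\<lambda>f. case_sum (\<lambda>t. N f t) (\<lambda>k. - (\<Sum>t<n. N f t * of_real (h t) * cnj (T k t)))"
  \<comment> \<open>The unknowns are the \<open>m\<close> coefficients of \<open>x\<close> and the
    \<open>s\<close> entries of \<open>y\<close>; the equations make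
    \<open>w = x - (z - A)^-1 y\<close> orthogonal to \<open>m + s - 1\<close> leading eigenvectors
    of the perturbed matrix. Nontriviality concerns the pair, so the contradiction will be that
    \<open>x\<close> and \<open>y\<close> both vanish.\<close>
  have "card {..<m + s - 1} < card ({..<m} <+> {..<s})"
    using s by (simp add: card_Plus)
  from homogeneous_system_nontrivial_solution[OF _ _ this, of ?C]
  obtain c where c: "\<exists>i\<in>{..<m} <+> {..<s}. c i \<noteq> 0"
    "\<And>f. f < m + s - 1 \<Longrightarrow> (\<Sum>i\<in>{..<m} <+> {..<s}. ?C f i * c i) = 0" by auto
  define \<alpha> where "\<alpha> = (\<lambda>t. if t < m then c (Inl t) else 0)"
  define y where "y = (\<lambda>k. if k < s then c (Inr k) else 0)"
  define \<eta> where "\<eta> = coord n T y"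
  define \<omega> where "\<omega> = (\<lambda>t. \<alpha> t - of_real (h t) * \<eta> t)"
  define w where "w = (\<lambda>k. \<Sum>t<n. T k t * \<omega> t)"
  have cT: "coord n T w t = \<omega> t" if "t < n" for t
    unfolding w_def using that by (rule coord_linear_combination[OF uT])
  have cZ: "coord n Z w f = 0" if "f < m + s - 1" for f
  proof -
    have "coord n Z w f = (\<Sum>k<n. \<Sum>t<n. cnj (Z k f) * T k t * \<omega> t)"
      by (simp add: coord_def w_def sum_distrib_left mult_ac)
    also have "\<dots> = (\<Sum>t<n. N f t * \<omega> t)"
      unfolding sum_distrib_right N_def by (rule sum.swap)
    also have "\<dots> = (\<Sum>t<n. N f t * \<alpha> t) - (\<Sum>t<n. \<Sum>k<n. N f t * of_real (h t) * cnj (T k t) * y k)"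
      by (simp add: \<omega>_def \<eta>_def coord_def algebra_simps sum_subtractf sum_distrib_left)
    also have "(\<Sum>t<n. \<Sum>k<n. N f t * of_real (h t) * cnj (T k t) * y k)
        = (\<Sum>k<n. (\<Sum>t<n. N f t * of_real (h t) * cnj (T k t)) * y k)"
      unfolding sum_distrib_right by (rule sum.swap)
    also have "\<dots> = (\<Sum>k<s. (\<Sum>t<n. N f t * of_real (h t) * cnj (T k t)) * c (Inr k))"
      using s by (intro sum.mono_neutral_cong_right) (auto simp: y_def)
    also have "(\<Sum>t<n. N f t * \<alpha> t) = (\<Sum>t<m. N f t * c (Inl t))"
      using s by (intro sum.mono_neutral_cong_right) (auto simp: \<alpha>_def)
    finally show ?thesis
      using c(2)[OF that] by (subst (asm) sum.Plus) (auto simp: sum_negf)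
  qed
  have n\<omega>: "normsq n w = (\<Sum>t<n. (cmod (\<omega> t))\<^sup>2)" "spec_form n T lam w = (\<Sum>t<n. lam t * (cmod (\<omega> t))\<^sup>2)"
    using cT by (auto simp: normsq_coord[OF uT] spec_form_def)
  have "spec_form n Z kap w \<le> z * normsq n w"
    using cZ kz by (intro spec_form_le[OF uZ, of "m + s - 1"]) auto
  then have 1: "(\<Sum>k<n. d k * (cmod (w k))\<^sup>2) \<le> (\<Sum>t<n. (z - lam t) * (cmod (\<omega> t))\<^sup>2)"
    unfolding spec_form_add_diag[OF T Z] n\<omega> by (simp add: left_diff_distrib sum_subtractf sum_distrib_left)
  \<comment> \<open>Completing the square with \<open>d0\<close> bounds the form of \<open>d\<close>
    at \<open>w\<close> from below by an expression linear in \<open>w\<close>, at the price of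
    \<open>1 / d0\<close>, which \<open>g\<close> has to beat.\<close>
  have "0 \<le> d k * (cmod (w k))\<^sup>2 + (2 * Re (cnj (w k) * y k) + 1 / d0 * (cmod (y k))\<^sup>2)" if "k < n" for k
  proof (cases "k < s")
    case True
    have "0 \<le> d0 * (cmod (w k + of_real (1 / d0) * y k))\<^sup>2" using d(3) by simp
    also have "\<dots> = d0 * (cmod (w k))\<^sup>2 + 2 * Re (cnj (w k) * y k) + 1 / d0 * (cmod (y k))\<^sup>2"
      using d(3) by (intro complete_square) simp
    also have "\<dots> \<le> d k * (cmod (w k))\<^sup>2 + 2 * Re (cnj (w k) * y k) + 1 / d0 * (cmod (y k))\<^sup>2"
      using d(2)[OF True] by (intro add_right_mono mult_right_mono) auto
    finally show ?thesis by simp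
  next
    case False
    then show ?thesis using d(1)[OF that] by (simp add: y_def)
  qed
  then have "0 \<le> (\<Sum>k<n. d k * (cmod (w k))\<^sup>2 + (2 * Re (cnj (w k) * y k) + 1 / d0 * (cmod (y k))\<^sup>2))"
    by (intro sum_nonneg) auto
  then have 2: "0 \<le> (\<Sum>k<n. d k * (cmod (w k))\<^sup>2) + 2 * Re (inner_n n w y) + 1 / d0 * normsq n y"
    by (simp add: sum.distrib normsq_def inner_n_def sum_distrib_left sum_divide_distrib)
  have "inner_n n w y = (\<Sum>t<n. cnj (\<omega> t) * \<eta> t)"
    unfolding inner_n_coord[OF uT, symmetric] \<eta>_def using cT by simp
  then have 3: "2 * Re (inner_n n w y) = (\<Sum>t<n. 2 * Re (cnj (\<omega> t) * \<eta> t))"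
    by (simp add: sum_distrib_left)
  \<comment> \<open>The cross term is the previous one, because \<open>T\<close> is unitary. The
    square with coefficient \<open>z - lam t\<close> recovers \<open>\<alpha>\<close>, which lives
    on the eigenvectors above \<open>z\<close>, so the right-hand side is nonpositive.\<close>
  have "(\<Sum>t<n. (z - lam t) * (cmod (\<omega> t))\<^sup>2) + (\<Sum>t<n. 2 * Re (cnj (\<omega> t) * \<eta> t)) + (\<Sum>t<n. h t * (cmod (\<eta> t))\<^sup>2)
      = (\<Sum>t<n. (z - lam t) * (cmod (\<alpha> t))\<^sup>2)"
    unfolding sum.distrib[symmetric]
  proof (intro sum.cong refl)
    fix t assume "t \<in> {..<n}"
    then show "(z - lam t) * (cmod (\<omega> t))\<^sup>2 + 2 * Re (cnj (\<omega> t) * \<eta> t) + h t * (cmod (\<eta> t))\<^sup>2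
       = (z - lam t) * (cmod (\<alpha> t))\<^sup>2"
      using complete_square[OF ph, of t "\<omega> t" "\<eta> t"] by (simp add: \<omega>_def)
  qed
  moreover have "\<bar>(\<Sum>t<n. h t * (cmod (\<eta> t))\<^sup>2) - g * normsq n y\<bar> \<le> real s * e * normsq n y"
    unfolding \<eta>_def by (rule resolvent_form_near_scalar) (use s S in \<open>auto simp: y_def h_def\<close>)
  ultimately have "(g - (1 / d0 + real s * e)) * normsq n y + (\<Sum>t<n. (lam t - z) * (cmod (\<alpha> t))\<^sup>2) \<le> 0"
    using 1 2 3 by (simp add: algebra_simps sum_subtractf)
  moreover have "(lam t - z) * (cmod (\<alpha> t))\<^sup>2 \<ge> 0" for t
    using lam(1)[of t] by (cases "t < m") (auto simp: \<alpha>_def)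
  then have "(\<Sum>t<n. (lam t - z) * (cmod (\<alpha> t))\<^sup>2) \<ge> 0" and
    4: "(\<Sum>t<n. (lam t - z) * (cmod (\<alpha> t))\<^sup>2) = 0 \<longleftrightarrow> (\<forall>t<n. (lam t - z) * (cmod (\<alpha> t))\<^sup>2 = 0)"
    by (auto intro!: sum_nonneg simp: sum_nonneg_eq_0_iff)
  moreover have "(g - (1 / d0 + real s * e)) * normsq n y \<ge> 0"
    using g normsq_nonneg[of n y] by simp
  ultimately have "(g - (1 / d0 + real s * e)) * normsq n y = 0"
    "(\<Sum>t<n. (lam t - z) * (cmod (\<alpha> t))\<^sup>2) = 0" by linarith+
  then have "normsq n y = 0" "\<forall>t<n. (lam t - z) * (cmod (\<alpha> t))\<^sup>2 = 0"
    using g 4 by auto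
  then have "\<forall>k<n. y k = 0" "\<forall>t<m. \<alpha> t = 0"
    using lam(1) s by (auto simp: normsq_eq_0) (metis add_leD1 less_irrefl order_less_le_trans)
  then have "\<forall>k<s. c (Inr k) = 0" "\<forall>t<m. c (Inl t) = 0"
    using s by (auto simp: y_def \<alpha>_def) (metis add_leD2 order_less_le_trans)
  then show False using c(1) by auto
qed

text \<open>Dually, the form of \<open>z - A - D\<close> is positive on a subspace of codimension \<open>m + s - 1\<close>.\<close>

lemma eig_add_diag_lt:
  assumes T: "eig_decomp n A T lam" and Z: "eig_decomp n (add_diag A d) Z kap"
    and kap: "\<And>i j. i \<le> j \<Longrightarrow> j < n \<Longrightarrow> kap j \<le> kap i"
    and d: "\<And>k. k < r \<Longrightarrow> d k > 0" "\<And>k. r \<le> k \<Longrightarrow> k < n \<Longrightarrow> d k = 0" "\<And>k. s - 1 \<le> k \<Longrightarrow> k < r \<Longrightarrow> d k \<le> d1"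
      "d1 > 0"
    and s: "1 \<le> s" "m + s \<le> n" "r \<le> n"
    and lam: "\<And>t. t < m \<Longrightarrow> lam t > z" "\<And>t. m \<le> t \<Longrightarrow> t < n \<Longrightarrow> lam t < z"
    and S: "\<And>k l. k < r \<Longrightarrow> l < r \<Longrightarrow>
      cmod ((\<Sum>i<n. of_real (1 / (z - lam i)) * (T k i * cnj (T l i))) - (if k = l then of_real g else 0)) \<le> e"
    and g: "g + real r * e < 1 / d1"
  shows "kap (m + s - 1) < z"
proof (rule ccontr)
  assume not_less: "\<not> ?thesis"
  have kz: "z \<le> kap t" if "t < m + s" for t
  proof -
    have "t \<le> m + s - 1" "m + s - 1 < n" using that s by auto
    then have "kap (m + s - 1) \<le> kap t" by (rule kap)
    with not_less show ?thesis by simp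
  qed
  have uT: "unitary_n n T" and uZ: "unitary_n n Z" using T Z by (auto simp: eig_decomp_def)
  define h where "h = (\<lambda>t. 1 / (z - lam t))"
  have ph: "(z - lam t) * h t = 1" if "t < n" for t
    using lam[of t] that by (cases "t < m") (auto simp: h_def)
  \<comment> \<open>With \<open>D\<close> the diagonal matrix of \<open>d\<close>, the
    \<open>m\<close> equations of \<open>?C\<close> remove from \<open>w - (z - A)^-1 D w\<close>
    the components along eigenvectors above \<open>z\<close>. Another \<open>s - 1\<close> equations
    make the leading entries of \<open>w\<close> vanish, where \<open>d\<close> may exceed
    \<open>d1\<close>.\<close>
  let ?C = "\<lambda>t i. (\<Sum>k<n. cnj (T k t) * Z k i * (1 - of_real (h t) * of_real (d k)))"
  have "card {..<s - 1} + card {..<m} < card {..<m + s}" using s by simp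
  from homogeneous_system_two_families[OF _ _ _ this, of "\<lambda>k i. Z k i" ?C]
  obtain c where c: "\<exists>i<m+s. c i \<noteq> 0" "\<And>k. k < s - 1 \<Longrightarrow> (\<Sum>i<m+s. Z k i * c i) = 0"
    "\<And>t. t < m \<Longrightarrow> (\<Sum>i<m+s. ?C t i * c i) = 0" by auto
  define b where "b = (\<lambda>i. if i < m + s then c i else 0)"
  define w where "w = (\<lambda>k. \<Sum>i<n. Z k i * b i)"
  have sum_b: "(\<Sum>i<n. F i * b i) = (\<Sum>i<m+s. F i * c i)" for F :: "nat \<Rightarrow> complex"
    using s by (intro sum.mono_neutral_cong_right) (auto simp: b_def)
  have cZ: "coord n Z w i = b i" if "i < n" for i
    unfolding w_def using that by (rule coord_linear_combination[OF uZ])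
  have wk: "w k = 0" if "k < s - 1" for k using c(2)[OF that] unfolding w_def sum_b .
  define y where "y = (\<lambda>k. of_real (d k) * w k)"
  define \<eta> where "\<eta> = coord n T y"
  define \<omega> where "\<omega> = coord n T w"
  define \<rho> where "\<rho> = (\<lambda>t. \<omega> t - of_real (h t) * \<eta> t)"
  have \<rho>0: "\<rho> t = 0" if "t < m" for t
  proof -
    have "\<rho> t = (\<Sum>k<n. \<Sum>i<n. cnj (T k t) * Z k i * (1 - of_real (h t) * of_real (d k)) * b i)"
      by (simp add: \<rho>_def \<omega>_def \<eta>_def coord_def y_def w_def sum_distrib_left sum_subtractf[symmetric] algebra_simps)
    also have "\<dots> = (\<Sum>i<n. ?C t i * b i)"
      unfolding sum_distrib_right by (rule sum.swap)
    finally show ?thesis using c(3)[OF that] unfolding sum_b by simp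
  qed
  have n\<omega>: "normsq n w = (\<Sum>t<n. (cmod (\<omega> t))\<^sup>2)" "spec_form n T lam w = (\<Sum>t<n. lam t * (cmod (\<omega> t))\<^sup>2)"
    by (auto simp: normsq_coord[OF uT] spec_form_def \<omega>_def)
  have "spec_form n Z kap w \<ge> z * normsq n w"
    using cZ kz by (intro spec_form_ge[OF uZ, of "m + s"]) (auto simp: b_def)
  then have 1: "(\<Sum>t<n. (z - lam t) * (cmod (\<omega> t))\<^sup>2) \<le> (\<Sum>k<n. d k * (cmod (w k))\<^sup>2)"
    unfolding spec_form_add_diag[OF T Z] n\<omega> by (simp add: left_diff_distrib sum_subtractf sum_distrib_left)
  \<comment> \<open>Wherever \<open>y k\<close> can be nonzero, \<open>0 < d k \<le> d1\<close>,
    hence \<open>(d k)^2 / d1 \<le> d k\<close>.\<close>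
  have "1 / d1 * (cmod (y k))\<^sup>2 \<le> d k * (cmod (w k))\<^sup>2" if "k < n" for k
  proof (cases "s - 1 \<le> k \<and> k < r")
    case True
    then have "d k * d k \<le> d k * d1" using d(1,3) by (intro mult_left_mono) (auto intro: less_imp_le)
    then have "1 / d1 * (d k * d k) \<le> d k" using d(4) by (simp add: divide_simps mult_ac)
    then have "1 / d1 * (d k * d k) * (cmod (w k))\<^sup>2 \<le> d k * (cmod (w k))\<^sup>2"
      by (rule mult_right_mono) auto
    moreover have "(cmod (y k))\<^sup>2 = d k * d k * (cmod (w k))\<^sup>2"
      by (simp add: y_def norm_mult power_mult_distrib power2_eq_square[of "d k"])
    ultimately show ?thesis by (simp add: mult.assoc)
  next
    case False
    then show ?thesis using wk[of k] d(2)[OF _ that] by (cases "k < r") (auto simp: y_def)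
  qed
  then have "(\<Sum>k<n. 1 / d1 * (cmod (y k))\<^sup>2) \<le> (\<Sum>k<n. d k * (cmod (w k))\<^sup>2)"
    by (intro sum_mono) auto
  then have 2: "1 / d1 * normsq n y \<le> (\<Sum>k<n. d k * (cmod (w k))\<^sup>2)"
    by (simp only: normsq_def sum_distrib_left)
  have "(\<Sum>t<n. cnj (\<omega> t) * \<eta> t) = inner_n n w y"
    unfolding \<omega>_def \<eta>_def by (rule inner_n_coord[OF uT])
  also have "\<dots> = (\<Sum>k<n. of_real (d k) * (cnj (w k) * w k))"
    by (simp add: inner_n_def y_def mult_ac)
  also have "\<dots> = of_real (\<Sum>k<n. d k * (cmod (w k))\<^sup>2)"
    unfolding cnj_mult_self of_real_sum of_real_mult ..
  finally have "Re (\<Sum>t<n. cnj (\<omega> t) * \<eta> t) = (\<Sum>k<n. d k * (cmod (w k))\<^sup>2)"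
    by (simp only: Re_complex_of_real)
  then have 3: "(\<Sum>t<n. 2 * Re (cnj (\<omega> t) * \<eta> t)) = 2 * (\<Sum>k<n. d k * (cmod (w k))\<^sup>2)"
    by (simp only: Re_sum sum_distrib_left[symmetric])
  \<comment> \<open>By \<open>1\<close> the form of \<open>z - A\<close> at \<open>w\<close> is at
    most \<open><w, D w>\<close>, and the cross term is \<open>2 <w, D w>\<close>, so their
    difference is at most \<open>- <w, D w>\<close>. The completed square is a form in
    \<open>\<rho>\<close>, nonnegative because its components above \<open>z\<close> were
    removed.\<close>
  have "(\<Sum>t<n. (z - lam t) * (cmod (\<omega> t))\<^sup>2) - (\<Sum>t<n. 2 * Re (cnj (\<omega> t) * \<eta> t)) + (\<Sum>t<n. h t * (cmod (\<eta> t))\<^sup>2)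
      = (\<Sum>t<n. (z - lam t) * (cmod (\<rho> t))\<^sup>2)"
    unfolding sum.distrib[symmetric] sum_subtractf[symmetric]
  proof (intro sum.cong refl)
    fix t assume "t \<in> {..<n}"
    then show "(z - lam t) * (cmod (\<omega> t))\<^sup>2 - 2 * Re (cnj (\<omega> t) * \<eta> t) + h t * (cmod (\<eta> t))\<^sup>2
       = (z - lam t) * (cmod (\<rho> t))\<^sup>2"
      using complete_square[OF ph, of t "\<omega> t" "- \<eta> t"] by (simp add: \<rho>_def)
  qed
  moreover have near: "\<bar>(\<Sum>t<n. h t * (cmod (\<eta> t))\<^sup>2) - g * normsq n y\<bar> \<le> real r * e * normsq n y"
    unfolding \<eta>_def by (rule resolvent_form_near_scalar) (use s S d(2) in \<open>auto simp: y_def h_def\<close>)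
  ultimately have "(1 / d1 - (g + real r * e)) * normsq n y + (\<Sum>t<n. (z - lam t) * (cmod (\<rho> t))\<^sup>2) \<le> 0"
    using 1 2 3 by (simp add: algebra_simps)
  moreover have nonneg: "(z - lam t) * (cmod (\<rho> t))\<^sup>2 \<ge> 0" if "t < n" for t
    using lam(2)[of t] \<rho>0[of t] that by (cases "t < m") auto
  have 4: "(\<Sum>t<n. (z - lam t) * (cmod (\<rho> t))\<^sup>2) = 0 \<longleftrightarrow> (\<forall>t<n. (z - lam t) * (cmod (\<rho> t))\<^sup>2 = 0)"
    by (subst sum_nonneg_eq_0_iff) (use nonneg in auto)
  have "(\<Sum>t<n. (z - lam t) * (cmod (\<rho> t))\<^sup>2) \<ge> 0"
    by (rule sum_nonneg) (use nonneg in auto)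
  moreover have "(1 / d1 - (g + real r * e)) * normsq n y \<ge> 0"
    using g normsq_nonneg[of n y] by simp
  ultimately have "(1 / d1 - (g + real r * e)) * normsq n y = 0"
    "(\<Sum>t<n. (z - lam t) * (cmod (\<rho> t))\<^sup>2) = 0" by linarith+
  then have y0: "normsq n y = 0" and \<rho>: "\<forall>t<n. (z - lam t) * (cmod (\<rho> t))\<^sup>2 = 0"
    using g 4 by auto
  have "\<eta> t = 0" for t using y0 by (auto simp: normsq_eq_0 \<eta>_def coord_def)
  moreover have "\<rho> t = 0" if "t < n" for t
    using \<rho> \<rho>0[of t] lam(2)[of t] that by (cases "t < m") auto
  ultimately have "\<omega> t = 0" if "t < n" for t using that by (simp add: \<rho>_def)
  then have "normsq n w = 0" by (simp add: n\<omega>)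
  then have "(\<Sum>i<n. (cmod (b i))\<^sup>2) = 0" using cZ by (simp add: normsq_coord[OF uZ])
  then have "\<forall>i<n. b i = 0" by (subst (asm) sum_nonneg_eq_0_iff) auto
  moreover obtain i where "i < m + s" "c i \<noteq> 0" using c(1) by blast
  moreover have "i < n" using \<open>i < m + s\<close> s(2) by simp
  ultimately show False by (auto simp: b_def)
qed

section \<open>Functional calculus\<close>

primrec mat_pow :: "nat \<Rightarrow> (nat \<Rightarrow> nat \<Rightarrow> complex) \<Rightarrow> nat \<Rightarrow> nat \<Rightarrow> nat \<Rightarrow> complex" where
  "mat_pow n A 0 = (\<lambda>i j. if i = j then 1 else 0)"
| "mat_pow n A (Suc t) = (\<lambda>i j. \<Sum>k<n. A i k * mat_pow n A t k j)"

lemma eig_decomp_eigenvector: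
  assumes "eig_decomp n A U lam" "k < n" "i < n"
  shows "(\<Sum>j<n. A k j * U j i) = of_real (lam i) * U k i"
proof -
  have "(\<Sum>j<n. A k j * U j i) = (\<Sum>j<n. \<Sum>p<n. of_real (lam p) * U k p * (cnj (U j p) * U j i))"
    using assms by (auto simp: eig_decomp_def sum_distrib_left sum_distrib_right mult_ac intro!: sum.cong)
  also have "\<dots> = (\<Sum>p<n. \<Sum>j<n. of_real (lam p) * U k p * (cnj (U j p) * U j i))"
    by (rule sum.swap)
  also have "\<dots> = (\<Sum>p<n. if p = i then of_real (lam p) * U k p else 0)"
    unfolding sum_distrib_left[symmetric] using assms
    by (intro sum.cong refl) (auto simp: unitary_n_cols eig_decomp_def)
  finally show ?thesis using assms by simp
qed

lemma mat_pow_eig_decomp: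
  assumes "eig_decomp n A U lam" "k < n" "l < n"
  shows "mat_pow n A t k l = (\<Sum>i<n. of_real (lam i ^ t) * (U k i * cnj (U l i)))"
  using assms(2)
proof (induction t arbitrary: k)
  case 0
  then show ?case using assms by (auto simp: eig_decomp_def unitary_n_def)
next
  case (Suc t)
  have "mat_pow n A (Suc t) k l = (\<Sum>j<n. \<Sum>i<n. of_real (lam i ^ t) * cnj (U l i) * (A k j * U j i))"
    using Suc by (auto simp: sum_distrib_left mult_ac intro!: sum.cong)
  also have "\<dots> = (\<Sum>i<n. \<Sum>j<n. of_real (lam i ^ t) * cnj (U l i) * (A k j * U j i))"
    by (rule sum.swap)
  also have "\<dots> = (\<Sum>i<n. of_real (lam i ^ t) * cnj (U l i) * (of_real (lam i) * U k i))"
    unfolding sum_distrib_left[symmetric]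
    using eig_decomp_eigenvector[OF assms(1) Suc.prems] by (intro sum.cong refl) simp
  finally show ?case by (simp add: mult_ac)
qed

text \<open>Stone-Weierstrass on \<open>[-m, m]\<close> with error \<open>1 / (m + 1)\<close>. A
  single sequence converging at every real point serves matrices of all sizes, whatever their
  spectra.\<close>

lemma poly_approximation_pointwise:
  fixes h :: "real \<Rightarrow> real"
  assumes "continuous_on UNIV h"
  shows "\<exists>a N. \<forall>x. (\<lambda>m. \<Sum>t\<le>N m. a m t * x ^ t) \<longlonglongrightarrow> h x"
proof -
  have "\<exists>a N. \<forall>x\<in>{- real m..real m}. \<bar>h x - (\<Sum>t\<le>(N::nat). a t * x ^ t)\<bar> < 1 / real (Suc m)" for m
  proof -
    have "continuous_on {- real m..real m} h" using assms continuous_on_subset by blast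
    then obtain g where g: "real_polynomial_function g"
        "\<And>x. x \<in> {- real m..real m} \<Longrightarrow> \<bar>h x - g x\<bar> < 1 / real (Suc m)"
      using Stone_Weierstrass_real_polynomial_function[of "{- real m..real m}" h "1 / real (Suc m)"]
      by auto
    then obtain a N where "g = (\<lambda>x. \<Sum>t\<le>N. a t * x ^ t)"
      unfolding real_polynomial_function_iff_sum by blast
    then show ?thesis using g(2) by blast
  qed
  then obtain a N where aN: "\<And>m x. x \<in> {- real m..real m} \<Longrightarrow> \<bar>h x - (\<Sum>t\<le>N m. a m t * x ^ t)\<bar> < 1 / real (Suc m)"
    by metis
  have "(\<lambda>m. \<Sum>t\<le>N m. a m t * x ^ t) \<longlonglongrightarrow> h x" for x
  proof -
    obtain m0 :: nat where m0: "\<bar>x\<bar> \<le> real m0" using real_arch_simple by blast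
    have "eventually (\<lambda>m. norm ((\<Sum>t\<le>N m. a m t * x ^ t) - h x) \<le> inverse (real (Suc m))) sequentially"
    proof (rule eventually_sequentiallyI[of m0])
      fix m assume "m0 \<le> m"
      then have "real m0 \<le> real m" by simp
      then have "x \<in> {- real m..real m}" using m0 by auto
      from aN[OF this] show "norm ((\<Sum>t\<le>N m. a m t * x ^ t) - h x) \<le> inverse (real (Suc m))"
        by (simp add: abs_minus_commute inverse_eq_divide)
    qed
    then have "(\<lambda>m. (\<Sum>t\<le>N m. a m t * x ^ t) - h x) \<longlonglongrightarrow> 0"
      using LIMSEQ_inverse_real_of_nat by (rule Lim_null_comparison)
    then show ?thesis by (simp add: LIM_zero_iff)
  qed
  then show ?thesis by blast
qed

text \<open>The sequence is chosen once per \<open>h\<close>, before any matrix is given, so the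
  choice does not affect measurability in the entries.\<close>

definition approx_coeffs :: "(real \<Rightarrow> real) \<Rightarrow> (nat \<Rightarrow> nat \<Rightarrow> real) \<times> (nat \<Rightarrow> nat)" where
  "approx_coeffs h = (SOME (a, N). \<forall>x. (\<lambda>m. \<Sum>t\<le>N m. a m t * x ^ t) \<longlonglongrightarrow> h x)"

text \<open>\<open>h(A)\<close> is taken as a limit of polynomials in \<open>A\<close>, so that it is a measurable function of
  the entries and does not depend on a choice of eigenvectors.\<close>

definition func_calc :: "(real \<Rightarrow> real) \<Rightarrow> nat \<Rightarrow> (nat \<Rightarrow> nat \<Rightarrow> complex) \<Rightarrow> nat \<Rightarrow> nat \<Rightarrow> complex" where
  "func_calc h n A k l = lim (\<lambda>m. \<Sum>t\<le>snd (approx_coeffs h) m. of_real (fst (approx_coeffs h) m t) * mat_pow n A t k l)"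

lemma func_calc_eig_decomp:
  assumes h: "continuous_on UNIV h" and A: "eig_decomp n A U lam" "k < n" "l < n"
  shows "func_calc h n A k l = (\<Sum>i<n. of_real (h (lam i)) * (U k i * cnj (U l i)))"
proof -
  obtain a N where aN: "approx_coeffs h = (a, N)" by fastforce
  have "\<exists>p. case p of (a, N) \<Rightarrow> \<forall>x. (\<lambda>m. \<Sum>t\<le>N m. a m t * x ^ t) \<longlonglongrightarrow> h x"
    using poly_approximation_pointwise[OF h] by auto
  from someI_ex[OF this] have lim: "(\<lambda>m. \<Sum>t\<le>N m. a m t * x ^ t) \<longlonglongrightarrow> h x" for x
    using aN by (auto simp: approx_coeffs_def)
  have "(\<Sum>t\<le>N m. of_real (a m t) * mat_pow n A t k l)
     = (\<Sum>i<n. of_real (\<Sum>t\<le>N m. a m t * lam i ^ t) * (U k i * cnj (U l i)))" for m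
    unfolding mat_pow_eig_decomp[OF A] sum_distrib_left of_real_sum sum_distrib_right
    by (subst sum.swap) (simp add: mult_ac)
  moreover have "(\<lambda>m. \<Sum>i<n. of_real (\<Sum>t\<le>N m. a m t * lam i ^ t) * (U k i * cnj (U l i)))
      \<longlonglongrightarrow> (\<Sum>i<n. of_real (h (lam i)) * (U k i * cnj (U l i)))"
    by (intro tendsto_intros lim)
  ultimately show ?thesis unfolding func_calc_def aN fst_conv snd_conv by (simp add: limI)
qed

section \<open>Measurability, equivariance and bounds for \<open>h(A)\<close>\<close>

lemma measurable_mat_entry [measurable]: "(\<lambda>A. A i j) \<in> borel_measurable mat_space"
proof -
  have 1: "(\<lambda>A. A i) \<in> measurable mat_space (Pi\<^sub>M UNIV (\<lambda>_. borel :: complex measure))"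
    unfolding mat_space_def by (rule measurable_component_singleton) simp
  show ?thesis by (rule measurable_compose[OF 1 measurable_component_singleton]) simp
qed

lemma measurable_mat_spaceI:
  assumes "\<And>i j. (\<lambda>x. F x i j) \<in> borel_measurable M"
  shows "F \<in> measurable M mat_space"
proof -
  have 1: "(\<lambda>x. F x i) \<in> measurable M (Pi\<^sub>M UNIV (\<lambda>_. borel :: complex measure))" for i
    by (rule measurable_PiM_single') (use assms in \<open>auto simp: space_PiM\<close>)
  show ?thesis unfolding mat_space_def
    by (rule measurable_PiM_single') (use 1 in \<open>auto simp: space_PiM\<close>)
qed

lemma measurable_mat_pow [measurable]: "(\<lambda>A. mat_pow n A t i j) \<in> borel_measurable mat_space"
  by (induction t arbitrary: i) auto

lemma measurable_func_calc [measurable]: "(\<lambda>A. func_calc h n A i j) \<in> borel_measurable mat_space"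
  unfolding func_calc_def by measurable

lemma measurable_mat_conj_n [measurable]: "mat_conj_n n W \<in> measurable mat_space mat_space"
  by (rule measurable_mat_spaceI) (simp add: mat_conj_n_def)

lemma unitary_n_mult:
  assumes "unitary_n n V" "unitary_n n W"
  shows "unitary_n n (\<lambda>k i. \<Sum>p<n. V k p * W p i)"
  unfolding unitary_n_def
proof (intro allI impI)
  fix i j assume ij: "i < n" "j < n"
  have "(\<Sum>k<n. (\<Sum>p<n. V i p * W p k) * cnj (\<Sum>p<n. V j p * W p k))
     = (\<Sum>k<n. cnj (coord n W (\<lambda>p. cnj (V i p)) k) * coord n W (\<lambda>p. cnj (V j p)) k)"
    by (simp add: coord_def mult.commute)
  also have "\<dots> = inner_n n (\<lambda>p. cnj (V i p)) (\<lambda>p. cnj (V j p))"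
    by (rule inner_n_coord[OF assms(2)])
  also have "\<dots> = (if i = j then 1 else 0)"
    using assms(1) ij by (auto simp: inner_n_def unitary_n_def)
  finally show "(\<Sum>k<n. (\<Sum>p<n. V i p * W p k) * cnj (\<Sum>p<n. V j p * W p k)) = (if i = j then 1 else 0)" .
qed

lemma mat_conj_n_spectral:
  assumes "i < n" "j < n" "\<And>k l. k < n \<Longrightarrow> l < n \<Longrightarrow> A k l = (\<Sum>t<n. w t * (U k t * cnj (U l t)))"
  shows "mat_conj_n n W A i j
    = (\<Sum>t<n. w t * ((\<Sum>p<n. W i p * U p t) * cnj (\<Sum>p<n. W j p * U p t)))"
proof -
  have "mat_conj_n n W A i j = (\<Sum>k<n. \<Sum>l<n. cnj (cnj (W i k)) * (\<Sum>t<n. w t * (U k t * cnj (U l t))) * cnj (W j l))"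
    using assms by (auto simp: mat_conj_n_def intro!: sum.cong)
  then show ?thesis unfolding sesquilinear_coord by (simp add: coord_def mult.commute)
qed

lemma eig_decomp_mat_conj_n:
  assumes "eig_decomp n A U lam" "unitary_n n W"
  shows "eig_decomp n (mat_conj_n n W A) (\<lambda>k i. \<Sum>p<n. W k p * U p i) lam"
  using assms mat_conj_n_spectral[of _ n _ A "\<lambda>t. of_real (lam t)" U W] unitary_n_mult[of n W U]
  by (auto simp: eig_decomp_def)

text \<open>Conjugation moves the eigenvectors and keeps the eigenvalues. Invariance of the law of a
  random matrix thereby passes to its image under \<open>h\<close>.\<close>

lemma func_calc_mat_conj_n:
  assumes h: "continuous_on UNIV h" and A: "hermitian_n n A" and W: "unitary_n n W" and ij: "i < n" "j < n"
  shows "func_calc h n (mat_conj_n n W A) i j = mat_conj_n n W (func_calc h n A) i j"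
proof -
  obtain U where U: "eig_decomp n A U (\<lambda>i. eig n A (Suc i))" using hermitian_eig_decomp(1)[OF A, of False] by auto
  show ?thesis
    unfolding func_calc_eig_decomp[OF h eig_decomp_mat_conj_n[OF U W] ij]
    using mat_conj_n_spectral[OF ij func_calc_eig_decomp[OF h U]] by simp
qed

lemma func_calc_hermitian:
  assumes h: "continuous_on UNIV h" and A: "hermitian_n n A"
  shows "hermitian_n n (func_calc h n A)"
proof -
  obtain U where U: "eig_decomp n A U (\<lambda>i. eig n A (Suc i))" using hermitian_eig_decomp(1)[OF A, of False] by auto
  show ?thesis unfolding hermitian_n_def
    by (simp add: func_calc_eig_decomp[OF h U] mult_ac)
qed

text \<open>Up to conjugation, row \<open>i\<close> of \<open>h(A)\<close> is \<open>U\<close>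
  applied to the vector with entries \<open>h (lam t) * cnj (U i t)\<close>; \<open>U\<close>
  preserves norms and its own row \<open>i\<close> has norm 1.\<close>

lemma func_calc_row_bound:
  assumes h: "continuous_on UNIV h" "\<And>x. \<bar>h x\<bar> \<le> K" and A: "hermitian_n n A" and i: "i < n"
  shows "(\<Sum>j<n. (cmod (func_calc h n A i j))\<^sup>2) \<le> K\<^sup>2"
proof -
  define lam where "lam = (\<lambda>i. eig n A (Suc i))"
  obtain U where U: "eig_decomp n A U lam" using hermitian_eig_decomp(1)[OF A, of False] by (auto simp: lam_def)
  then have uU: "unitary_n n U" by (simp add: eig_decomp_def)
  let ?c = "\<lambda>t. of_real (h (lam t)) * cnj (U i t)"
  have "cmod (func_calc h n A i j) = cmod (\<Sum>t<n. U j t * ?c t)" if "j < n" for j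
    by (subst complex_mod_cnj[symmetric]) (simp add: func_calc_eig_decomp[OF h(1) U i that] mult_ac)
  then have "(\<Sum>j<n. (cmod (func_calc h n A i j))\<^sup>2) = normsq n (\<lambda>j. \<Sum>t<n. U j t * ?c t)"
    by (simp add: normsq_def)
  also have "\<dots> = (\<Sum>t<n. (cmod (?c t))\<^sup>2)"
    unfolding normsq_coord[OF uU] by (intro sum.cong refl) (simp only: coord_linear_combination[OF uU] lessThan_iff)
  also have "\<dots> \<le> (\<Sum>t<n. K\<^sup>2 * (cmod (U i t))\<^sup>2)"
  proof (rule sum_mono)
    fix t
    have "\<bar>h (lam t)\<bar>\<^sup>2 \<le> K\<^sup>2" by (rule power_mono[OF h(2)]) simp
    then show "(cmod (?c t))\<^sup>2 \<le> K\<^sup>2 * (cmod (U i t))\<^sup>2"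
      by (simp add: norm_mult power_mult_distrib mult_right_mono)
  qed
  also have "(\<Sum>t<n. K\<^sup>2 * (cmod (U i t))\<^sup>2) = K\<^sup>2"
  proof -
    have "complex_of_real (\<Sum>t<n. (cmod (U i t))\<^sup>2) = (\<Sum>t<n. U i t * cnj (U i t))"
      unfolding of_real_sum complex_norm_square ..
    also have "\<dots> = of_real 1" using uU i by (simp add: unitary_n_def)
    finally have "(\<Sum>t<n. (cmod (U i t))\<^sup>2) = 1" by (simp only: of_real_eq_iff)
    then show ?thesis by (simp add: sum_distrib_left[symmetric])
  qed
  finally show ?thesis .
qed

lemma func_calc_trace:
  assumes h: "continuous_on UNIV h" and A: "eig_decomp n A U lam"
  shows "(\<Sum>k<n. func_calc h n A k k) = of_real (\<Sum>i<n. h (lam i))"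
proof -
  have uU: "unitary_n n U" using A by (simp add: eig_decomp_def)
  have "(\<Sum>k<n. func_calc h n A k k) = (\<Sum>k<n. \<Sum>i<n. of_real (h (lam i)) * (cnj (U k i) * U k i))"
    by (intro sum.cong refl) (simp add: func_calc_eig_decomp[OF assms] mult.commute)
  also have "\<dots> = (\<Sum>i<n. of_real (h (lam i)) * (\<Sum>k<n. cnj (U k i) * U k i))"
    unfolding sum_distrib_left by (rule sum.swap)
  also have "\<dots> = (\<Sum>i<n. of_real (h (lam i)))"
    by (intro sum.cong refl) (simp add: unitary_n_cols[OF uU])
  finally show ?thesis by simp
qed

section \<open>Fourth moments for an invariant random matrix\<close>

text \<open>For \<open>c^2 + s^2 = 1\<close> this is the reflection with block
  \<open>[[c, s], [s, -c]]\<close> in the plane of coordinates \<open>j\<close> and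
  \<open>k\<close>. It is real and symmetric, so it belongs to both symmetry groups and needs no
  transposes; \<open>c = 0\<close>, \<open>s = 1\<close> exchanges the two coordinates without
  signs.\<close>

definition plane_refl :: "nat \<Rightarrow> nat \<Rightarrow> real \<Rightarrow> real \<Rightarrow> nat \<Rightarrow> nat \<Rightarrow> complex" where
  "plane_refl j k c s = (\<lambda>p q.
     if p = j then (if q = j then of_real c else if q = k then of_real s else 0)
     else if p = k then (if q = j then of_real s else if q = k then - of_real c else 0)
     else if p = q then 1 else 0)"

lemma sum_plane_refl:
  fixes F :: "nat \<Rightarrow> complex"
  assumes "j < n" "k < n" "j \<noteq> k" "p < n"
  shows "(\<Sum>a<n. plane_refl j k c s p a * F a) =
    (if p = j then of_real c * F j + of_real s * F k
     else if p = k then of_real s * F j - of_real c * F k else F p)"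
proof -
  have "(\<Sum>a<n. plane_refl j k c s p a * F a) =
    (\<Sum>a<n. (if a = j then (if p = j then of_real c else if p = k then of_real s else 0) * F a else 0)
      + (if a = k then (if p = j then of_real s else if p = k then - of_real c else 0) * F a else 0)
      + (if a = p then (if p = j \<or> p = k then 0 else F a) else 0))"
    using assms by (intro sum.cong refl) (auto simp: plane_refl_def)
  also have "\<dots> = (if p = j then of_real c * F j + of_real s * F k
     else if p = k then of_real s * F j - of_real c * F k else F p)"
    unfolding sum.distrib using assms by (auto simp: sum.delta)
  finally show ?thesis .
qed

lemma cnj_plane_refl: "cnj (plane_refl j k c s p q) = plane_refl j k c s p q"
  by (simp add: plane_refl_def)

lemma plane_refl_unitary:
  assumes "j < n" "k < n" "j \<noteq> k" "c\<^sup>2 + s\<^sup>2 = 1"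
  shows "unitary_n n (plane_refl j k c s)" "real_entries_n n (plane_refl j k c s)"
proof -
  have "of_real c * of_real c + of_real s * of_real s = (1 :: complex)"
    unfolding of_real_mult[symmetric] of_real_add[symmetric] using assms(4) by (simp add: power2_eq_square)
  then show "unitary_n n (plane_refl j k c s)"
    using assms(1-3) unfolding unitary_n_def cnj_plane_refl
    by (auto simp: sum_plane_refl) (auto simp: plane_refl_def add.commute)
  show "real_entries_n n (plane_refl j k c s)"
    by (auto simp: real_entries_n_def plane_refl_def)
qed

lemma mat_conj_n_plane_refl:
  fixes c s :: real
  assumes "j < n" "k < n" "j \<noteq> k" "p < n" "q < n"
  defines "R \<equiv> \<lambda>F p. (if p = j then of_real c * F j + of_real s * F k
     else if p = k then of_real s * F j - of_real c * F k else F p :: complex)"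
  shows "mat_conj_n n (plane_refl j k c s) H p q = R (\<lambda>a. R (H a) q) p"
proof -
  have "mat_conj_n n (plane_refl j k c s) H p q
    = (\<Sum>a<n. plane_refl j k c s p a * (\<Sum>b<n. plane_refl j k c s q b * H a b))"
    using assms by (simp add: mat_conj_n_def cnj_plane_refl sum_distrib_left mult_ac)
  then show ?thesis using assms(1-5) by (simp add: sum_plane_refl R_def)
qed

text \<open>The reverse triangle inequality for \<open>x^2\<close> and \<open>y^2\<close>. It lets a
  mixed moment of rotated entries control fourth powers without any information on phases.\<close>

lemma cmod_sum_diff_squares:
  fixes x y :: complex
  shows "(cmod x)^4 + (cmod y)^4 - 2 * ((cmod x)\<^sup>2 * (cmod y)\<^sup>2) \<le> (cmod (x + y))\<^sup>2 * (cmod (x - y))\<^sup>2"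
proof -
  have "(cmod x)^4 + (cmod y)^4 - 2 * ((cmod x)\<^sup>2 * (cmod y)\<^sup>2) = \<bar>cmod (x\<^sup>2) - cmod (y\<^sup>2)\<bar>\<^sup>2"
    by (simp add: norm_power power2_diff)
  also have "\<dots> \<le> (cmod (x\<^sup>2 - y\<^sup>2))\<^sup>2"
    by (rule power_mono[OF norm_triangle_ineq3]) simp
  also have "x\<^sup>2 - y\<^sup>2 = (x + y) * (x - y)" by (simp add: power2_eq_square algebra_simps)
  finally show ?thesis by (simp add: norm_mult power_mult_distrib)
qed

text \<open>Jensen's inequality for the fourth power, by Cauchy-Schwarz twice.\<close>

lemma power4_mean_le:
  fixes x :: "nat \<Rightarrow> real"
  assumes "n > 0"
  shows "((\<Sum>k<n. x k) / real n)^4 \<le> (\<Sum>k<n. x k ^ 4) / real n"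
proof -
  have sq: "(\<Sum>k<n. f k)\<^sup>2 \<le> real n * (\<Sum>k<n. (f k)\<^sup>2)" for f :: "nat \<Rightarrow> real"
    using Cauchy_Schwarz_ineq_sum[of "\<lambda>_. 1" f "{..<n}"] by simp
  have "(\<Sum>k<n. x k)^4 = ((\<Sum>k<n. x k)\<^sup>2)\<^sup>2" by simp
  also have "\<dots> \<le> (real n * (\<Sum>k<n. (x k)\<^sup>2))\<^sup>2"
    using sq by (rule power_mono) simp
  also have "\<dots> = (real n)\<^sup>2 * (\<Sum>k<n. (x k)\<^sup>2)\<^sup>2" by (simp add: power_mult_distrib)
  also have "\<dots> \<le> (real n)\<^sup>2 * (real n * (\<Sum>k<n. ((x k)\<^sup>2)\<^sup>2))"
    using sq by (rule mult_left_mono) simp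
  also have "\<dots> = (real n)^3 * (\<Sum>k<n. x k ^ 4)"
    by (simp add: power2_eq_square[of "real n"] power3_eq_cube)
  finally have "(\<Sum>k<n. x k)^4 / (real n)^4 \<le> (real n)^3 * (\<Sum>k<n. x k ^ 4) / (real n)^4"
    by (rule divide_right_mono) simp
  then show ?thesis using assms by (simp add: power_divide eval_nat_numeral)
qed

text \<open>Invariance is asked only under real orthogonal matrices, which both symmetry classes
  provide. The bound \<open>K\<close> on \<open>h\<close> makes all moments of the entries
  finite.\<close>

locale invariant_random_matrix = prob_space M for M :: "'w measure" +
  fixes n :: nat and X :: "'w \<Rightarrow> nat \<Rightarrow> nat \<Rightarrow> complex" and h :: "real \<Rightarrow> real" and K :: real
  assumes X_meas: "X \<in> measurable M mat_space"
    and X_herm: "\<And>\<omega>. \<omega> \<in> space M \<Longrightarrow> hermitian_n n (X \<omega>)"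
    and X_inv: "\<And>U. unitary_n n U \<Longrightarrow> real_entries_n n U \<Longrightarrow>
      distr M mat_space (\<lambda>\<omega>. mat_conj_n n U (X \<omega>)) = distr M mat_space X"
    and h_cont: "continuous_on UNIV h" and h_bound: "\<And>x. \<bar>h x\<bar> \<le> K"
begin

section \<open>Moments of the entries of \<open>h(X)\<close>\<close>

definition H :: "nat \<Rightarrow> nat \<Rightarrow> 'w \<Rightarrow> complex" where
  "H i j \<omega> = func_calc h n (X \<omega>) i j"

lemma H_measurable [measurable]: "H i j \<in> borel_measurable M"
  unfolding H_def by (rule measurable_compose[OF X_meas measurable_func_calc])

lemma K_nonneg: "K \<ge> 0"
  using h_bound[of 0] by simp

lemma H_row_bound: "\<omega> \<in> space M \<Longrightarrow> i < n \<Longrightarrow> (\<Sum>j<n. (cmod (H i j \<omega>))\<^sup>2) \<le> K\<^sup>2"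
  unfolding H_def by (intro func_calc_row_bound h_cont h_bound X_herm)

lemma H_bound:
  assumes "\<omega> \<in> space M" "i < n" "j < n"
  shows "cmod (H i j \<omega>) \<le> K"
proof -
  have "(cmod (H i j \<omega>))\<^sup>2 \<le> (\<Sum>j<n. (cmod (H i j \<omega>))\<^sup>2)"
    using assms by (intro member_le_sum) auto
  then have "(cmod (H i j \<omega>))\<^sup>2 \<le> K\<^sup>2" using H_row_bound[OF assms(1,2)] by linarith
  then show ?thesis using K_nonneg by (rule power2_le_imp_le)
qed

lemma H_cnj:
  assumes "\<omega> \<in> space M" "i < n" "j < n"
  shows "H j i \<omega> = cnj (H i j \<omega>)"
  using func_calc_hermitian[OF h_cont X_herm[OF assms(1)]] assms unfolding H_def hermitian_n_def by blast

lemma integrable_bounded: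
  fixes f :: "'w \<Rightarrow> real"
  assumes "f \<in> borel_measurable M" "\<And>\<omega>. \<omega> \<in> space M \<Longrightarrow> \<bar>f \<omega>\<bar> \<le> B"
  shows "integrable M f"
  using assms by (intro integrable_const_bound[of _ B]) (auto intro: AE_I2)

lemma integrable_H_power:
  assumes "i < n" "j < n"
  shows "integrable M (\<lambda>\<omega>. (cmod (H i j \<omega>)) ^ t)"
  by (rule integrable_bounded[of _ "K ^ t"]) (use assms H_bound in \<open>auto intro!: power_mono\<close>)

lemma integrable_H_mixed:
  assumes "i < n" "j < n" "k < n"
  shows "integrable M (\<lambda>\<omega>. (cmod (H i j \<omega>))\<^sup>2 * (cmod (H i k \<omega>))\<^sup>2)"
proof (rule integrable_bounded[of _ "K\<^sup>2 * K\<^sup>2"])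
  fix \<omega> assume "\<omega> \<in> space M"
  then show "\<bar>(cmod (H i j \<omega>))\<^sup>2 * (cmod (H i k \<omega>))\<^sup>2\<bar> \<le> K\<^sup>2 * K\<^sup>2"
    unfolding abs_mult power_abs abs_norm_cancel by (intro mult_mono power_mono H_bound assms) auto
qed measurable

lemma integrable_H_diag_diff:
  assumes "j < n" "k < n"
  shows "integrable M (\<lambda>\<omega>. (Re (H j j \<omega>) - Re (H k k \<omega>)) ^ 4)"
proof (rule integrable_bounded[of _ "(2 * K) ^ 4"])
  fix \<omega> assume \<omega>: "\<omega> \<in> space M"
  have "\<bar>Re (H j j \<omega>) - Re (H k k \<omega>)\<bar> \<le> 2 * K"
    using H_bound[OF \<omega>, of j j] H_bound[OF \<omega>, of k k] abs_Re_le_cmod[of "H j j \<omega>"] abs_Re_le_cmod[of "H k k \<omega>"] assms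
    by linarith
  then have "\<bar>Re (H j j \<omega>) - Re (H k k \<omega>)\<bar> ^ 4 \<le> (2 * K) ^ 4" by (rule power_mono) simp
  then show "\<bar>(Re (H j j \<omega>) - Re (H k k \<omega>)) ^ 4\<bar> \<le> (2 * K) ^ 4" by (simp only: power_abs)
qed measurable

text \<open>\<open>F\<close> takes two entries in order to cover mixed moments; for a single entry,
  \<open>F\<close> ignores its second argument.\<close>

lemma expectation_plane_refl:
  fixes F :: "complex \<Rightarrow> complex \<Rightarrow> real"
  assumes jk: "j < n" "k < n" "j \<noteq> k" "c\<^sup>2 + s\<^sup>2 = 1" and p: "p < n" "q < n" "p' < n" "q' < n"
    and F: "(\<lambda>(x, y). F x y) \<in> borel_measurable (borel \<Otimes>\<^sub>M borel)"
  shows "expectation (\<lambda>\<omega>. F (H p q \<omega>) (H p' q' \<omega>)) =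
    expectation (\<lambda>\<omega>. F (mat_conj_n n (plane_refl j k c s) (\<lambda>a b. H a b \<omega>) p q)
                      (mat_conj_n n (plane_refl j k c s) (\<lambda>a b. H a b \<omega>) p' q'))"
proof -
  let ?W = "plane_refl j k c s"
  let ?\<phi> = "\<lambda>A. F (func_calc h n A p q) (func_calc h n A p' q')"
  have W: "unitary_n n ?W" "real_entries_n n ?W" using plane_refl_unitary[OF jk] .
  have \<phi>: "?\<phi> \<in> borel_measurable mat_space"
    using measurable_compose[OF measurable_Pair[OF measurable_func_calc measurable_func_calc] F] by simp
  have XW: "(\<lambda>\<omega>. mat_conj_n n ?W (X \<omega>)) \<in> measurable M mat_space"
    by (rule measurable_compose[OF X_meas measurable_mat_conj_n])
  have "expectation (\<lambda>\<omega>. F (H p q \<omega>) (H p' q' \<omega>)) = integral\<^sup>L (distr M mat_space X) ?\<phi>"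
    unfolding H_def by (rule integral_distr[OF X_meas \<phi>, symmetric])
  also have "\<dots> = expectation (\<lambda>\<omega>. ?\<phi> (mat_conj_n n ?W (X \<omega>)))"
    unfolding X_inv[OF W, symmetric] by (rule integral_distr[OF XW \<phi>])
  also have "\<dots> = expectation (\<lambda>\<omega>. F (mat_conj_n n ?W (\<lambda>a b. H a b \<omega>) p q) (mat_conj_n n ?W (\<lambda>a b. H a b \<omega>) p' q'))"
  proof (rule Bochner_Integration.integral_cong[OF refl])
    fix \<omega> assume "\<omega> \<in> space M"
    from func_calc_mat_conj_n[OF h_cont X_herm[OF this] W(1)] p
    show "?\<phi> (mat_conj_n n ?W (X \<omega>)) = F (mat_conj_n n ?W (\<lambda>a b. H a b \<omega>) p q) (mat_conj_n n ?W (\<lambda>a b. H a b \<omega>) p' q')"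
      by (simp add: H_def)
  qed
  finally show ?thesis .
qed

text \<open>The reflection with \<open>c = 0\<close>, \<open>s = 1\<close> exchanges
  \<open>j\<close> and \<open>k\<close> and fixes \<open>i\<close>. Diagonal entries are excluded,
  since no permutation carries them to off-diagonal ones.\<close>

lemma expectation_H_swap:
  assumes "i < n" "j < n" "k < n" "i \<noteq> j" "i \<noteq> k"
  shows "expectation (\<lambda>\<omega>. (cmod (H i j \<omega>)) ^ t) = expectation (\<lambda>\<omega>. (cmod (H i k \<omega>)) ^ t)"
proof (cases "j = k")
  case False
  show ?thesis
    by (subst expectation_plane_refl[where j = j and k = k and c = 0 and s = 1 and p = i and q = j and p' = i and q' = j
          and F = "\<lambda>x y. cmod x ^ t"])
      (use assms False in \<open>auto simp: mat_conj_n_plane_refl\<close>)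
qed simp

lemma expectation_H_mixed_swap:
  assumes "i < n" "j < n" "j' < n" "k < n" "i \<noteq> j" "i \<noteq> j'" "i \<noteq> k" "k \<noteq> j" "k \<noteq> j'"
  shows "expectation (\<lambda>\<omega>. (cmod (H i j \<omega>))\<^sup>2 * (cmod (H i k \<omega>))\<^sup>2)
    = expectation (\<lambda>\<omega>. (cmod (H i j' \<omega>))\<^sup>2 * (cmod (H i k \<omega>))\<^sup>2)"
proof (cases "j = j'")
  case False
  show ?thesis
    by (subst expectation_plane_refl[where j = j and k = j' and c = 0 and s = 1 and p = i and q = j and p' = i and q' = k
          and F = "\<lambda>x y. (cmod x)\<^sup>2 * (cmod y)\<^sup>2"])
      (use assms False in \<open>auto simp: mat_conj_n_plane_refl\<close>)
qed simp

text \<open>The \<open>n - 1\<close> off-diagonal entries of a row share one second moment, and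
  their squares sum to at most \<open>K^2\<close>.\<close>

lemma second_moment_offdiag:
  assumes "i < n" "k < n" "i \<noteq> k"
  shows "real (n - 1) * expectation (\<lambda>\<omega>. (cmod (H i k \<omega>))\<^sup>2) \<le> K\<^sup>2"
proof -
  have "real (n - 1) * expectation (\<lambda>\<omega>. (cmod (H i k \<omega>))\<^sup>2)
      = (\<Sum>j\<in>{..<n} - {i}. expectation (\<lambda>\<omega>. (cmod (H i k \<omega>))\<^sup>2))"
    using assms by simp
  also have "\<dots> = (\<Sum>j\<in>{..<n} - {i}. expectation (\<lambda>\<omega>. (cmod (H i j \<omega>))\<^sup>2))"
    by (intro sum.cong refl expectation_H_swap) (use assms in auto)
  also have "\<dots> = expectation (\<lambda>\<omega>. \<Sum>j\<in>{..<n} - {i}. (cmod (H i j \<omega>))\<^sup>2)"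
    using assms integrable_H_power by (intro Bochner_Integration.integral_sum[symmetric]) auto
  also have "\<dots> \<le> expectation (\<lambda>\<omega>. K\<^sup>2)"
  proof (rule integral_mono)
    show "integrable M (\<lambda>\<omega>. \<Sum>j\<in>{..<n} - {i}. (cmod (H i j \<omega>))\<^sup>2)"
      using assms integrable_H_power by (intro Bochner_Integration.integrable_sum) auto
    fix \<omega> assume "\<omega> \<in> space M"
    have "(\<Sum>j\<in>{..<n} - {i}. (cmod (H i j \<omega>))\<^sup>2) \<le> (\<Sum>j<n. (cmod (H i j \<omega>))\<^sup>2)"
      by (rule sum_mono2) auto
    then show "(\<Sum>j\<in>{..<n} - {i}. (cmod (H i j \<omega>))\<^sup>2) \<le> K\<^sup>2"
      using H_row_bound[OF \<open>\<omega> \<in> space M\<close> assms(1)] by linarith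
  qed simp
  finally show ?thesis by (simp add: prob_space)
qed

text \<open>Moving \<open>j\<close> over the \<open>n - 2\<close> free positions of the row replaces
  the first factor by a row sum, at most \<open>K^2\<close>. The second moment of
  \<open>H i k\<close> supplies the remaining factor \<open>1 / (n - 1)\<close>.\<close>

lemma mixed_moment_offdiag:
  assumes "i < n" "j < n" "k < n" "i \<noteq> j" "i \<noteq> k" "j \<noteq> k"
  shows "real (n - 1) * real (n - 2) * expectation (\<lambda>\<omega>. (cmod (H i j \<omega>))\<^sup>2 * (cmod (H i k \<omega>))\<^sup>2) \<le> K ^ 4"
proof -
  have card: "card ({..<n} - {i, k}) = n - 2" using assms by (subst card_Diff_subset) auto
  have "real (n - 2) * expectation (\<lambda>\<omega>. (cmod (H i j \<omega>))\<^sup>2 * (cmod (H i k \<omega>))\<^sup>2)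
      = (\<Sum>j'\<in>{..<n} - {i, k}. expectation (\<lambda>\<omega>. (cmod (H i j \<omega>))\<^sup>2 * (cmod (H i k \<omega>))\<^sup>2))"
    by (simp add: card)
  also have "\<dots> = (\<Sum>j'\<in>{..<n} - {i, k}. expectation (\<lambda>\<omega>. (cmod (H i j' \<omega>))\<^sup>2 * (cmod (H i k \<omega>))\<^sup>2))"
    by (intro sum.cong refl expectation_H_mixed_swap) (use assms in auto)
  also have "\<dots> = expectation (\<lambda>\<omega>. \<Sum>j'\<in>{..<n} - {i, k}. (cmod (H i j' \<omega>))\<^sup>2 * (cmod (H i k \<omega>))\<^sup>2)"
    using assms integrable_H_mixed by (intro Bochner_Integration.integral_sum[symmetric]) auto
  also have "\<dots> \<le> expectation (\<lambda>\<omega>. K\<^sup>2 * (cmod (H i k \<omega>))\<^sup>2)"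
  proof (rule integral_mono)
    show "integrable M (\<lambda>\<omega>. \<Sum>j'\<in>{..<n} - {i, k}. (cmod (H i j' \<omega>))\<^sup>2 * (cmod (H i k \<omega>))\<^sup>2)"
      using assms integrable_H_mixed by (intro Bochner_Integration.integrable_sum) auto
    show "integrable M (\<lambda>\<omega>. K\<^sup>2 * (cmod (H i k \<omega>))\<^sup>2)"
      using assms integrable_H_power by (intro integrable_mult_right) auto
    fix \<omega> assume "\<omega> \<in> space M"
    have "(\<Sum>j'\<in>{..<n} - {i, k}. (cmod (H i j' \<omega>))\<^sup>2) \<le> (\<Sum>j<n. (cmod (H i j \<omega>))\<^sup>2)"
      by (rule sum_mono2) auto
    then have "(\<Sum>j'\<in>{..<n} - {i, k}. (cmod (H i j' \<omega>))\<^sup>2) \<le> K\<^sup>2"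
      using H_row_bound[OF \<open>\<omega> \<in> space M\<close> assms(1)] by linarith
    then show "(\<Sum>j'\<in>{..<n} - {i, k}. (cmod (H i j' \<omega>))\<^sup>2 * (cmod (H i k \<omega>))\<^sup>2) \<le> K\<^sup>2 * (cmod (H i k \<omega>))\<^sup>2"
      unfolding sum_distrib_right[symmetric] by (rule mult_right_mono) simp
  qed
  finally have "real (n - 2) * expectation (\<lambda>\<omega>. (cmod (H i j \<omega>))\<^sup>2 * (cmod (H i k \<omega>))\<^sup>2)
      \<le> K\<^sup>2 * expectation (\<lambda>\<omega>. (cmod (H i k \<omega>))\<^sup>2)" by simp
  then have "real (n - 1) * (real (n - 2) * expectation (\<lambda>\<omega>. (cmod (H i j \<omega>))\<^sup>2 * (cmod (H i k \<omega>))\<^sup>2))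
      \<le> real (n - 1) * (K\<^sup>2 * expectation (\<lambda>\<omega>. (cmod (H i k \<omega>))\<^sup>2))"
    by (rule mult_left_mono) simp
  also have "\<dots> = K\<^sup>2 * (real (n - 1) * expectation (\<lambda>\<omega>. (cmod (H i k \<omega>))\<^sup>2))" by simp
  also have "\<dots> \<le> K\<^sup>2 * K\<^sup>2"
    using assms by (intro mult_left_mono second_moment_offdiag) auto
  finally show ?thesis by (simp add: mult.assoc power_add[symmetric])
qed

text \<open>A rotation by 45 degrees in the plane \<open>(j, k)\<close> turns the mixed moment of \<open>H i j\<close> and \<open>H i k\<close>
  into a fourth moment; a second one turns \<open>H j k\<close> into \<open>(H j j - H k k) / 2\<close>.\<close>

lemma fourth_moment_offdiag:
  assumes "3 \<le> n" "i < n" "j < n" "i \<noteq> j"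
  shows "real (n - 1) * real (n - 2) * expectation (\<lambda>\<omega>. (cmod (H i j \<omega>)) ^ 4) \<le> 3 * K ^ 4"
proof -
  \<comment> \<open>The rotation plane needs an index \<open>k\<close> besides \<open>i\<close> and
    \<open>j\<close>. Two indices cannot cover \<open>0, 1, 2\<close>, and these lie in the matrix
    because \<open>3 \<le> n\<close>.\<close>
  have "\<not> {..<3::nat} \<subseteq> {i, j}"
    using card_mono[of "{i, j}" "{..<3::nat}"] card_insert_le_m1[of 2 "{j}" i] by auto
  then obtain k where k: "k < 3" "k \<noteq> i" "k \<noteq> j" by auto
  then have kn: "k < n" using assms by simp
  let ?s = "1 / sqrt 2 :: real"
  have s2: "?s\<^sup>2 = 1 / 2" by (simp add: power_divide)
  let ?a = "expectation (\<lambda>\<omega>. (cmod (H i j \<omega>))\<^sup>2 * (cmod (H i k \<omega>))\<^sup>2)"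
  let ?e = "\<lambda>k. expectation (\<lambda>\<omega>. (cmod (H i k \<omega>)) ^ 4)"
  have "?a = expectation (\<lambda>\<omega>. (cmod (of_real ?s * (H i j \<omega> + H i k \<omega>)))\<^sup>2 * (cmod (of_real ?s * (H i j \<omega> - H i k \<omega>)))\<^sup>2)"
    by (subst expectation_plane_refl[where j = j and k = k and c = ?s and s = ?s and p = i and q = j and p' = i and q' = k
          and F = "\<lambda>x y. (cmod x)\<^sup>2 * (cmod y)\<^sup>2"])
      (use assms k kn s2 in \<open>auto simp: mat_conj_n_plane_refl ring_distribs simp del: of_real_divide\<close>)
  also have "\<dots> = expectation (\<lambda>\<omega>. (cmod (H i j \<omega> + H i k \<omega>))\<^sup>2 * (cmod (H i j \<omega> - H i k \<omega>))\<^sup>2 / 4)"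
    by (simp add: norm_mult norm_divide power_mult_distrib power_divide)
  also have "\<dots> \<ge> expectation (\<lambda>\<omega>. ((cmod (H i j \<omega>))^4 + (cmod (H i k \<omega>))^4 - 2 * ((cmod (H i j \<omega>))\<^sup>2 * (cmod (H i k \<omega>))\<^sup>2)) / 4)"
  proof (rule integral_mono)
    show "integrable M (\<lambda>\<omega>. ((cmod (H i j \<omega>))^4 + (cmod (H i k \<omega>))^4 - 2 * ((cmod (H i j \<omega>))\<^sup>2 * (cmod (H i k \<omega>))\<^sup>2)) / 4)"
      using assms kn integrable_H_power integrable_H_mixed by auto
    show "integrable M (\<lambda>\<omega>. (cmod (H i j \<omega> + H i k \<omega>))\<^sup>2 * (cmod (H i j \<omega> - H i k \<omega>))\<^sup>2 / 4)"
    proof (rule integrable_bounded[of _ "(2 * K)\<^sup>2 * (2 * K)\<^sup>2 / 4"])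
      fix \<omega> assume \<omega>: "\<omega> \<in> space M"
      have "cmod (H i j \<omega> + H i k \<omega>) \<le> 2 * K" "cmod (H i j \<omega> - H i k \<omega>) \<le> 2 * K"
        using H_bound[OF \<omega>, of i j] H_bound[OF \<omega>, of i k] assms kn
          norm_triangle_ineq[of "H i j \<omega>" "H i k \<omega>"] norm_triangle_ineq4[of "H i j \<omega>" "H i k \<omega>"] by auto
      then show "\<bar>(cmod (H i j \<omega> + H i k \<omega>))\<^sup>2 * (cmod (H i j \<omega> - H i k \<omega>))\<^sup>2 / 4\<bar> \<le> (2 * K)\<^sup>2 * (2 * K)\<^sup>2 / 4"
        unfolding abs_divide abs_mult abs_numeral power_abs abs_norm_cancel
        by (intro divide_right_mono mult_mono power_mono) auto
    qed measurable
    fix \<omega>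
    show "((cmod (H i j \<omega>))^4 + (cmod (H i k \<omega>))^4 - 2 * ((cmod (H i j \<omega>))\<^sup>2 * (cmod (H i k \<omega>))\<^sup>2)) / 4
      \<le> (cmod (H i j \<omega> + H i k \<omega>))\<^sup>2 * (cmod (H i j \<omega> - H i k \<omega>))\<^sup>2 / 4"
      by (rule divide_right_mono[OF cmod_sum_diff_squares]) simp
  qed
  also have "expectation (\<lambda>\<omega>. ((cmod (H i j \<omega>))^4 + (cmod (H i k \<omega>))^4 - 2 * ((cmod (H i j \<omega>))\<^sup>2 * (cmod (H i k \<omega>))\<^sup>2)) / 4)
     = (?e j + ?e k - 2 * ?a) / 4"
    using assms kn integrable_H_power integrable_H_mixed by simp
  also have "?e k = ?e j" by (rule expectation_H_swap) (use assms k kn in auto)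
  \<comment> \<open>With equal fourth moments the bound reads
    \<open>?a \<ge> (2 * ?e j - 2 * ?a) / 4\<close>; this is where the factor 3 comes from.\<close>
  finally have "?e j \<le> 3 * ?a" by simp
  then have "real (n - 1) * real (n - 2) * ?e j \<le> real (n - 1) * real (n - 2) * (3 * ?a)"
    by (rule mult_left_mono) simp
  also have "\<dots> \<le> 3 * K ^ 4"
    using mixed_moment_offdiag[of i j k] assms k kn by simp
  finally show ?thesis .
qed

text \<open>\<open>H j k\<close> and \<open>H k j\<close> are conjugate, so they contribute only to
  the imaginary part of the rotated entry, and its real part is half the difference of the diagonal
  entries. The constant is \<open>2^4 * 3\<close>.\<close>

lemma fourth_moment_diag_diff:
  assumes "3 \<le> n" "j < n" "k < n"
  shows "real (n - 1) * real (n - 2) * expectation (\<lambda>\<omega>. (Re (H j j \<omega>) - Re (H k k \<omega>)) ^ 4) \<le> 48 * K ^ 4"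
proof (cases "j = k")
  case False
  let ?s = "1 / sqrt 2 :: real"
  have s2: "?s\<^sup>2 = 1 / 2" by (simp add: power_divide)
  have ss: "of_real ?s * (of_real ?s * z) = z / 2" for z :: complex
  proof -
    have "of_real ?s * (of_real ?s * z) = of_real (?s * ?s) * z" by (simp only: of_real_mult mult.assoc)
    also have "?s * ?s = 1 / 2" by simp
    finally show ?thesis by simp
  qed
  have "expectation (\<lambda>\<omega>. (Re (H j j \<omega>) - Re (H k k \<omega>)) ^ 4 / 16)
    \<le> expectation (\<lambda>\<omega>. cmod (mat_conj_n n (plane_refl j k ?s ?s) (\<lambda>a b. H a b \<omega>) j k) ^ 4)"
  proof (rule integral_mono)
    show "integrable M (\<lambda>\<omega>. (Re (H j j \<omega>) - Re (H k k \<omega>)) ^ 4 / 16)"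
      using assms integrable_H_diag_diff by auto
    have eq: "mat_conj_n n (plane_refl j k ?s ?s) (\<lambda>a b. H a b \<omega>) j k
        = (H j j \<omega> - H j k \<omega>) / 2 + (H k j \<omega> - H k k \<omega>) / 2" for \<omega>
      using assms False
      by (simp add: mat_conj_n_plane_refl right_diff_distrib[symmetric] ss del: of_real_divide)
    show "integrable M (\<lambda>\<omega>. cmod (mat_conj_n n (plane_refl j k ?s ?s) (\<lambda>a b. H a b \<omega>) j k) ^ 4)"
    proof (rule integrable_bounded[of _ "(2 * K) ^ 4"])
      fix \<omega> assume \<omega>: "\<omega> \<in> space M"
      have "cmod ((H j j \<omega> - H j k \<omega>) / 2) \<le> K" "cmod ((H k j \<omega> - H k k \<omega>) / 2) \<le> K"
        using H_bound[OF \<omega>, of j j] H_bound[OF \<omega>, of j k] H_bound[OF \<omega>, of k j] H_bound[OF \<omega>, of k k] assms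
          norm_triangle_ineq4[of "H j j \<omega>" "H j k \<omega>"] norm_triangle_ineq4[of "H k j \<omega>" "H k k \<omega>"]
        by (auto simp: norm_divide)
      then have "cmod (mat_conj_n n (plane_refl j k ?s ?s) (\<lambda>a b. H a b \<omega>) j k) \<le> 2 * K"
        unfolding eq using norm_triangle_ineq[of "(H j j \<omega> - H j k \<omega>) / 2" "(H k j \<omega> - H k k \<omega>) / 2"] by linarith
      then show "\<bar>cmod (mat_conj_n n (plane_refl j k ?s ?s) (\<lambda>a b. H a b \<omega>) j k) ^ 4\<bar> \<le> (2 * K) ^ 4"
        unfolding power_abs abs_norm_cancel by (rule power_mono) simp
    qed (simp add: eq)
    fix \<omega> assume \<omega>: "\<omega> \<in> space M"
    have Re_eq: "Re (mat_conj_n n (plane_refl j k ?s ?s) (\<lambda>a b. H a b \<omega>) j k) = (Re (H j j \<omega>) - Re (H k k \<omega>)) / 2"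
      unfolding eq using H_cnj[OF \<omega>, of j k] assms by (simp add: field_simps)
    have "(Re (H j j \<omega>) - Re (H k k \<omega>)) ^ 4 / 16 = ((Re (H j j \<omega>) - Re (H k k \<omega>)) / 2) ^ 4"
      by (simp add: power_divide)
    also have "\<dots> = \<bar>Re (mat_conj_n n (plane_refl j k ?s ?s) (\<lambda>a b. H a b \<omega>) j k)\<bar> ^ 4"
      unfolding Re_eq by (rule power_even_abs_numeral[symmetric]) simp
    also have "\<dots> \<le> cmod (mat_conj_n n (plane_refl j k ?s ?s) (\<lambda>a b. H a b \<omega>) j k) ^ 4"
      by (rule power_mono[OF abs_Re_le_cmod]) simp
    finally show "(Re (H j j \<omega>) - Re (H k k \<omega>)) ^ 4 / 16
      \<le> cmod (mat_conj_n n (plane_refl j k ?s ?s) (\<lambda>a b. H a b \<omega>) j k) ^ 4" .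
  qed
  also have "\<dots> = expectation (\<lambda>\<omega>. cmod (H j k \<omega>) ^ 4)"
    by (rule expectation_plane_refl[where p = j and q = k and p' = j and q' = k and F = "\<lambda>x y. cmod x ^ 4", symmetric])
      (use assms False s2 in auto)
  finally have "expectation (\<lambda>\<omega>. (Re (H j j \<omega>) - Re (H k k \<omega>)) ^ 4) \<le> 16 * expectation (\<lambda>\<omega>. cmod (H j k \<omega>) ^ 4)"
    by simp
  then have "real (n - 1) * real (n - 2) * expectation (\<lambda>\<omega>. (Re (H j j \<omega>) - Re (H k k \<omega>)) ^ 4)
     \<le> real (n - 1) * real (n - 2) * (16 * expectation (\<lambda>\<omega>. cmod (H j k \<omega>) ^ 4))"
    by (rule mult_left_mono) simp
  also have "\<dots> \<le> 48 * K ^ 4" using fourth_moment_offdiag[OF assms False] by simp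
  finally show ?thesis .
qed (use K_nonneg in simp)

text \<open>The deviation from the normalised trace is the average of the differences with all
  diagonal entries, so by convexity the bound for one difference carries over with the same
  constant.\<close>

lemma fourth_moment_diag:
  assumes "3 \<le> n" "j < n"
  shows "integrable M (\<lambda>\<omega>. (Re (H j j \<omega>) - (\<Sum>k<n. Re (H k k \<omega>)) / real n) ^ 4)"
    and "real (n - 1) * real (n - 2) *
      expectation (\<lambda>\<omega>. (Re (H j j \<omega>) - (\<Sum>k<n. Re (H k k \<omega>)) / real n) ^ 4) \<le> 48 * K ^ 4"
proof -
  let ?C = "real (n - 1) * real (n - 2)"
  let ?D = "\<lambda>\<omega>. \<Sum>k<n. (Re (H j j \<omega>) - Re (H k k \<omega>)) ^ 4"
  have le: "(Re (H j j \<omega>) - (\<Sum>k<n. Re (H k k \<omega>)) / real n) ^ 4 \<le> ?D \<omega> / real n" for \<omega>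
    using power4_mean_le[of n "\<lambda>k. Re (H j j \<omega>) - Re (H k k \<omega>)"] assms
    by (simp add: sum_subtractf diff_divide_distrib)
  have int: "integrable M (\<lambda>\<omega>. ?D \<omega> / real n)"
    using assms integrable_H_diag_diff by (intro integrable_divide Bochner_Integration.integrable_sum) auto
  show *: "integrable M (\<lambda>\<omega>. (Re (H j j \<omega>) - (\<Sum>k<n. Re (H k k \<omega>)) / real n) ^ 4)"
  proof (rule Bochner_Integration.integrable_bound[OF int])
    have "norm ((Re (H j j \<omega>) - (\<Sum>k<n. Re (H k k \<omega>)) / real n) ^ 4) \<le> norm (?D \<omega> / real n)" for \<omega>
    proof -
      have "0 \<le> ?D \<omega> / real n" by (intro divide_nonneg_nonneg sum_nonneg) auto
      then show ?thesis using le[of \<omega>] unfolding real_norm_def by (simp only: abs_of_nonneg) simp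
    qed
    then show "AE \<omega> in M. norm ((Re (H j j \<omega>) - (\<Sum>k<n. Re (H k k \<omega>)) / real n) ^ 4) \<le> norm (?D \<omega> / real n)" by simp
  qed measurable
  have "expectation (\<lambda>\<omega>. (Re (H j j \<omega>) - (\<Sum>k<n. Re (H k k \<omega>)) / real n) ^ 4) \<le> expectation (\<lambda>\<omega>. ?D \<omega> / real n)"
    by (rule integral_mono[OF * int le])
  also have "\<dots> = (\<Sum>k<n. expectation (\<lambda>\<omega>. (Re (H j j \<omega>) - Re (H k k \<omega>)) ^ 4)) / real n"
    using assms integrable_H_diag_diff by (simp add: Bochner_Integration.integral_sum)
  finally have "?C * expectation (\<lambda>\<omega>. (Re (H j j \<omega>) - (\<Sum>k<n. Re (H k k \<omega>)) / real n) ^ 4)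
    \<le> ?C * ((\<Sum>k<n. expectation (\<lambda>\<omega>. (Re (H j j \<omega>) - Re (H k k \<omega>)) ^ 4)) / real n)"
    by (rule mult_left_mono) simp
  also have "\<dots> = (\<Sum>k<n. ?C * expectation (\<lambda>\<omega>. (Re (H j j \<omega>) - Re (H k k \<omega>)) ^ 4)) / real n"
    by (simp add: sum_distrib_left)
  also have "\<dots> \<le> (\<Sum>k<n. 48 * K ^ 4) / real n"
    using fourth_moment_diag_diff[OF assms] by (intro divide_right_mono sum_mono) auto
  also have "\<dots> = 48 * K ^ 4" using assms by simp
  finally show "?C * expectation (\<lambda>\<omega>. (Re (H j j \<omega>) - (\<Sum>k<n. Re (H k k \<omega>)) / real n) ^ 4) \<le> 48 * K ^ 4" .
qed

end

text \<open>Plays the part of Borel-Cantelli: the series of the \<open>f n\<close> has finite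
  integral, hence converges almost everywhere, and its terms tend to 0.\<close>

lemma AE_tendsto_zero_of_summable_integral:
  fixes f :: "nat \<Rightarrow> 'a \<Rightarrow> real"
  assumes int: "\<And>n. integrable M (f n)" and nonneg: "\<And>n x. f n x \<ge> 0"
    and sum: "summable (\<lambda>n. integral\<^sup>L M (f n))"
  shows "AE x in M. (\<lambda>n. f n x) \<longlonglongrightarrow> 0"
proof -
  have [measurable]: "f n \<in> borel_measurable M" for n using int by auto
  have "(\<integral>\<^sup>+x. (\<Sum>n. ennreal (f n x)) \<partial>M) = (\<Sum>n. \<integral>\<^sup>+x. ennreal (f n x) \<partial>M)"
    by (rule nn_integral_suminf) measurable
  also have "\<dots> = (\<Sum>n. ennreal (integral\<^sup>L M (f n)))"
    using int nonneg by (simp add: nn_integral_eq_integral)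
  also have "\<dots> = ennreal (\<Sum>n. integral\<^sup>L M (f n))"
    by (rule suminf_ennreal2) (auto intro: sum integral_nonneg_AE simp: nonneg)
  finally have "(\<integral>\<^sup>+x. (\<Sum>n. ennreal (f n x)) \<partial>M) \<noteq> \<infinity>" by simp
  then have "AE x in M. (\<Sum>n. ennreal (f n x)) \<noteq> \<infinity>"
    by (intro nn_integral_noteq_infinite) auto
  then show ?thesis
  proof eventually_elim
    case (elim x)
    then have "summable (\<lambda>n. f n x)"
      by (intro summable_suminf_not_top) (auto simp: nonneg)
    then show ?case by (rule summable_LIMSEQ_zero)
  qed
qed

lemma tendsto_zero_if_power4_tendsto_zero:
  fixes f :: "'a \<Rightarrow> 'b::real_normed_div_algebra"
  assumes "((\<lambda>n. norm (f n) ^ 4) \<longlongrightarrow> 0) F"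
  shows "(f \<longlongrightarrow> 0) F"
proof (rule tendstoI)
  fix e :: real assume "e > 0"
  then have "\<forall>\<^sub>F n in F. norm (f n) ^ 4 < e ^ 4" using order_tendstoD(2)[OF assms, of "e^4"] by simp
  then show "\<forall>\<^sub>F n in F. dist (f n) 0 < e"
    by eventually_elim (use \<open>e > 0\<close> in \<open>auto intro: power_less_imp_less_base\<close>)
qed

text \<open>The bound is of order \<open>n^-2\<close>, hence summable. It starts at \<open>N\<close>
  because a fixed entry lies in the matrix only for large \<open>n\<close>; the type class covers
  complex entries and real deviations from the trace.\<close>

lemma AE_tendsto_zero_of_fourth_moment:
  fixes f :: "nat \<Rightarrow> 'a \<Rightarrow> 'b::real_normed_div_algebra"
  assumes "\<And>n. N \<le> n \<Longrightarrow> integrable M (\<lambda>x. norm (f n x) ^ 4)"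
    and "\<And>n. N \<le> n \<Longrightarrow> real (n - 1) * real (n - 2) * integral\<^sup>L M (\<lambda>x. norm (f n x) ^ 4) \<le> C"
    and "3 \<le> N"
  shows "AE x in M. (\<lambda>n. f n x) \<longlonglongrightarrow> 0"
proof -
  let ?I = "\<lambda>n. integral\<^sup>L M (\<lambda>x. norm (f (n + N) x) ^ 4)"
  have "summable ?I"
  proof (rule summable_comparison_test')
    show "summable (\<lambda>n. C * inverse (real (Suc n)) ^ 2)"
      using inverse_power_summable[of 2, where 'a = real] summable_Suc_iff[of "\<lambda>n. inverse (real n) ^ 2"]
      by (intro summable_mult) (simp add: power_inverse)
    fix n :: nat
    have nn: "?I n \<ge> 0" by (rule integral_nonneg_AE) auto
    \<comment> \<open>Because \<open>3 \<le> N\<close>, both shifted factors are at least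
      \<open>Suc n\<close>.\<close>
    have "real (Suc n) ^ 2 * ?I n \<le> real (n + N - 1) * real (n + N - 2) * ?I n"
      unfolding power2_eq_square using assms(3) by (intro mult_right_mono mult_mono nn) auto
    also have "\<dots> \<le> C" by (rule assms(2)) simp
    finally have "?I n \<le> C / real (Suc n) ^ 2" by (simp add: pos_le_divide_eq mult.commute)
    then show "norm (?I n) \<le> C * inverse (real (Suc n)) ^ 2"
      using nn by (simp add: divide_inverse power_inverse)
  qed
  then have "AE x in M. (\<lambda>n. norm (f (n + N) x) ^ 4) \<longlonglongrightarrow> 0"
    using assms(1) by (intro AE_tendsto_zero_of_summable_integral) auto
  then show ?thesis
  proof eventually_elim
    case (elim x)
    then have "(\<lambda>n. f (n + N) x) \<longlonglongrightarrow> 0" by (rule tendsto_zero_if_power4_tendsto_zero)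
    then show ?case by (rule LIMSEQ_offset)
  qed
qed

text \<open>On the diagonal, the normalised trace is the mean of \<open>h\<close> over the spectrum,
  which converges to \<open>\<gamma>\<close> by hypothesis. The same \<open>K\<close> for all
  \<open>n\<close> keeps the moment bounds summable.\<close>

lemma func_calc_entries_AE_tendsto:
  assumes Y: "\<And>n. invariant_random_matrix M n (Y n) h K"
    and esd: "AE \<omega> in M. (\<lambda>n. (\<Sum>i<n. h (eig n (Y n \<omega>) (Suc i))) / real n) \<longlonglongrightarrow> \<gamma>"
  shows "AE \<omega> in M. (\<lambda>n. func_calc h n (Y n \<omega>) k l) \<longlonglongrightarrow> (if k = l then of_real \<gamma> else 0)"
proof (cases "k = l")
  case False
  have "AE \<omega> in M. (\<lambda>n. func_calc h n (Y n \<omega>) k l) \<longlonglongrightarrow> 0"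
  proof (rule AE_tendsto_zero_of_fourth_moment)
    fix n assume n: "k + l + 3 \<le> n"
    interpret invariant_random_matrix M n "Y n" h K by (rule Y)
    show "integrable M (\<lambda>\<omega>. cmod (func_calc h n (Y n \<omega>) k l) ^ 4)"
      using integrable_H_power[of k l 4] n by (simp add: H_def)
    show "real (n - 1) * real (n - 2) * (\<integral>\<omega>. cmod (func_calc h n (Y n \<omega>) k l) ^ 4 \<partial>M) \<le> 3 * K ^ 4"
      using fourth_moment_offdiag[of k l] n False by (simp add: H_def)
  qed simp
  with False show ?thesis by simp
next
  case True
  let ?tr = "\<lambda>n \<omega>. (\<Sum>i<n. h (eig n (Y n \<omega>) (Suc i))) / real n"
  have tr: "(\<Sum>i<n. Re (func_calc h n (Y n \<omega>) i i)) / real n = ?tr n \<omega>" if \<omega>: "\<omega> \<in> space M" for n \<omega>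
  proof -
    interpret invariant_random_matrix M n "Y n" h K by (rule Y)
    obtain U where U: "eig_decomp n (Y n \<omega>) U (\<lambda>i. eig n (Y n \<omega>) (Suc i))"
      using hermitian_eig_decomp(1)[OF X_herm[OF \<omega>], of False] by auto
    show ?thesis unfolding Re_sum[symmetric] func_calc_trace[OF h_cont U] by simp
  qed
  have "AE \<omega> in M. (\<lambda>n. Re (func_calc h n (Y n \<omega>) k k) - (\<Sum>i<n. Re (func_calc h n (Y n \<omega>) i i)) / real n) \<longlonglongrightarrow> 0"
  proof (rule AE_tendsto_zero_of_fourth_moment)
    fix n assume n: "k + 3 \<le> n"
    interpret invariant_random_matrix M n "Y n" h K by (rule Y)
    show "integrable M (\<lambda>\<omega>. norm (Re (func_calc h n (Y n \<omega>) k k) - (\<Sum>i<n. Re (func_calc h n (Y n \<omega>) i i)) / real n) ^ 4)"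
      "real (n - 1) * real (n - 2) * (\<integral>\<omega>. norm (Re (func_calc h n (Y n \<omega>) k k) - (\<Sum>i<n. Re (func_calc h n (Y n \<omega>) i i)) / real n) ^ 4 \<partial>M) \<le> 48 * K ^ 4"
      using fourth_moment_diag[of k] n by (simp_all add: H_def power_even_abs_numeral)
  qed simp
  then show ?thesis using esd AE_space
  proof eventually_elim
    case (elim \<omega>)
    have "(\<lambda>n. (Re (func_calc h n (Y n \<omega>) k k) - ?tr n \<omega>) + ?tr n \<omega>) \<longlonglongrightarrow> 0 + \<gamma>"
      using elim tr by (intro tendsto_add) auto
    then have "(\<lambda>n. complex_of_real (Re (func_calc h n (Y n \<omega>) k k))) \<longlonglongrightarrow> of_real \<gamma>"
      by (intro tendsto_of_real) simp
    moreover have "\<forall>\<^sub>F n in sequentially. complex_of_real (Re (func_calc h n (Y n \<omega>) k k)) = func_calc h n (Y n \<omega>) k k"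
      using eventually_gt_at_top[of k]
    proof eventually_elim
      case (elim n)
      interpret invariant_random_matrix M n "Y n" h K by (rule Y)
      have "H k k \<omega> = cnj (H k k \<omega>)" using H_cnj[OF \<open>\<omega> \<in> space M\<close> elim elim] .
      then show ?case unfolding H_def by (metis Reals_cnj_iff of_real_Re)
    qed
    ultimately show ?case using True by (simp add: tendsto_cong)
  qed
qed

section \<open>Finite-rank perturbations\<close>

lemma mat_conj_n_mat_conj_n:
  "mat_conj_n n U (mat_conj_n n W A) = mat_conj_n n (\<lambda>i k. \<Sum>p<n. U i p * W p k) A"
proof (intro ext)
  fix i j
  let ?F = "\<lambda>k l p q. U i k * W k p * A p q * cnj (W l q) * cnj (U j l)"
  have "(\<Sum>k<n. \<Sum>l<n. \<Sum>p<n. \<Sum>q<n. ?F k l p q) = (\<Sum>k<n. \<Sum>p<n. \<Sum>l<n. \<Sum>q<n. ?F k l p q)"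
    by (intro sum.cong refl sum.swap)
  also have "\<dots> = (\<Sum>p<n. \<Sum>k<n. \<Sum>l<n. \<Sum>q<n. ?F k l p q)" by (rule sum.swap)
  also have "\<dots> = (\<Sum>p<n. \<Sum>k<n. \<Sum>q<n. \<Sum>l<n. ?F k l p q)" by (intro sum.cong refl sum.swap)
  also have "\<dots> = (\<Sum>p<n. \<Sum>q<n. \<Sum>k<n. \<Sum>l<n. ?F k l p q)" by (intro sum.cong refl sum.swap)
  finally show "mat_conj_n n U (mat_conj_n n W A) i j = mat_conj_n n (\<lambda>i k. \<Sum>p<n. U i p * W p k) A i j"
    by (auto simp: mat_conj_n_def sum_distrib_left sum_distrib_right mult_ac)
qed

lemma eig_decomp_hermitian: "eig_decomp n A U lam \<Longrightarrow> hermitian_n n A"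
  by (auto simp: eig_decomp_def hermitian_n_def mult_ac)

lemma hermitian_n_mat_conj_n:
  assumes "hermitian_n n A" "unitary_n n W"
  shows "hermitian_n n (mat_conj_n n W A)"
proof -
  obtain U where "eig_decomp n A U (\<lambda>i. eig n A (Suc i))"
    using hermitian_eig_decomp(1)[OF assms(1), of False] by auto
  from eig_decomp_mat_conj_n[OF this assms(2)] show ?thesis by (rule eig_decomp_hermitian)
qed

lemma eigs_desc_eqI:
  assumes "eig_decomp n A U lam" "eig_decomp n B V lam"
  shows "eigs_desc n A = eigs_desc n B"
proof -
  have "eigs_desc n C = rev (sorted_list_of_multiset (mset (eigs_desc n C)))" for C
    by (simp add: eigs_desc_def)
  then show ?thesis by (metis assms eig_decomp_mset_eigs_desc)
qed

lemma eig_mat_conj_n: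
  assumes "hermitian_n n A" "unitary_n n W"
  shows "eig n (mat_conj_n n W A) i = eig n A i"
proof -
  obtain U where "eig_decomp n A U (\<lambda>i. eig n A (Suc i))"
    using hermitian_eig_decomp(1)[OF assms(1), of False] by auto
  from eigs_desc_eqI[OF eig_decomp_mat_conj_n[OF this assms(2)] this] show ?thesis by (simp add: eig_def)
qed

text \<open>The product \<open>U W\<close> is again an admissible conjugation, so conjugating
  \<open>X\<close> by \<open>W\<close> or by \<open>U W\<close> gives the law of \<open>X\<close> in
  both cases. \<open>W\<close> is fixed before the sample.\<close>

lemma invariant_random_matrix_mat_conj_n:
  assumes "prob_space M" and X: "X \<in> measurable M mat_space" "\<And>\<omega>. \<omega> \<in> space M \<Longrightarrow> hermitian_n n (X \<omega>)"
    and inv: "\<And>U. unitary_n n U \<Longrightarrow> (real_case \<longrightarrow> real_entries_n n U) \<Longrightarrow>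
      distr M mat_space (\<lambda>\<omega>. mat_conj_n n U (X \<omega>)) = distr M mat_space X"
    and W: "unitary_n n W" "real_case \<longrightarrow> real_entries_n n W"
    and h: "continuous_on UNIV h" "\<And>x. \<bar>h x\<bar> \<le> K"
  shows "invariant_random_matrix M n (\<lambda>\<omega>. mat_conj_n n W (X \<omega>)) h K"
proof -
  interpret prob_space M by fact
  show ?thesis
  proof
    show "(\<lambda>\<omega>. mat_conj_n n W (X \<omega>)) \<in> measurable M mat_space"
      by (rule measurable_compose[OF X(1) measurable_mat_conj_n])
    fix U assume U: "unitary_n n U" "real_entries_n n U"
    have "real_entries_n n (\<lambda>i k. \<Sum>p<n. U i p * W p k)" if real_case
      using U W that by (auto simp: real_entries_n_def intro!: sum_in_Reals Reals_mult)
    then show "distr M mat_space (\<lambda>\<omega>. mat_conj_n n U (mat_conj_n n W (X \<omega>)))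
        = distr M mat_space (\<lambda>\<omega>. mat_conj_n n W (X \<omega>))"
      unfolding mat_conj_n_mat_conj_n using U W by (simp add: inv unitary_n_mult)
  qed (use X W h hermitian_n_mat_conj_n in auto)
qed

lemma hermitian_diagonalisation:
  assumes "hermitian_n n P" "real_case \<Longrightarrow> real_entries_n n P"
  shows "\<exists>W. unitary_n n W \<and> (real_case \<longrightarrow> real_entries_n n W) \<and>
    (\<forall>i<n. \<forall>j<n. mat_conj_n n W P i j = (if i = j then of_real (eig n P (Suc i)) else 0))"
proof -
  obtain V where V: "eig_decomp n P V (\<lambda>i. eig n P (Suc i))" "real_case \<longrightarrow> real_entries_n n V"
    using hermitian_eig_decomp(1)[OF assms] by auto
  then have uV: "unitary_n n V" and eq: "\<And>k l. k < n \<Longrightarrow> l < n \<Longrightarrow> P k l = (\<Sum>i<n. of_real (eig n P (Suc i)) * (V k i * cnj (V l i)))"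
    by (auto simp: eig_decomp_def)
  define W where "W = (\<lambda>i k. cnj (V k i))"
  have "unitary_n n W" unfolding W_def by (rule unitary_n_adjoint[OF uV])
  moreover have "real_case \<longrightarrow> real_entries_n n W"
    using V(2) by (auto simp: W_def real_entries_n_def Reals_cnj_iff)
  moreover have "mat_conj_n n W P i j = (if i = j then of_real (eig n P (Suc i)) else 0)" if ij: "i < n" "j < n" for i j
  proof -
    have "mat_conj_n n W P i j = (\<Sum>t<n. of_real (eig n P (Suc t)) * ((\<Sum>p<n. W i p * V p t) * cnj (\<Sum>p<n. W j p * V p t)))"
      using ij eq by (rule mat_conj_n_spectral)
    also have "\<dots> = (\<Sum>t<n. of_real (eig n P (Suc t)) * ((if i = t then 1 else 0) * cnj (if j = t then 1 else 0)))"
      by (intro sum.cong refl) (use ij in \<open>simp add: W_def unitary_n_cols[OF uV]\<close>)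
    also have "\<dots> = (\<Sum>t<n. if t = i then (if i = j then of_real (eig n P (Suc i)) else 0) else 0)"
      by (intro sum.cong refl) auto
    finally show ?thesis using ij by simp
  qed
  ultimately show ?thesis by blast
qed

lemma mat_conj_n_mat_add:
  "i < n \<Longrightarrow> j < n \<Longrightarrow> mat_conj_n n W (mat_add A P) i j = mat_conj_n n W A i j + mat_conj_n n W P i j"
  by (simp add: mat_conj_n_def mat_add_def algebra_simps sum.distrib)

lemma hermitian_n_mat_add: "hermitian_n n A \<Longrightarrow> hermitian_n n P \<Longrightarrow> hermitian_n n (mat_add A P)"
  unfolding hermitian_n_def mat_add_def complex_cnj_add by metis

text \<open>The same \<open>W\<close> is applied to \<open>A\<close> and to \<open>A + P\<close>; it
  keeps both spectra, so the decompositions carry the eigenvalues of the original matrices.\<close>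

lemma eig_decomp_perturbation:
  assumes A: "hermitian_n n A" and P: "hermitian_n n P" and W: "unitary_n n W"
    and diag: "\<And>i j. i < n \<Longrightarrow> j < n \<Longrightarrow> mat_conj_n n W P i j = (if i = j then of_real (d i) else 0)"
  obtains T Z where "eig_decomp n (mat_conj_n n W A) T (\<lambda>i. eig n A (Suc i))"
    and "eig_decomp n (add_diag (mat_conj_n n W A) d) Z (\<lambda>i. eig n (mat_add A P) (Suc i))"
proof -
  have AP: "hermitian_n n (mat_add A P)" using A P by (rule hermitian_n_mat_add)
  obtain U V where UV: "eig_decomp n A U (\<lambda>i. eig n A (Suc i))"
      "eig_decomp n (mat_add A P) V (\<lambda>i. eig n (mat_add A P) (Suc i))"
    using hermitian_eig_decomp(1)[OF A, of False] hermitian_eig_decomp(1)[OF AP, of False] by auto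
  have "add_diag (mat_conj_n n W A) d i j = mat_conj_n n W (mat_add A P) i j" if "i < n" "j < n" for i j
    using that by (simp add: add_diag_def mat_conj_n_mat_add diag)
  with eig_decomp_mat_conj_n[OF UV(2) W]
  have "eig_decomp n (add_diag (mat_conj_n n W A) d) (\<lambda>k i. \<Sum>p<n. W k p * V p i) (\<lambda>i. eig n (mat_add A P) (Suc i))"
    by (simp add: eig_decomp_def)
  then show ?thesis by (rule that[OF eig_decomp_mat_conj_n[OF UV(1) W]])
qed

text \<open>A bounded continuous function that equals \<open>1 / (z - x)\<close> off \<open>(z - \<delta>, z + \<delta>)\<close>, where for large \<open>n\<close>
  there are no eigenvalues.\<close>

definition trunc_resolvent :: "real \<Rightarrow> real \<Rightarrow> real \<Rightarrow> real" where
  "trunc_resolvent z \<delta> x = (z - x) / max (\<delta>\<^sup>2) ((z - x)\<^sup>2)"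

lemma trunc_resolvent_eq: "\<delta> > 0 \<Longrightarrow> \<delta> \<le> \<bar>z - x\<bar> \<Longrightarrow> trunc_resolvent z \<delta> x = 1 / (z - x)"
proof -
  assume "\<delta> > 0" "\<delta> \<le> \<bar>z - x\<bar>"
  then have "\<delta>\<^sup>2 \<le> (z - x)\<^sup>2" using power_mono[of \<delta> "\<bar>z - x\<bar>" 2] by simp
  then show ?thesis by (simp add: trunc_resolvent_def max_absorb2 power2_eq_square)
qed

lemma trunc_resolvent_bound:
  assumes "\<delta> > 0"
  shows "\<bar>trunc_resolvent z \<delta> x\<bar> \<le> 1 / \<delta>"
proof (cases "\<delta> \<le> \<bar>z - x\<bar>")
  case True
  then show ?thesis using assms by (simp add: trunc_resolvent_eq abs_divide frac_le)
next
  case False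
  then have "(z - x)\<^sup>2 \<le> \<delta>\<^sup>2" using power_mono[of "\<bar>z - x\<bar>" \<delta> 2] by simp
  then have "\<bar>trunc_resolvent z \<delta> x\<bar> = \<bar>z - x\<bar> / \<delta>\<^sup>2"
    by (simp add: trunc_resolvent_def max_absorb1 abs_divide)
  also have "\<dots> \<le> \<delta> / \<delta>\<^sup>2" using False by (intro divide_right_mono) auto
  finally show ?thesis using assms by (simp add: power2_eq_square)
qed

lemma continuous_on_trunc_resolvent: "\<delta> > 0 \<Longrightarrow> continuous_on UNIV (trunc_resolvent z \<delta>)"
  unfolding trunc_resolvent_def
  by (intro continuous_intros) (auto simp: max_def)

section \<open>The perturbed spectrum relative to a level \<open>z\<close>\<close>

locale spiked_model = prob_space M for M :: "'w measure" +
  fixes X :: "nat \<Rightarrow> 'w \<Rightarrow> nat \<Rightarrow> nat \<Rightarrow> complex" and P :: "nat \<Rightarrow> nat \<Rightarrow> nat \<Rightarrow> complex"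
    and real_case :: bool and r :: nat and \<theta> :: "nat \<Rightarrow> real"
  assumes X_herm: "\<And>n \<omega>. \<omega> \<in> space M \<Longrightarrow> hermitian_n n (X n \<omega>)"
    and X_meas: "\<And>n. X n \<in> measurable M mat_space"
    and X_inv: "\<And>n U. unitary_n n U \<Longrightarrow> (real_case \<longrightarrow> real_entries_n n U) \<Longrightarrow>
      distr M mat_space (\<lambda>\<omega>. mat_conj_n n U (X n \<omega>)) = distr M mat_space (X n)"
    and P_herm: "\<And>n. hermitian_n n (P n)" "\<And>n. real_case \<Longrightarrow> real_entries_n n (P n)"
    and P_spec: "\<And>n. r \<le> n \<Longrightarrow> eigs_desc n (P n) = map \<theta> [1..<r+1] @ replicate (n - r) 0"
    and theta_antimono: "\<And>i j. 1 \<le> i \<Longrightarrow> i \<le> j \<Longrightarrow> j \<le> r \<Longrightarrow> \<theta> j \<le> \<theta> i"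
    and theta_r_pos: "\<theta> r > 0"
begin

abbreviation "X' n \<omega> \<equiv> mat_add (X n \<omega>) (P n)"

lemma theta_pos: "1 \<le> i \<Longrightarrow> i \<le> r \<Longrightarrow> \<theta> i > 0"
  using theta_antimono[of i r] theta_r_pos by simp

lemma eig_P:
  assumes "r \<le> n" "k < n"
  shows "eig n (P n) (Suc k) = (if k < r then \<theta> (Suc k) else 0)"
  using assms by (auto simp: eig_def P_spec nth_append simp del: upt_Suc)

lemma eig_antimono_X: "\<omega> \<in> space M \<Longrightarrow> 1 \<le> i \<Longrightarrow> i \<le> j \<Longrightarrow> j \<le> n \<Longrightarrow> eig n (X n \<omega>) j \<le> eig n (X n \<omega>) i"
  by (rule eig_antimono[OF X_herm, of _ False]) auto

lemma eig_antimono_X':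
  "\<omega> \<in> space M \<Longrightarrow> 1 \<le> i \<Longrightarrow> i \<le> j \<Longrightarrow> j \<le> n \<Longrightarrow> eig n (X' n \<omega>) j \<le> eig n (X' n \<omega>) i"
  by (rule eig_antimono[OF hermitian_n_mat_add[OF X_herm P_herm(1)], of _ False]) auto

lemma eig_perturbed_bounds:
  assumes \<omega>: "\<omega> \<in> space M" and r: "r \<le> n" and t: "1 \<le> t"
  shows "t \<le> n \<Longrightarrow> eig n (X n \<omega>) t \<le> eig n (X' n \<omega>) t"
    and "t + r \<le> n \<Longrightarrow> eig n (X' n \<omega>) (t + r) \<le> eig n (X n \<omega>) t"
proof -
  obtain W where W: "unitary_n n W"
    "\<And>i j. i < n \<Longrightarrow> j < n \<Longrightarrow> mat_conj_n n W (P n) i j = (if i = j then of_real (eig n (P n) (Suc i)) else 0)"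
    using hermitian_diagonalisation[where n = n and real_case = False, OF P_herm(1)] by blast
  obtain T Z where TZ: "eig_decomp n (mat_conj_n n W (X n \<omega>)) T (\<lambda>i. eig n (X n \<omega>) (Suc i))"
    "eig_decomp n (add_diag (mat_conj_n n W (X n \<omega>)) (\<lambda>i. eig n (P n) (Suc i))) Z (\<lambda>i. eig n (X' n \<omega>) (Suc i))"
    using eig_decomp_perturbation[OF X_herm[OF \<omega>] P_herm(1) W] by blast
  have d: "eig n (P n) (Suc k) \<ge> 0" if "k < n" for k
    using that r theta_pos[of "Suc k"] by (cases "k < r") (auto simp: eig_P Suc_le_eq)
  show "eig n (X n \<omega>) t \<le> eig n (X' n \<omega>) t" if "t \<le> n"
    using eig_add_diag_ge[OF TZ _ _ d, of "t - 1"] eig_antimono_X[OF \<omega>] eig_antimono_X'[OF \<omega>] t that by simp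
  show "eig n (X' n \<omega>) (t + r) \<le> eig n (X n \<omega>) t" if "t + r \<le> n"
    using eig_add_diag_shift_le[OF TZ, of r "t - 1"] eig_antimono_X[OF \<omega>] eig_antimono_X'[OF \<omega>] t that r
    by (simp add: eig_P)
qed

text \<open>Deterministic, at one sample point: the margin \<open>\<delta>\<close> makes
  \<open>trunc_resolvent\<close> agree with the resolvent on the spectrum. The guard
  \<open>0 < m\<close> matters for the unbounded gap: by truncated subtraction
  \<open>eig n A 0\<close> is the largest eigenvalue, which lies below \<open>z\<close>
  there.\<close>

lemma eig_perturbed_threshold:
  fixes z \<delta> :: real
  assumes \<omega>: "\<omega> \<in> space M" and n: "m + r \<le> n" and i: "1 \<le> i" "i \<le> r" and \<delta>: "\<delta> > 0"
    and W: "unitary_n n W"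
      "\<And>i j. i < n \<Longrightarrow> j < n \<Longrightarrow> mat_conj_n n W (P n) i j = (if i = j then of_real (eig n (P n) (Suc i)) else 0)"
    and gap: "0 < m \<Longrightarrow> z + \<delta> \<le> eig n (X n \<omega>) m" "eig n (X n \<omega>) (m + 1) \<le> z - \<delta>"
    and S: "\<And>k l. k < r \<Longrightarrow> l < r \<Longrightarrow>
      cmod (func_calc (trunc_resolvent z \<delta>) n (mat_conj_n n W (X n \<omega>)) k l - (if k = l then of_real g else 0)) \<le> e"
  shows "1 / \<theta> i + real r * e < g \<Longrightarrow> z < eig n (X' n \<omega>) (m + i)"
    and "g + real r * e < 1 / \<theta> i \<Longrightarrow> eig n (X' n \<omega>) (m + i) < z"
proof -
  let ?lam = "\<lambda>i. eig n (X n \<omega>) (Suc i)"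
  obtain T Z where T: "eig_decomp n (mat_conj_n n W (X n \<omega>)) T ?lam"
    and Z: "eig_decomp n (add_diag (mat_conj_n n W (X n \<omega>)) (\<lambda>i. eig n (P n) (Suc i))) Z (\<lambda>i. eig n (X' n \<omega>) (Suc i))"
    using eig_decomp_perturbation[OF X_herm[OF \<omega>] P_herm(1) W] by blast
  have lo: "z + \<delta> \<le> ?lam t" if "t < m" for t
    using gap(1) eig_antimono_X[OF \<omega>, of "Suc t" m n] n that by simp
  have hi: "?lam t \<le> z - \<delta>" if "m \<le> t" "t < n" for t
    using gap(2) eig_antimono_X[OF \<omega>, of "m + 1" "Suc t" n] that by simp
  have S': "cmod ((\<Sum>i<n. of_real (1 / (z - ?lam i)) * (T k i * cnj (T l i))) - (if k = l then of_real g else 0)) \<le> e"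
    if "k < r" "l < r" for k l
  proof -
    have "k < n" "l < n" using that n by auto
    then have "func_calc (trunc_resolvent z \<delta>) n (mat_conj_n n W (X n \<omega>)) k l
       = (\<Sum>i<n. of_real (trunc_resolvent z \<delta> (?lam i)) * (T k i * cnj (T l i)))"
      by (rule func_calc_eig_decomp[OF continuous_on_trunc_resolvent[OF \<delta>] T])
    also have "\<dots> = (\<Sum>i<n. of_real (1 / (z - ?lam i)) * (T k i * cnj (T l i)))"
    proof (intro sum.cong refl)
      fix t assume "t \<in> {..<n}"
      then have "\<delta> \<le> \<bar>z - ?lam t\<bar>" using lo[of t] hi[of t] by (cases "t < m") auto
      then show "of_real (trunc_resolvent z \<delta> (?lam t)) * (T k t * cnj (T l t)) = of_real (1 / (z - ?lam t)) * (T k t * cnj (T l t))"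
        by (simp only: trunc_resolvent_eq[OF \<delta>])
    qed
    finally show ?thesis using S[OF that] by simp
  qed
  have e0: "e \<ge> 0" using order_trans[OF norm_ge_zero S'[of 0 0]] i by simp
  have d: "eig n (P n) (Suc k) = (if k < r then \<theta> (Suc k) else 0)" if "k < n" for k
    using that n by (intro eig_P) auto
  note anti = eig_antimono_X'[OF \<omega>]
  show "z < eig n (X' n \<omega>) (m + i)" if g: "1 / \<theta> i + real r * e < g"
  proof -
    \<comment> \<open>The lower bound only involves the corner of size \<open>i\<close>; its error
      is enlarged so that both directions share the factor \<open>real r\<close>.\<close>
    have "real i * e \<le> real r * e" using i e0 by (intro mult_right_mono) auto
    then have "1 / \<theta> i + real i * e < g" using g by simp
    then have "z < eig n (X' n \<omega>) (Suc (m + i - 1))"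
    proof (intro eig_add_diag_gt[OF T Z, where s = i and e = e])
      show "eig n (P n) (Suc k) \<ge> \<theta> i" if "k < i" for k
        using that i n d[of k] theta_antimono[of "Suc k" i] by simp
      show "eig n (P n) (Suc k) \<ge> 0" if "k < n" for k
        using d[OF that] theta_pos[of "Suc k"] by (cases "k < r") (auto simp: Suc_le_eq)
      show "z < ?lam t" if "t < m" for t using lo[OF that] \<delta> by simp
      show "?lam t < z" if "m \<le> t" "t < n" for t using hi[OF that] \<delta> by simp
      show "eig n (X' n \<omega>) (Suc l) \<le> eig n (X' n \<omega>) (Suc k)" if "k \<le> l" "l < n" for k l
        using that by (intro anti) auto
    qed (use i n S' theta_pos in auto)
    then show ?thesis using i by simp
  qed
  show "eig n (X' n \<omega>) (m + i) < z" if g: "g + real r * e < 1 / \<theta> i"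
  proof -
    have "eig n (X' n \<omega>) (Suc (m + i - 1)) < z"
    proof (rule eig_add_diag_lt[OF T Z _ _ _ _ _ _ _ _ _ _ S' g])
      show "eig n (P n) (Suc k) \<le> \<theta> i" if "i - 1 \<le> k" "k < r" for k
        using that i n d[of k] theta_antimono[of i "Suc k"] by simp
      show "eig n (P n) (Suc k) > 0" if "k < r" for k
        using that n d[of k] theta_pos[of "Suc k"] by simp
      show "eig n (P n) (Suc k) = 0" if "r \<le> k" "k < n" for k
        using that d[of k] by simp
      show "z < ?lam t" if "t < m" for t using lo[OF that] \<delta> by simp
      show "?lam t < z" if "m \<le> t" "t < n" for t using hi[OF that] \<delta> by simp
      show "eig n (X' n \<omega>) (Suc l) \<le> eig n (X' n \<omega>) (Suc k)" if "k \<le> l" "l < n" for k l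
        using that by (intro anti) auto
    qed (use i n theta_pos in auto)
    then show ?thesis using i by simp
  qed
qed

lemma AE_eig_perturbed_threshold:
  fixes z \<delta> \<gamma> :: real and m :: "nat \<Rightarrow> nat"
  assumes i: "1 \<le> i" "i \<le> r" and \<delta>: "\<delta> > 0" and m: "\<forall>\<^sub>F n in sequentially. m n + r \<le> n"
    and esd: "AE \<omega> in M. (\<lambda>n. (\<Sum>i=1..n. trunc_resolvent z \<delta> (eig n (X n \<omega>) i)) / real n) \<longlonglongrightarrow> \<gamma>"
    and gap: "AE \<omega> in M. \<forall>\<^sub>F n in sequentially. (0 < m n \<longrightarrow> z + \<delta> \<le> eig n (X n \<omega>) (m n)) \<and>
      eig n (X n \<omega>) (m n + 1) \<le> z - \<delta>"
  shows "AE \<omega> in M. \<forall>\<^sub>F n in sequentially.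
      (1 / \<theta> i < \<gamma> \<longrightarrow> z < eig n (X' n \<omega>) (m n + i)) \<and> (\<gamma> < 1 / \<theta> i \<longrightarrow> eig n (X' n \<omega>) (m n + i) < z)"
proof -
  have "\<exists>W. unitary_n n W \<and> (real_case \<longrightarrow> real_entries_n n W) \<and>
    (\<forall>i<n. \<forall>j<n. mat_conj_n n W (P n) i j = (if i = j then of_real (eig n (P n) (Suc i)) else 0))" for n
    using hermitian_diagonalisation[where n = n and real_case = real_case, OF P_herm] by blast
  then obtain W where W: "\<And>n. unitary_n n (W n)" "\<And>n. real_case \<longrightarrow> real_entries_n n (W n)"
    and diag: "\<And>n i j. i < n \<Longrightarrow> j < n \<Longrightarrow>
      mat_conj_n n (W n) (P n) i j = (if i = j then of_real (eig n (P n) (Suc i)) else 0)"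
    by metis
  let ?h = "trunc_resolvent z \<delta>" and ?Y = "\<lambda>n \<omega>. mat_conj_n n (W n) (X n \<omega>)"
  have inv: "invariant_random_matrix M n (?Y n) ?h (1 / \<delta>)" for n
    by (rule invariant_random_matrix_mat_conj_n[where real_case = real_case])
      (use prob_space_axioms X_meas X_herm X_inv W continuous_on_trunc_resolvent trunc_resolvent_bound \<delta> in auto)
  have "AE \<omega> in M. (\<lambda>n. (\<Sum>i<n. ?h (eig n (?Y n \<omega>) (Suc i))) / real n) \<longlonglongrightarrow> \<gamma>"
    using esd AE_space
  proof eventually_elim
    case (elim \<omega>)
    have "(\<Sum>i<n. ?h (eig n (?Y n \<omega>) (Suc i))) = (\<Sum>i=1..n. ?h (eig n (X n \<omega>) i))" for n
      using sum.atLeast1_atMost_eq[of "\<lambda>i. ?h (eig n (X n \<omega>) i)" n]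
      by (simp add: eig_mat_conj_n[OF X_herm[OF elim(2)] W(1)])
    then show ?case using elim(1) by simp
  qed
  from func_calc_entries_AE_tendsto[OF inv this]
  have "AE \<omega> in M. \<forall>k l. (\<lambda>n. func_calc ?h n (?Y n \<omega>) k l) \<longlonglongrightarrow> (if k = l then of_real \<gamma> else 0)"
    by (simp only: AE_all_countable simp_thms)
  then show ?thesis using gap AE_space
  proof eventually_elim
    case (elim \<omega>)
    \<comment> \<open>If \<open>\<gamma> = 1 / \<theta> i\<close> both implications are vacuous and
      any \<open>e\<close> will do. Otherwise \<open>real r * e\<close> is half the distance between
      the two numbers.\<close>
    define e where "e = (if \<gamma> = 1 / \<theta> i then 1 else \<bar>\<gamma> - 1 / \<theta> i\<bar> / (2 * real r))"
    have e: "e > 0" "\<gamma> \<noteq> 1 / \<theta> i \<Longrightarrow> real r * e < \<bar>\<gamma> - 1 / \<theta> i\<bar>"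
      using i by (auto simp: e_def)
    have "\<forall>\<^sub>F n in sequentially. cmod (func_calc ?h n (?Y n \<omega>) k l - (if k = l then of_real \<gamma> else 0)) < e" for k l
      using tendstoD[OF elim(1)[rule_format, of k l] e(1)] by (simp add: dist_norm)
    then have "\<forall>\<^sub>F n in sequentially. \<forall>k\<in>{..<r}. \<forall>l\<in>{..<r}.
        cmod (func_calc ?h n (?Y n \<omega>) k l - (if k = l then of_real \<gamma> else 0)) < e"
      by (intro eventually_ball_finite ballI) auto
    then show ?case using elim(2) m
    proof eventually_elim
      case S: (elim n)
      have "cmod (func_calc ?h n (?Y n \<omega>) k l - (if k = l then of_real \<gamma> else 0)) \<le> e" if "k < r" "l < r" for k l
        using S(1) that by (meson lessThan_iff less_imp_le)
      note thr = eig_perturbed_threshold[OF elim(3) S(3) i \<delta> W(1) diag _ _ this]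
      show ?case using thr S(2) e by fastforce
    qed
  qed
qed

end

section \<open>The Cauchy transform on a gap of the support\<close>

text \<open>The upper end is an extended real so that the unbounded gap above the whole support is
  the case \<open>hi = \<infinity>\<close>.\<close>

locale spectral_gap = prob_space \<mu> for \<mu> :: "real measure" +
  fixes lo :: real and hi :: ereal
  assumes sets_borel [measurable_cong]: "sets \<mu> = sets borel" and lo_less_hi: "ereal lo < hi"
    and AE_outside: "AE t in \<mu>. t \<le> lo \<or> hi \<le> ereal t"
begin

definition gap :: "real set" where "gap = {z. lo < z \<and> ereal z < hi}"

abbreviation "G \<equiv> cauchy_transform \<mu>"

lemma gap_margin:
  assumes "z \<in> gap"
  obtains \<delta> where "\<delta> > 0" "lo < z - \<delta>" "ereal (z + \<delta>) < hi"
proof -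
  obtain v where v: "ereal z < ereal v" "ereal v < hi"
    using assms ereal_dense2[of "ereal z" hi] by (auto simp: gap_def)
  define \<delta> where "\<delta> = min (z - lo) (v - z) / 2"
  have "\<delta> > 0" "lo < z - \<delta>" "z + \<delta> < v" using assms v by (auto simp: \<delta>_def gap_def min_def field_simps)
  then show ?thesis using v(2) by (intro that[of \<delta>]) (auto intro: order_less_trans[of _ "ereal v"])
qed

lemma gap_between: "x \<in> gap \<Longrightarrow> y \<in> gap \<Longrightarrow> x \<le> z \<Longrightarrow> z \<le> y \<Longrightarrow> z \<in> gap"
  unfolding gap_def by (auto intro: le_less_trans[of "ereal z" "ereal y"])

lemma rational_in_gap:
  assumes "lo \<le> u" "u < v" "ereal u < hi"
  obtains z where "z \<in> gap" "z \<in> \<rat>" "u < z" "z < v"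
proof -
  obtain w where w: "ereal u < ereal w" "ereal w < min (ereal v) hi"
    using assms ereal_dense2[of "ereal u" "min (ereal v) hi"] by auto
  obtain z where "z \<in> \<rat>" "u < z" "z < w" using Rats_dense_in_real[of u w] w(1) by auto
  moreover have "z \<in> gap" using assms \<open>u < z\<close> \<open>z < w\<close> w(2) by (auto simp: gap_def intro: order_less_trans[of _ "ereal w"])
  ultimately show ?thesis using w(2) by (intro that[of z]) auto
qed

lemma AE_far:
  assumes "lo < z - \<delta>" "ereal (z + \<delta>) < hi"
  shows "AE t in \<mu>. \<delta> \<le> \<bar>z - t\<bar>"
  using AE_outside
proof eventually_elim
  case (elim t)
  then show ?case
  proof
    assume "hi \<le> ereal t"
    with assms(2) have "ereal (z + \<delta>) < ereal t" by (rule order_less_le_trans)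
    then show ?thesis by simp
  qed (use assms in auto)
qed

lemma integral_trunc_resolvent:
  assumes "\<delta> > 0" "lo < z - \<delta>" "ereal (z + \<delta>) < hi"
  shows "(\<integral>t. trunc_resolvent z \<delta> t \<partial>\<mu>) = G z" "integrable \<mu> (\<lambda>t. 1 / (z - t))"
proof -
  have meas: "trunc_resolvent z \<delta> \<in> borel_measurable \<mu>"
    unfolding measurable_cong_sets[OF sets_borel refl]
    by (intro borel_measurable_continuous_onI continuous_on_trunc_resolvent assms)
  have eq: "AE t in \<mu>. trunc_resolvent z \<delta> t = 1 / (z - t)"
    using AE_far[OF assms(2,3)] by eventually_elim (rule trunc_resolvent_eq[OF assms(1)])
  show "(\<integral>t. trunc_resolvent z \<delta> t \<partial>\<mu>) = G z"
    unfolding cauchy_transform_def by (rule integral_cong_AE) (use meas eq in auto)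
  have "integrable \<mu> (trunc_resolvent z \<delta>)"
    using trunc_resolvent_bound[OF assms(1)] meas by (intro integrable_const_bound[of _ "1 / \<delta>"]) auto
  then show "integrable \<mu> (\<lambda>t. 1 / (z - t))"
    by (subst (asm) integrable_cong_AE[OF meas _ eq]) auto
qed

lemma integrable_resolvent: "z \<in> gap \<Longrightarrow> integrable \<mu> (\<lambda>t. 1 / (z - t))"
  by (elim gap_margin) (rule integral_trunc_resolvent(2))

text \<open>Almost every \<open>t\<close> lies outside the gap, hence on the same side of
  \<open>z\<close> and \<open>w\<close>, and there \<open>1 / (x - t)\<close> decreases in
  \<open>x\<close>.\<close>

lemma G_strict_decreasing:
  assumes "z \<in> gap" "w \<in> gap" "z < w"
  shows "G w < G z"
  unfolding cauchy_transform_def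
proof (rule integral_less_AE_space)
  show "AE t in \<mu>. 1 / (w - t) < 1 / (z - t)"
    using AE_outside
  proof eventually_elim
    case (elim t)
    have "t < z \<or> w < t"
    proof (rule ccontr)
      assume "\<not> ?thesis"
      then have "t \<in> gap" using assms gap_between[of z w t] by auto
      with elim show False by (auto simp: gap_def)
    qed
    then have "(z - t) * (w - t) > 0" using assms(3) by (auto intro: mult_pos_pos mult_neg_neg)
    then have "1 / (z - t) - 1 / (w - t) > 0"
      using assms(3) \<open>t < z \<or> w < t\<close> by (subst diff_frac_eq) (auto intro: divide_pos_pos)
    then show ?case by simp
  qed
qed (use assms integrable_resolvent emeasure_space_1 in auto)

lemma inj_on_G: "inj_on G gap"
  by (rule inj_onI) (metis G_strict_decreasing less_irrefl linorder_neqE_linordered_idom)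

lemma isCont_G:
  assumes "z \<in> gap"
  shows "isCont G z"
proof -
  obtain \<delta> where \<delta>: "\<delta> > 0" "lo < z - \<delta>" "ereal (z + \<delta>) < hi" using gap_margin[OF assms] .
  \<comment> \<open>Almost every \<open>t\<close> is at distance at least \<open>\<delta>\<close>
    from \<open>z\<close>, hence at least \<open>\<delta> / 2\<close> from \<open>w\<close>; the
    product of the two distances gives the constant.\<close>
  have bound: "norm (G w - G z) \<le> 2 / \<delta>\<^sup>2 * \<bar>w - z\<bar>" if w: "\<bar>w - z\<bar> < \<delta> / 2" for w
  proof -
    have "lo < w" "w < z + \<delta>" using w \<delta>(1,2) unfolding abs_less_iff by linarith+
    then have wg: "w \<in> gap"
      using \<delta>(3) by (auto simp: gap_def intro: order_less_trans[of _ "ereal (z + \<delta>)"])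
    have "norm (G w - G z) = norm (\<integral>t. 1 / (w - t) - 1 / (z - t) \<partial>\<mu>)"
      unfolding cauchy_transform_def
      by (subst Bochner_Integration.integral_diff[OF integrable_resolvent integrable_resolvent]) (use wg assms in auto)
    also have "\<dots> \<le> (\<integral>t. norm (1 / (w - t) - 1 / (z - t)) \<partial>\<mu>)" by (rule integral_norm_bound)
    also have "\<dots> \<le> (\<integral>t. 2 / \<delta>\<^sup>2 * \<bar>w - z\<bar> \<partial>\<mu>)"
    proof (rule integral_mono_AE)
      show "AE t in \<mu>. norm (1 / (w - t) - 1 / (z - t)) \<le> 2 / \<delta>\<^sup>2 * \<bar>w - z\<bar>"
        using AE_far[OF \<delta>(2,3)]
      proof eventually_elim
        case (elim t)
        have wt: "\<delta> / 2 \<le> \<bar>w - t\<bar>" using elim w by linarith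
        then have ne: "w - t \<noteq> 0" "z - t \<noteq> 0" using elim \<delta>(1) by auto
        have "norm (1 / (w - t) - 1 / (z - t)) = \<bar>w - z\<bar> / (\<bar>w - t\<bar> * \<bar>z - t\<bar>)"
          by (subst diff_frac_eq[OF ne]) (simp add: abs_mult abs_minus_commute)
        also have "\<dots> \<le> \<bar>w - z\<bar> / (\<delta> / 2 * \<delta>)"
          using wt elim \<delta>(1) by (intro divide_left_mono mult_mono mult_pos_pos) auto
        finally show ?case by (simp add: power2_eq_square mult_ac)
      qed
    qed (use wg assms integrable_resolvent in auto)
    finally show ?thesis by (simp add: prob_space)
  qed
  have "((\<lambda>w. G w - G z) \<longlongrightarrow> 0) (at z)"
  proof (rule Lim_null_comparison)
    show "\<forall>\<^sub>F w in at z. norm (G w - G z) \<le> 2 / \<delta>\<^sup>2 * \<bar>w - z\<bar>"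
      unfolding eventually_at using bound \<delta>(1) by (intro exI[of _ "\<delta> / 2"]) (auto simp: dist_real_def)
    have "((\<lambda>w. 2 / \<delta>\<^sup>2 * \<bar>w - z\<bar>) \<longlongrightarrow> 2 / \<delta>\<^sup>2 * \<bar>z - z\<bar>) (at z)" by (intro tendsto_intros)
    then show "((\<lambda>w. 2 / \<delta>\<^sup>2 * \<bar>w - z\<bar>) \<longlongrightarrow> 0) (at z)" by simp
  qed
  then show ?thesis by (simp add: isCont_def LIM_zero_iff)
qed

text \<open>For a decreasing function the limit at the left end is the supremum, finite or not. In
  this form edge values are compared with \<open>1 / \<theta> i\<close> by exhibiting points of the
  gap.\<close>

lemma G_right_eq: "G_right \<mu> lo = (SUP z\<in>gap. ereal (G z))"
  unfolding G_right_def
proof (rule tendsto_Lim)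
  have ev: "\<forall>\<^sub>F z in at_right lo. z < w \<and> z \<in> gap" if "w \<in> gap" for w
    using that unfolding eventually_at_right_field gap_def
    by (intro exI[of _ w]) (auto intro: order_less_trans[of _ "ereal w"])
  obtain w0 where "w0 \<in> gap" using rational_in_gap[of lo "lo + 1"] lo_less_hi by auto
  show "((\<lambda>z. ereal (G z)) \<longlongrightarrow> (SUP z\<in>gap. ereal (G z))) (at_right lo)"
  proof (rule increasing_tendsto)
    show "\<forall>\<^sub>F z in at_right lo. ereal (G z) \<le> (SUP z\<in>gap. ereal (G z))"
      using ev[OF \<open>w0 \<in> gap\<close>] by eventually_elim (auto intro: SUP_upper)
    fix x assume "x < (SUP z\<in>gap. ereal (G z))"
    then obtain w where w: "w \<in> gap" "x < ereal (G w)" unfolding less_SUP_iff by blast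
    show "\<forall>\<^sub>F z in at_right lo. x < ereal (G z)"
      using ev[OF w(1)]
    proof eventually_elim
      case (elim z)
      then have "G w < G z" using w(1) G_strict_decreasing by blast
      then show ?case using w(2) by (metis less_ereal.simps(1) order_less_trans)
    qed
  qed
qed simp

lemma G_left_eq:
  assumes "hi = ereal h"
  shows "G_left \<mu> h = (INF z\<in>gap. ereal (G z))"
  unfolding G_left_def
proof (rule tendsto_Lim)
  have ev: "\<forall>\<^sub>F z in at_left h. w < z \<and> z \<in> gap" if "w \<in> gap" for w
    using that assms unfolding eventually_at_left_field gap_def by (intro exI[of _ w]) auto
  obtain w0 where "w0 \<in> gap" using rational_in_gap[of lo "lo + 1"] lo_less_hi by auto
  show "((\<lambda>z. ereal (G z)) \<longlongrightarrow> (INF z\<in>gap. ereal (G z))) (at_left h)"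
  proof (rule decreasing_tendsto)
    show "\<forall>\<^sub>F z in at_left h. (INF z\<in>gap. ereal (G z)) \<le> ereal (G z)"
      using ev[OF \<open>w0 \<in> gap\<close>] by eventually_elim (auto intro: INF_lower)
    fix x assume "(INF z\<in>gap. ereal (G z)) < x"
    then obtain w where w: "w \<in> gap" "ereal (G w) < x" unfolding INF_less_iff by blast
    show "\<forall>\<^sub>F z in at_left h. ereal (G z) < x"
      using ev[OF w(1)]
    proof eventually_elim
      case (elim z)
      then have "G z < G w" using w(1) G_strict_decreasing by blast
      then show ?case using w(2) by (metis less_ereal.simps(1) order_less_trans)
    qed
  qed
qed simp

text \<open>Justifies the convention \<open>G(a_0^-) = 0\<close>. Above the whole support
  \<open>G\<close> is nonnegative, and at distance \<open>1 / e\<close> from the edge it is at most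
  \<open>e\<close>.\<close>

lemma INF_G_unbounded:
  assumes "hi = \<infinity>"
  shows "(INF z\<in>gap. ereal (G z)) = 0"
proof (rule antisym)
  have tle: "AE t in \<mu>. t \<le> lo" using AE_outside assms by simp
  have gap: "z \<in> gap" if "lo < z" for z using that by (subst gap_def) (simp add: assms)
  show "(INF z\<in>gap. ereal (G z)) \<le> 0"
  proof (rule ereal_le_epsilon2)
    fix e :: real assume "e > 0"
    define z where "z = lo + 1 / e"
    have z: "lo < z" using \<open>e > 0\<close> by (simp add: z_def)
    have "G z \<le> (\<integral>t. e \<partial>\<mu>)" unfolding cauchy_transform_def
    proof (rule integral_mono_AE)
      show "AE t in \<mu>. 1 / (z - t) \<le> e"
        using tle
      proof eventually_elim
        case (elim t)
        then have "1 / e \<le> z - t" "0 < z - t" using z unfolding z_def by linarith+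
        then have "1 / (z - t) \<le> 1 / (1 / e)" using \<open>e > 0\<close> by (intro divide_left_mono mult_pos_pos) auto
        then show ?case by simp
      qed
    qed (use integrable_resolvent[OF gap[OF z]] in auto)
    then have "ereal (G z) \<le> 0 + ereal e" by (simp add: prob_space)
    then show "(INF z\<in>gap. ereal (G z)) \<le> 0 + ereal e"
      by (rule INF_lower2[OF gap[OF z]])
  qed
  show "0 \<le> (INF z\<in>gap. ereal (G z))"
  proof (rule INF_greatest)
    fix z assume "z \<in> gap"
    have "AE t in \<mu>. 0 \<le> 1 / (z - t)"
      using tle by eventually_elim (use \<open>z \<in> gap\<close> in \<open>auto simp: gap_def\<close>)
    then have "G z \<ge> 0" unfolding cauchy_transform_def by (rule integral_nonneg_AE)
    then show "0 \<le> ereal (G z)" by simp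
  qed
qed

lemma G_inverse:
  assumes "(INF z\<in>gap. ereal (G z)) < ereal g" "ereal g < (SUP z\<in>gap. ereal (G z))"
  shows "the_inv_into gap G g \<in> gap" "G (the_inv_into gap G g) = g"
proof -
  obtain w where w: "w \<in> gap" "G w < g" using assms(1) by (auto simp: INF_less_iff)
  obtain u where u: "u \<in> gap" "g < G u" using assms(2) by (auto simp: less_SUP_iff)
  have "u < w" using G_strict_decreasing[of w u] u w by (cases u w rule: linorder_cases) auto
  moreover have "continuous_on {u..w} G"
    using gap_between[OF u(1) w(1)] isCont_G by (intro continuous_at_imp_continuous_on) auto
  ultimately obtain z where z: "u \<le> z" "z \<le> w" "G z = g" using IVT2'[of G w g u] u w by auto
  then have "z \<in> gap" using gap_between[OF u(1) w(1)] by blast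
  moreover from this have "the_inv_into gap G g = z" using z(3) by (intro the_inv_into_f_eq[OF inj_on_G])
  ultimately show "the_inv_into gap G g \<in> gap" "G (the_inv_into gap G g) = g" using z(3) by simp_all
qed

text \<open>A squeeze free of probability. In the interior case rational thresholds on both sides of
  the root suffice; at an edge the gap offers them on one side only, and \<open>low\<close> or
  \<open>high\<close> covers the other.\<close>

lemma threshold_limit:
  fixes \<kappa> :: "nat \<Rightarrow> real"
  assumes thr: "\<And>z. z \<in> gap \<Longrightarrow> z \<in> \<rat> \<Longrightarrow>
      \<forall>\<^sub>F n in sequentially. (g < G z \<longrightarrow> z < \<kappa> n) \<and> (G z < g \<longrightarrow> \<kappa> n < z)"
    and low: "\<And>e. e > 0 \<Longrightarrow> \<forall>\<^sub>F n in sequentially. lo - e < \<kappa> n"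
    and high: "\<And>h e. hi = ereal h \<Longrightarrow> e > 0 \<Longrightarrow> \<forall>\<^sub>F n in sequentially. \<kappa> n < h + e"
  shows "(INF z\<in>gap. ereal (G z)) < ereal g \<Longrightarrow> ereal g < (SUP z\<in>gap. ereal (G z)) \<Longrightarrow>
      \<kappa> \<longlonglongrightarrow> the_inv_into gap G g"
    and "(SUP z\<in>gap. ereal (G z)) \<le> ereal g \<Longrightarrow> \<kappa> \<longlonglongrightarrow> lo"
    and "ereal g \<le> (INF z\<in>gap. ereal (G z)) \<Longrightarrow> hi = ereal h \<Longrightarrow> \<kappa> \<longlonglongrightarrow> h"
proof -
  have above: "\<forall>\<^sub>F n in sequentially. z < \<kappa> n" if "z \<in> gap" "z \<in> \<rat>" "g < G z" for z
    using thr[OF that(1,2)] that(3) by auto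
  have below: "\<forall>\<^sub>F n in sequentially. \<kappa> n < z" if "z \<in> gap" "z \<in> \<rat>" "G z < g" for z
    using thr[OF that(1,2)] that(3) by auto
  show "\<kappa> \<longlonglongrightarrow> the_inv_into gap G g" if g: "(INF z\<in>gap. ereal (G z)) < ereal g" "ereal g < (SUP z\<in>gap. ereal (G z))"
  proof -
    define z0 where "z0 = the_inv_into gap G g"
    have z0: "z0 \<in> gap" "G z0 = g" using G_inverse[OF g] by (auto simp: z0_def)
    show ?thesis unfolding z0_def[symmetric]
    proof (rule order_tendstoI)
      fix x assume "x < z0"
      then have "max x lo < z0" using z0 by (auto simp: gap_def)
      moreover from this have "ereal (max x lo) < hi"
        using z0 by (auto simp: gap_def intro: order_less_trans[of _ "ereal z0"])
      ultimately obtain z where z: "z \<in> gap" "z \<in> \<rat>" "max x lo < z" "z < z0"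
        using rational_in_gap[of "max x lo" z0] by auto
      then have "g < G z" using G_strict_decreasing[of z z0] z0 by simp
      from above[OF z(1,2) this] show "\<forall>\<^sub>F n in sequentially. x < \<kappa> n"
        by eventually_elim (use z in auto)
    next
      fix x assume "z0 < x"
      then obtain z where z: "z \<in> gap" "z \<in> \<rat>" "z0 < z" "z < x"
        using rational_in_gap[of z0 x] z0 by (auto simp: gap_def)
      then have "G z < g" using G_strict_decreasing[of z0 z] z0 by simp
      from below[OF z(1,2) this] show "\<forall>\<^sub>F n in sequentially. \<kappa> n < x"
        by eventually_elim (use z in auto)
    qed
  qed
  show "\<kappa> \<longlonglongrightarrow> lo" if g: "(SUP z\<in>gap. ereal (G z)) \<le> ereal g"
  proof (rule order_tendstoI)
    fix x assume "x < lo"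
    then show "\<forall>\<^sub>F n in sequentially. x < \<kappa> n" using low[of "lo - x"] by simp
  next
    fix x assume "lo < x"
    then obtain z where z: "z \<in> gap" "z \<in> \<rat>" "lo < z" "z < x"
      using rational_in_gap[of lo x] lo_less_hi by auto
    \<comment> \<open>The intermediate point \<open>w\<close> turns the weak bound by the supremum
      into the strict \<open>G z < g\<close>.\<close>
    then obtain w where w: "w \<in> gap" "w < z"
      using rational_in_gap[of lo z] lo_less_hi by auto
    then have "G z < G w" using z G_strict_decreasing by blast
    moreover have "ereal (G w) \<le> ereal g" using SUP_upper[OF w(1), of "\<lambda>z. ereal (G z)"] g by (rule order_trans)
    ultimately have "G z < g" by simp
    from below[OF z(1,2) this] show "\<forall>\<^sub>F n in sequentially. \<kappa> n < x"
      by eventually_elim (use z in auto)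
  qed
  show "\<kappa> \<longlonglongrightarrow> h" if g: "ereal g \<le> (INF z\<in>gap. ereal (G z))" and h: "hi = ereal h"
  proof (rule order_tendstoI)
    fix x assume "h < x"
    then show "\<forall>\<^sub>F n in sequentially. \<kappa> n < x" using high[OF h, of "x - h"] by simp
  next
    fix x assume "x < h"
    then obtain z where z: "z \<in> gap" "z \<in> \<rat>" "x < z"
      using rational_in_gap[of "max x lo" h] lo_less_hi h by auto
    then obtain w where w: "w \<in> gap" "z < w"
      using rational_in_gap[of z "z + 1"] by (auto simp: gap_def)
    then have "G w < G z" using z G_strict_decreasing by blast
    moreover have "ereal g \<le> ereal (G w)" using g INF_lower[OF w(1), of "\<lambda>z. ereal (G z)"] by (rule order_trans)
    ultimately have "g < G z" by simp
    from above[OF z(1,2) this] show "\<forall>\<^sub>F n in sequentially. x < \<kappa> n"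
      by eventually_elim (use z in auto)
  qed
qed

end

section \<open>Almost sure limits of perturbed eigenvalues\<close>

text \<open>If only \<open>q\<close> terms were nonzero, the average would be at most
  \<open>q * B / n\<close>, against its positive limit. \<open>J\<close> is quantified after
  \<open>n\<close> so that the excluded indices may move with \<open>n\<close>.\<close>

lemma eventually_not_few_nonzero:
  fixes x :: "nat \<Rightarrow> nat \<Rightarrow> real" and f :: "real \<Rightarrow> real"
  assumes lim: "(\<lambda>n. (\<Sum>i=1..n. f (x n i)) / real n) \<longlonglongrightarrow> I" and "I > 0"
    and f: "\<And>t. f t \<le> B" "0 \<le> B"
  shows "\<forall>\<^sub>F n in sequentially. \<forall>J. card J \<le> q \<longrightarrow> finite J \<longrightarrow> (\<exists>i\<in>{1..n} - J. f (x n i) \<noteq> 0)"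
proof -
  have "(\<lambda>n. real q * B / real n) \<longlonglongrightarrow> 0" by (rule lim_const_over_n)
  then have "\<forall>\<^sub>F n in sequentially. real q * B / real n < I / 2"
    using \<open>I > 0\<close> by (intro order_tendstoD) auto
  moreover have "\<forall>\<^sub>F n in sequentially. I / 2 < (\<Sum>i=1..n. f (x n i)) / real n"
    using \<open>I > 0\<close> by (intro order_tendstoD(1)[OF lim]) auto
  ultimately show ?thesis
  proof eventually_elim
    case (elim n)
    show ?case
    proof (intro allI impI, rule ccontr)
      fix J :: "nat set" assume J: "card J \<le> q" "finite J" and "\<not> (\<exists>i\<in>{1..n} - J. f (x n i) \<noteq> 0)"
      then have "(\<Sum>i=1..n. f (x n i)) = (\<Sum>i\<in>{1..n} \<inter> J. f (x n i))"
        by (intro sum.mono_neutral_right) auto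
      also have "\<dots> \<le> real (card ({1..n} \<inter> J)) * B"
        using f by (intro sum_bounded_above) auto
      also have "\<dots> \<le> real q * B"
        using J f(2) card_mono[of J "{1..n} \<inter> J"] by (intro mult_right_mono) auto
      finally have "(\<Sum>i=1..n. f (x n i)) / real n \<le> real q * B / real n"
        by (rule divide_right_mono) simp
      then show False using elim by linarith
    qed
  qed
qed

text \<open>A continuous bounded bump, positive exactly on \<open>(u, v)\<close>: a test function by
  which weak convergence detects eigenvalues next to an edge.\<close>

definition tent :: "real \<Rightarrow> real \<Rightarrow> real \<Rightarrow> real" where
  "tent u v t = max 0 (min (t - u) (v - t))"

lemma tent_bounds: "0 \<le> tent u v t" "u < v \<Longrightarrow> tent u v t \<le> v - u"
  by (auto simp: tent_def)

lemma tent_eq_0: "t \<le> u \<or> v \<le> t \<Longrightarrow> tent u v t = 0"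
  by (auto simp: tent_def)

lemma continuous_on_tent: "continuous_on UNIV (tent u v)"
  unfolding tent_def by (intro continuous_intros)

lemma integral_tent_pos:
  assumes "prob_space \<mu>" "sets \<mu> = sets borel" "u < v" "measure \<mu> {u<..<v} > 0"
  shows "(\<integral>t. tent u v t \<partial>\<mu>) > 0"
proof -
  interpret prob_space \<mu> by fact
  have meas: "tent u v \<in> borel_measurable \<mu>"
    unfolding measurable_cong_sets[OF assms(2) refl]
    by (intro borel_measurable_continuous_onI continuous_on_tent)
  have int: "integrable \<mu> (tent u v)"
    using tent_bounds assms(3) meas by (intro integrable_const_bound[of _ "v - u"]) auto
  have "(\<integral>t. tent u v t \<partial>\<mu>) \<noteq> 0"
  proof
    assume "(\<integral>t. tent u v t \<partial>\<mu>) = 0"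
    then have "AE t in \<mu>. tent u v t = 0"
      using integral_nonneg_eq_0_iff_AE[OF int] tent_bounds by auto
    then have "AE t in \<mu>. t \<notin> {u<..<v}" by eventually_elim (auto simp: tent_def)
    then show False using prob_eq_0[of "{u<..<v}"] assms by simp
  qed
  moreover have "(\<integral>t. tent u v t \<partial>\<mu>) \<ge> 0" using tent_bounds by (intro integral_nonneg_AE) auto
  ultimately show ?thesis by linarith
qed

text \<open>Since \<open>\<mu>\<close> charges every neighbourhood of a finite edge, only boundedly many eigenvalues of
  \<open>X n\<close> adjacent to the gap can stay away from its edges, so that the eigenvalues with index \<open>m n + i\<close> and
  \<open>m n + i - r\<close> also tend to \<open>lo\<close> and \<open>hi\<close>; the Weyl inequalities compare with these.\<close>

lemma (in spiked_model) AE_eig_perturbed_limit: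
  fixes \<mu> :: "real measure" and lo :: real and hi :: ereal and m :: "nat \<Rightarrow> nat"
  assumes sg: "spectral_gap \<mu> lo hi"
    and esd: "AE \<omega> in M. \<forall>f :: real \<Rightarrow> real. continuous_on UNIV f \<and> bounded (range f) \<longrightarrow>
                (\<lambda>n. (\<Sum>i=1..n. f (eig n (X n \<omega>) i)) / real n) \<longlonglongrightarrow> (\<integral>t. f t \<partial>\<mu>)"
    and mass_lo: "\<And>e. e > 0 \<Longrightarrow> measure \<mu> {lo - e<..<lo} > 0"
    and mass_hi: "\<And>h e. hi = ereal h \<Longrightarrow> e > 0 \<Longrightarrow> measure \<mu> {h<..<h + e} > 0"
    and m: "\<forall>\<^sub>F n in sequentially. m n + r \<le> n" "hi = \<infinity> \<Longrightarrow> \<forall>n. m n = 0"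
      "hi \<noteq> \<infinity> \<Longrightarrow> \<forall>\<^sub>F n in sequentially. r \<le> m n"
    and top: "AE \<omega> in M. (\<lambda>n. eig n (X n \<omega>) (m n + 1)) \<longlonglongrightarrow> lo"
    and bot: "AE \<omega> in M. \<forall>h. hi = ereal h \<longrightarrow> (\<lambda>n. eig n (X n \<omega>) (m n)) \<longlonglongrightarrow> h"
    and i: "1 \<le> i" "i \<le> r"
  defines "gap \<equiv> {z. lo < z \<and> ereal z < hi}" and "G \<equiv> cauchy_transform \<mu>"
  shows "(INF z\<in>gap. ereal (G z)) < ereal (1 / \<theta> i) \<Longrightarrow> ereal (1 / \<theta> i) < (SUP z\<in>gap. ereal (G z)) \<Longrightarrow>
      AE \<omega> in M. (\<lambda>n. eig n (X' n \<omega>) (m n + i)) \<longlonglongrightarrow> the_inv_into gap G (1 / \<theta> i)"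
    and "(SUP z\<in>gap. ereal (G z)) \<le> ereal (1 / \<theta> i) \<Longrightarrow>
      AE \<omega> in M. (\<lambda>n. eig n (X' n \<omega>) (m n + i)) \<longlonglongrightarrow> lo"
    and "ereal (1 / \<theta> i) \<le> (INF z\<in>gap. ereal (G z)) \<Longrightarrow> hi = ereal h \<Longrightarrow>
      AE \<omega> in M. (\<lambda>n. eig n (X' n \<omega>) (m n + i)) \<longlonglongrightarrow> h"
proof -
  interpret \<mu>: spectral_gap \<mu> lo hi by fact
  have gap: "\<mu>.gap = gap" by (simp add: \<mu>.gap_def gap_def)
  \<comment> \<open>For infinite \<open>hi\<close> the claim is vacuous, since
    \<open>m n = 0\<close>; the value \<open>-\<infinity>\<close> is excluded by
    \<open>lo_less_hi\<close>.\<close>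
  have far_above: "\<forall>\<^sub>F n in sequentially. 0 < m n \<longrightarrow> z < eig n (X n \<omega>) (m n)"
    if "\<forall>h. hi = ereal h \<longrightarrow> (\<lambda>n. eig n (X n \<omega>) (m n)) \<longlonglongrightarrow> h" "ereal z < hi" for z \<omega>
  proof (cases hi)
    case (real h)
    then show ?thesis using that order_tendstoD(1)[of "\<lambda>n. eig n (X n \<omega>) (m n)" h sequentially z]
      by (auto elim: eventually_mono)
  qed (use m(2) \<mu>.lo_less_hi in auto)
  have "AE \<omega> in M. \<forall>\<^sub>F n in sequentially. (1 / \<theta> i < G z \<longrightarrow> z < eig n (X' n \<omega>) (m n + i)) \<and>
      (G z < 1 / \<theta> i \<longrightarrow> eig n (X' n \<omega>) (m n + i) < z)" if "z \<in> gap" for z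
  proof -
    obtain \<delta> where \<delta>: "\<delta> > 0" "lo < z - \<delta>" "ereal (z + \<delta>) < hi"
      using \<mu>.gap_margin \<open>z \<in> gap\<close> unfolding gap by blast
    show ?thesis
    proof (rule AE_eig_perturbed_threshold[OF i \<delta>(1) m(1)])
      show "AE \<omega> in M. (\<lambda>n. (\<Sum>i=1..n. trunc_resolvent z \<delta> (eig n (X n \<omega>) i)) / real n) \<longlonglongrightarrow> G z"
        using esd
      proof eventually_elim
        case (elim \<omega>)
        have "bounded (range (trunc_resolvent z \<delta>))"
          using trunc_resolvent_bound[OF \<delta>(1)] by (auto intro!: boundedI)
        then show ?case
          using elim[rule_format, of "trunc_resolvent z \<delta>"] continuous_on_trunc_resolvent[OF \<delta>(1)]
          by (simp add: \<mu>.integral_trunc_resolvent(1)[OF \<delta>] G_def)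
      qed
      show "AE \<omega> in M. \<forall>\<^sub>F n in sequentially. (0 < m n \<longrightarrow> z + \<delta> \<le> eig n (X n \<omega>) (m n)) \<and>
        eig n (X n \<omega>) (m n + 1) \<le> z - \<delta>"
        using top bot
      proof eventually_elim
        case (elim \<omega>)
        show ?case
          using far_above[OF elim(2) \<delta>(3)] order_tendstoD(2)[OF elim(1) \<delta>(2)]
          by eventually_elim auto
      qed
    qed
  qed
  then have "AE \<omega> in M. \<forall>z\<in>gap \<inter> \<rat>. \<forall>\<^sub>F n in sequentially. (1 / \<theta> i < G z \<longrightarrow> z < eig n (X' n \<omega>) (m n + i)) \<and>
      (G z < 1 / \<theta> i \<longrightarrow> eig n (X' n \<omega>) (m n + i) < z)"
    using countable_rat by (subst AE_ball_countable) auto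
  moreover have "AE \<omega> in M. \<forall>e>0. \<forall>\<^sub>F n in sequentially. lo - e < eig n (X' n \<omega>) (m n + i)"
    using esd bot AE_space
  proof eventually_elim
    case (elim \<omega>)
    note \<omega> = elim(3)
    show ?case
    proof (intro allI impI)
      fix e :: real assume e: "e > 0"
      have "bounded (range (tent (lo - e) lo))"
        using tent_bounds[of "lo - e" lo] e by (intro boundedI[of _ e]) auto
      then have "(\<lambda>n. (\<Sum>i=1..n. tent (lo - e) lo (eig n (X n \<omega>) i)) / real n) \<longlonglongrightarrow> (\<integral>t. tent (lo - e) lo t \<partial>\<mu>)"
        using elim(1) continuous_on_tent by blast
      moreover have "(\<integral>t. tent (lo - e) lo t \<partial>\<mu>) > 0"
        using e by (intro integral_tent_pos mass_lo \<mu>.prob_space_axioms \<mu>.sets_borel) auto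
      ultimately have "\<forall>\<^sub>F n in sequentially. \<forall>J. card J \<le> i \<longrightarrow> finite J \<longrightarrow>
          (\<exists>k\<in>{1..n} - J. tent (lo - e) lo (eig n (X n \<omega>) k) \<noteq> 0)"
        using e tent_bounds[of "lo - e" lo] by (intro eventually_not_few_nonzero[where B = e]) auto
      then show "\<forall>\<^sub>F n in sequentially. lo - e < eig n (X' n \<omega>) (m n + i)"
        using far_above[OF elim(2) \<mu>.lo_less_hi] m(1)
      proof eventually_elim
        case n: (elim n)
        \<comment> \<open>Some eigenvalue with index outside this set lies in
          \<open>(lo - e, lo)\<close>. Indices up to \<open>m n\<close> belong to eigenvalues above
          \<open>lo\<close>, so its index is at least \<open>m n + i\<close>.\<close>
        have "card {m n<..<m n + i} \<le> i" "finite {m n<..<m n + i}" by auto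
        with n(1) obtain k where k: "k \<in> {1..n} - {m n<..<m n + i}" "tent (lo - e) lo (eig n (X n \<omega>) k) \<noteq> 0"
          by blast
        have nz: "lo - e < eig n (X n \<omega>) k" "eig n (X n \<omega>) k < lo"
          using tent_eq_0[of "eig n (X n \<omega>) k" "lo - e" lo] k(2) by linarith+
        have "\<not> k \<le> m n" using nz(2) n(2,3) k(1) eig_antimono_X[OF \<omega>, of k "m n" n] by auto
        then have "eig n (X n \<omega>) k \<le> eig n (X n \<omega>) (m n + i)"
          using k(1) i by (intro eig_antimono_X[OF \<omega>]) auto
        also have "\<dots> \<le> eig n (X' n \<omega>) (m n + i)"
          using n(3) i by (intro eig_perturbed_bounds(1)[OF \<omega>]) auto
        finally show ?case using nz(1) by linarith
      qed
    qed
  qed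
  moreover have "AE \<omega> in M. \<forall>h e. hi = ereal h \<longrightarrow> e > 0 \<longrightarrow> (\<forall>\<^sub>F n in sequentially. eig n (X' n \<omega>) (m n + i) < h + e)"
    using esd top AE_space
  proof eventually_elim
    case (elim \<omega>)
    note \<omega> = elim(3)
    show ?case
    proof (intro allI impI)
      fix h e :: real assume h: "hi = ereal h" and e: "e > 0"
      have "bounded (range (tent h (h + e)))"
        using tent_bounds[of h "h + e"] e by (intro boundedI[of _ e]) auto
      then have "(\<lambda>n. (\<Sum>i=1..n. tent h (h + e) (eig n (X n \<omega>) i)) / real n) \<longlonglongrightarrow> (\<integral>t. tent h (h + e) t \<partial>\<mu>)"
        using elim(1) continuous_on_tent by blast
      moreover have "(\<integral>t. tent h (h + e) t \<partial>\<mu>) > 0"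
        using e h by (intro integral_tent_pos mass_hi \<mu>.prob_space_axioms \<mu>.sets_borel) auto
      ultimately have "\<forall>\<^sub>F n in sequentially. \<forall>J. card J \<le> r \<longrightarrow> finite J \<longrightarrow>
          (\<exists>k\<in>{1..n} - J. tent h (h + e) (eig n (X n \<omega>) k) \<noteq> 0)"
        using e tent_bounds[of h "h + e"] by (intro eventually_not_few_nonzero[where B = e]) auto
      moreover have "\<forall>\<^sub>F n in sequentially. eig n (X n \<omega>) (m n + 1) < h"
        using elim(2) \<mu>.lo_less_hi h by (intro order_tendstoD(2)) auto
      moreover have "\<forall>\<^sub>F n in sequentially. r \<le> m n" using m(3) h by simp
      ultimately show "\<forall>\<^sub>F n in sequentially. eig n (X' n \<omega>) (m n + i) < h + e"
        using m(1)
      proof eventually_elim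
        case n: (elim n)
        \<comment> \<open>The excluded \<open>r - i\<close> indices are those next to the gap on its
          upper side. An eigenvalue in \<open>(h, h + e)\<close> then has index at most
          \<open>m n + i - r\<close>, and the Weyl shift by \<open>r\<close> lands on
          \<open>m n + i\<close>; \<open>r \<le> m n\<close> keeps the subtraction exact.\<close>
        have "card {m n + i - r<..m n} \<le> r" "finite {m n + i - r<..m n}" by auto
        with n(1) obtain k where k: "k \<in> {1..n} - {m n + i - r<..m n}" "tent h (h + e) (eig n (X n \<omega>) k) \<noteq> 0"
          by blast
        have nz: "h < eig n (X n \<omega>) k" "eig n (X n \<omega>) k < h + e"
          using tent_eq_0[of "eig n (X n \<omega>) k" h "h + e"] k(2) by linarith+
        have "\<not> m n < k" using nz(1) n(2) k(1) eig_antimono_X[OF \<omega>, of "m n + 1" k n] by auto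
        then have k': "k \<le> m n + i - r" using k(1) by auto
        have "eig n (X' n \<omega>) (m n + i - r + r) \<le> eig n (X n \<omega>) (m n + i - r)"
          using n(3,4) i by (intro eig_perturbed_bounds(2)[OF \<omega>]) auto
        also have "\<dots> \<le> eig n (X n \<omega>) k"
          using k k' n(4) i by (intro eig_antimono_X[OF \<omega>]) auto
        finally show ?case using nz(2) n(3) by simp
      qed
    qed
  qed
  ultimately have AE: "AE \<omega> in M.
     (\<forall>z\<in>gap \<inter> \<rat>. \<forall>\<^sub>F n in sequentially. (1 / \<theta> i < G z \<longrightarrow> z < eig n (X' n \<omega>) (m n + i)) \<and>
      (G z < 1 / \<theta> i \<longrightarrow> eig n (X' n \<omega>) (m n + i) < z)) \<and>
     (\<forall>e>0. \<forall>\<^sub>F n in sequentially. lo - e < eig n (X' n \<omega>) (m n + i)) \<and>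
     (\<forall>h e. hi = ereal h \<longrightarrow> e > 0 \<longrightarrow> (\<forall>\<^sub>F n in sequentially. eig n (X' n \<omega>) (m n + i) < h + e))"
    by eventually_elim blast
  note lim = \<mu>.threshold_limit[unfolded gap, folded G_def]
  show "AE \<omega> in M. (\<lambda>n. eig n (X' n \<omega>) (m n + i)) \<longlonglongrightarrow> the_inv_into gap G (1 / \<theta> i)"
    if "(INF z\<in>gap. ereal (G z)) < ereal (1 / \<theta> i)" "ereal (1 / \<theta> i) < (SUP z\<in>gap. ereal (G z))"
    using AE by eventually_elim (rule lim(1)[OF _ _ _ that]; blast)
  show "AE \<omega> in M. (\<lambda>n. eig n (X' n \<omega>) (m n + i)) \<longlonglongrightarrow> lo"
    if "(SUP z\<in>gap. ereal (G z)) \<le> ereal (1 / \<theta> i)"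
    using AE by eventually_elim (rule lim(2)[OF _ _ _ that]; blast)
  show "AE \<omega> in M. (\<lambda>n. eig n (X' n \<omega>) (m n + i)) \<longlonglongrightarrow> h"
    if "ereal (1 / \<theta> i) \<le> (INF z\<in>gap. ereal (G z))" "hi = ereal h"
    using AE by eventually_elim (rule lim(3)[OF _ _ _ that]; blast)
qed

lemma eventually_nat_ceiling_add_le:
  fixes c :: real
  assumes "c < 1"
  shows "\<forall>\<^sub>F n in sequentially. nat \<lceil>real n * c\<rceil> + r \<le> n"
proof -
  \<comment> \<open>The extra 1 absorbs the rounding of the ceiling.\<close>
  obtain N :: nat where N: "(real r + 1) / (1 - c) \<le> real N" using real_arch_simple by blast
  show ?thesis
  proof (rule eventually_sequentiallyI[of "max N r"])
    fix n assume n: "max N r \<le> n"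
    then have "(real r + 1) / (1 - c) \<le> real n" using N by linarith
    then have "real r + 1 \<le> real n * (1 - c)" using assms by (simp add: pos_divide_le_eq)
    then have "real n * c + 1 \<le> real n - real r" by (simp add: algebra_simps)
    then have "real_of_int \<lceil>real n * c\<rceil> \<le> real_of_int (int n - int r)"
      unfolding of_int_diff of_int_of_nat_eq using of_int_ceiling_le_add_one[of "real n * c"] by linarith
    then have "\<lceil>real n * c\<rceil> \<le> int n - int r" by (simp only: of_int_le_iff)
    then show "nat \<lceil>real n * c\<rceil> + r \<le> n" using n by linarith
  qed
qed

lemma eventually_le_nat_ceiling:
  fixes c :: real
  assumes "c > 0"
  shows "\<forall>\<^sub>F n in sequentially. r \<le> nat \<lceil>real n * c\<rceil>"
proof -
  obtain N :: nat where N: "real r / c \<le> real N" using real_arch_simple by blast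
  show ?thesis
  proof (rule eventually_sequentiallyI[of N])
    fix n assume "N \<le> n"
    then have "real r / c \<le> real n" using N by linarith
    then have "real r \<le> real n * c" using assms by (simp add: pos_divide_le_eq)
    then show "r \<le> nat \<lceil>real n * c\<rceil>" by linarith
  qed
qed

theorem mainTheorem3:
  fixes M :: "'w measure"
    and X :: "nat \<Rightarrow> 'w \<Rightarrow> (nat \<Rightarrow> nat \<Rightarrow> complex)"
    and P :: "nat \<Rightarrow> (nat \<Rightarrow> nat \<Rightarrow> complex)"
    and real_case :: bool
    and \<mu>X :: "real measure" and \<mu> :: "nat \<Rightarrow> real measure"
    and L r :: nat and p c a b \<theta> :: "nat \<Rightarrow> real"
  assumes M: "prob_space M"
    and X_herm: "\<forall>n. \<forall>\<omega>\<in>space M. hermitian_n n (X n \<omega>) \<and> supported_n n (X n \<omega>)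
                   \<and> (real_case \<longrightarrow> real_entries_n n (X n \<omega>))"
    and X_meas: "\<forall>n. X n \<in> measurable M mat_space"
    and X_inv: "\<forall>n U. unitary_n n U \<and> (real_case \<longrightarrow> real_entries_n n U) \<longrightarrow>
                  distr M mat_space (\<lambda>\<omega>. mat_conj_n n U (X n \<omega>)) = distr M mat_space (X n)"
    and l_pos: "L \<ge> 1"
    and p_pos: "\<forall>j\<in>{1..L}. p j > 0"
    and p_sum: "(\<Sum>j=1..L. p j) = 1"
    and mu_prob: "\<forall>j\<in>{1..L}. prob_space (\<mu> j) \<and> sets (\<mu> j) = sets borel"
    and mu_supp: "\<forall>j\<in>{1..L}. measure (\<mu> j) {a j..b j} = 1"
    and mu_pos: "\<forall>j\<in>{1..L}. \<forall>u v. a j \<le> u \<and> u < v \<and> v \<le> b j \<longrightarrow> measure (\<mu> j) {u<..<v} > 0"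
    and ab_ord: "\<forall>j\<in>{1..L}. a j < b j"
    and ab_gap: "\<forall>j. 1 \<le> j \<and> j < L \<longrightarrow> b (j + 1) < a j"
    and muX_prob: "prob_space \<mu>X" and muX_sets: "sets \<mu>X = sets borel"
    and muX_mix: "\<forall>A\<in>sets borel. measure \<mu>X A = (\<Sum>j=1..L. p j * measure (\<mu> j) A)"
    and c_def: "\<forall>k. c k = (\<Sum>i=1..k. p i)"
    and esd: "AE \<omega> in M. \<forall>f :: real \<Rightarrow> real. continuous_on UNIV f \<and> bounded (range f) \<longrightarrow>
                (\<lambda>n. (\<Sum>i=1..n. f (eig n (X n \<omega>) i)) / real n) \<longlonglongrightarrow> (\<integral>t. f t \<partial>\<mu>X)"
    and edge_top: "\<forall>j\<in>{1..L}. AE \<omega> in M.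
                (\<lambda>n. eig n (X n \<omega>) (nat \<lceil>real n * c (j - 1)\<rceil> + 1)) \<longlonglongrightarrow> b j"
    and edge_bot: "\<forall>j\<in>{1..L}. AE \<omega> in M.
                (\<lambda>n. eig n (X n \<omega>) (nat \<lceil>real n * c j\<rceil>)) \<longlonglongrightarrow> a j"
    and r_pos: "r \<ge> 1"
    and theta_ord: "\<forall>i j. 1 \<le> i \<and> i \<le> j \<and> j \<le> r \<longrightarrow> \<theta> j \<le> \<theta> i"
    and theta_pos: "\<theta> r > 0"
    and P_herm: "\<forall>n. hermitian_n n (P n) \<and> supported_n n (P n) \<and> (real_case \<longrightarrow> real_entries_n n (P n))"
    and P_spec: "\<forall>n\<ge>r. eigs_desc n (P n) = map \<theta> [1..<r+1] @ replicate (n - r) 0"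
  shows "\<forall>i\<in>{1..r}. \<forall>j\<in>{1..L}.
     (G_left_edge \<mu>X a j < ereal (1 / \<theta> i) \<and> ereal (1 / \<theta> i) < G_right \<mu>X (b j) \<longrightarrow>
        (AE \<omega> in M. (\<lambda>n. eig n (mat_add (X n \<omega>) (P n)) (nat \<lceil>real n * c (j - 1)\<rceil> + i))
            \<longlonglongrightarrow> the_inv_into (gap_interval a b j) (cauchy_transform \<mu>X) (1 / \<theta> i)))
   \<and> (ereal (1 / \<theta> i) \<ge> G_right \<mu>X (b j) \<longrightarrow>
        (AE \<omega> in M. (\<lambda>n. eig n (mat_add (X n \<omega>) (P n)) (nat \<lceil>real n * c (j - 1)\<rceil> + i))
            \<longlonglongrightarrow> b j))
   \<and> (ereal (1 / \<theta> i) \<le> G_left_edge \<mu>X a j \<longrightarrow>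
        (AE \<omega> in M. (\<lambda>n. eig n (mat_add (X n \<omega>) (P n)) (nat \<lceil>real n * c (j - 1)\<rceil> + i))
            \<longlonglongrightarrow> a (j - 1)))"
proof (intro ballI)
  fix i j assume i: "i \<in> {1..r}" and j: "j \<in> {1..L}"
  interpret \<mu>X: prob_space \<mu>X by (rule muX_prob)
  interpret spiked_model M X P real_case r \<theta>
    using M X_herm X_meas X_inv P_herm P_spec theta_ord theta_pos
    by (intro spiked_model.intro spiked_model_axioms.intro) auto
  define hi where "hi = (if j = 1 then \<infinity> else ereal (a (j - 1)))"
  have gap: "gap_interval a b j = {z. b j < z \<and> ereal z < hi}"
    by (auto simp: gap_interval_def hi_def)
  \<comment> \<open>The bands are numbered from right to left.\<close>
  have below: "b l < a k" if "k < l" "1 \<le> k" "l \<le> L" for k l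
    using that
  proof (induction l)
    case (Suc l)
    show ?case
    proof (cases "k = l")
      case False
      then have "b l < a k" "a l < b l" "b (Suc l) < a l" using Suc ab_ord ab_gap by auto
      then show ?thesis by linarith
    qed (use Suc ab_gap in auto)
  qed simp
  have c_pred: "c (j - 1) < 1" "j \<noteq> 1 \<Longrightarrow> 0 < c (j - 1)"
  proof -
    have pos: "p k > 0" if "k \<in> {1..j}" for k using that j p_pos by auto
    \<comment> \<open>Strictness comes from the positive weight \<open>p j\<close>, which
      \<open>c (j - 1)\<close> leaves out.\<close>
    have "(\<Sum>k=1..j. p k) = p j + c (j - 1)" using j by (cases j) (simp_all add: c_def)
    moreover have "(\<Sum>k=1..j. p k) \<le> (\<Sum>k=1..L. p k)"
      using j p_pos by (intro sum_mono2) (auto intro: less_imp_le)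
    ultimately show "c (j - 1) < 1" using pos[of j] j p_sum by simp
    show "0 < c (j - 1)" if "j \<noteq> 1" unfolding c_def[rule_format]
      by (rule sum_pos) (use pos that j in auto)
  qed
  have sg: "spectral_gap \<mu>X (b j) hi"
  proof
    show "ereal (b j) < hi" using below[of "j - 1" j] j by (auto simp: hi_def)
    have borel: "gap_interval a b j \<in> sets borel" by (simp add: gap_interval_def)
    \<comment> \<open>Component \<open>k\<close> has full mass on its band, which misses the gap:
      bands with \<open>k \<ge> j\<close> lie to the left of it and the others to the right.\<close>
    have "measure (\<mu> k) (gap_interval a b j) = 0" if k: "k \<in> {1..L}" for k
    proof -
      interpret \<mu>k: prob_space "\<mu> k" using mu_prob k by blast
      have sets: "sets (\<mu> k) = sets borel" using mu_prob k by blast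
      have "{a k..b k} \<inter> gap_interval a b j = {}"
      proof (cases "j \<le> k")
        case True
        then have "b k \<le> b j" using below[of j k] ab_ord j k by (cases "j = k") force+
        then show ?thesis by (auto simp: gap)
      next
        case False
        have "a (j - 1) \<le> a k"
        proof (cases "k = j - 1")
          case k': False
          then have "j - 1 \<in> {1..L}" "k < j - 1" using False j k by auto
          then have "a (j - 1) < b (j - 1)" "b (j - 1) < a k" using ab_ord below k by auto
          then show ?thesis by linarith
        qed simp
        then show ?thesis using False k by (auto simp: gap_interval_def)
      qed
      then have "measure (\<mu> k) ({a k..b k} \<union> gap_interval a b j) = measure (\<mu> k) {a k..b k} + measure (\<mu> k) (gap_interval a b j)"
        using borel by (intro \<mu>k.finite_measure_Union) (auto simp: sets)
      moreover have "measure (\<mu> k) {a k..b k} = 1" using mu_supp k by blast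
      ultimately show ?thesis
        using \<mu>k.prob_le_1[of "{a k..b k} \<union> gap_interval a b j"] measure_nonneg[of "\<mu> k" "gap_interval a b j"] by linarith
    qed
    then have "measure \<mu>X (gap_interval a b j) = 0" using muX_mix borel by simp
    then have "AE t in \<mu>X. t \<notin> gap_interval a b j"
      using borel muX_sets by (simp add: \<mu>X.prob_eq_0)
    then show "AE t in \<mu>X. t \<le> b j \<or> hi \<le> ereal t"
      by eventually_elim (auto simp: gap not_less)
  qed (use muX_sets in simp)
  interpret sg: spectral_gap \<mu>X "b j" hi by (rule sg)
  have sg_gap: "sg.gap = gap_interval a b j" by (simp add: sg.gap_def gap)
  \<comment> \<open>An open interval overlapping band \<open>k\<close> has positive mass, by
    \<open>mu_pos\<close> on the overlap and \<open>p k > 0\<close>. It is applied just outside the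
    two ends of the gap.\<close>
  have mass: "measure \<mu>X {u<..<v} > 0" if k: "k \<in> {1..L}" and uv: "u < v" "max u (a k) < min v (b k)" for k u v
  proof -
    interpret \<mu>k: prob_space "\<mu> k" using mu_prob k by blast
    have "0 < measure (\<mu> k) {max u (a k)<..<min v (b k)}"
      using mu_pos[rule_format, OF k, of "max u (a k)" "min v (b k)"] uv by simp
    also have "\<dots> \<le> measure (\<mu> k) {u<..<v}" using mu_prob k by (intro \<mu>k.finite_measure_mono) auto
    finally have "0 < p k * measure (\<mu> k) {u<..<v}" using p_pos k by simp
    also have "\<dots> \<le> (\<Sum>j=1..L. p j * measure (\<mu> j) {u<..<v})"
      using k p_pos by (intro member_le_sum) (auto simp: less_imp_le intro!: mult_nonneg_nonneg)
    finally show ?thesis using muX_mix by simp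
  qed
  have edge: "G_left_edge \<mu>X a j = (INF z\<in>gap_interval a b j. ereal (cauchy_transform \<mu>X z))"
  proof (cases "j = 1")
    case True
    then have "hi = \<infinity>" by (simp add: hi_def)
    from sg.INF_G_unbounded[OF this] show ?thesis unfolding sg_gap using True by (simp add: G_left_edge_def)
  next
    case False
    then have "hi = ereal (a (j - 1))" by (simp add: hi_def)
    from sg.G_left_eq[OF this] show ?thesis unfolding sg_gap using False by (simp add: G_left_edge_def)
  qed
  have right: "G_right \<mu>X (b j) = (SUP z\<in>gap_interval a b j. ereal (cauchy_transform \<mu>X z))"
    using sg.G_right_eq unfolding sg_gap .
  let ?m = "\<lambda>n. nat \<lceil>real n * c (j - 1)\<rceil>"
  have mass_lo: "measure \<mu>X {b j - e<..<b j} > 0" if "e > 0" for e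
    using that ab_ord j by (intro mass[OF j]) auto
  have mass_hi: "measure \<mu>X {h<..<h + e} > 0" if "hi = ereal h" "e > 0" for h e
  proof (rule mass[of "j - 1"])
    show j': "j - 1 \<in> {1..L}" using that j by (auto simp: hi_def split: if_splits)
    then show "max h (a (j - 1)) < min (h + e) (b (j - 1))"
      using that ab_ord by (auto simp: hi_def split: if_splits)
  qed (use that in simp)
  have m0: "\<forall>n. ?m n = 0" if "hi = \<infinity>"
    using that by (auto simp: hi_def c_def split: if_splits)
  have m_large: "\<forall>\<^sub>F n in sequentially. r \<le> ?m n" if "hi \<noteq> \<infinity>"
    using that c_pred(2) by (intro eventually_le_nat_ceiling) (auto simp: hi_def split: if_splits)
  \<comment> \<open>The upper end of the gap is the lower end of band \<open>j - 1\<close>, whose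
    last eigenvalue has index \<open>nat \<lceil>real n * c (j - 1)\<rceil>\<close>, which is
    \<open>?m n\<close>.\<close>
  have bot: "AE \<omega> in M. \<forall>h. hi = ereal h \<longrightarrow> (\<lambda>n. eig n (X n \<omega>) (?m n)) \<longlonglongrightarrow> h"
  proof (cases "j = 1")
    case False
    then have "j - 1 \<in> {1..L}" using j by auto
    with edge_bot have "AE \<omega> in M. (\<lambda>n. eig n (X n \<omega>) (?m n)) \<longlonglongrightarrow> a (j - 1)" by blast
    then show ?thesis using False by (simp add: hi_def)
  qed (simp add: hi_def)
  note limit = AE_eig_perturbed_limit[OF sg esd mass_lo mass_hi
      eventually_nat_ceiling_add_le[OF c_pred(1)] m0 m_large edge_top[rule_format, OF j] bot, of i,
      folded gap edge right]
  have i': "1 \<le> i" "i \<le> r" using i by auto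
  \<comment> \<open>Here \<open>a 0\<close> is an arbitrary real, so the third case must not arise
    for \<open>j = 1\<close>: there the edge value is 0, below
    \<open>1 / \<theta> i\<close>.\<close>
  have "j \<noteq> 1" if "ereal (1 / \<theta> i) \<le> G_left_edge \<mu>X a j"
    using that theta_pos[OF i'] by (auto simp: G_left_edge_def)
  then show "(G_left_edge \<mu>X a j < ereal (1 / \<theta> i) \<and> ereal (1 / \<theta> i) < G_right \<mu>X (b j) \<longrightarrow>
        (AE \<omega> in M. (\<lambda>n. eig n (mat_add (X n \<omega>) (P n)) (nat \<lceil>real n * c (j - 1)\<rceil> + i))
            \<longlonglongrightarrow> the_inv_into (gap_interval a b j) (cauchy_transform \<mu>X) (1 / \<theta> i)))
   \<and> (ereal (1 / \<theta> i) \<ge> G_right \<mu>X (b j) \<longrightarrow>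
        (AE \<omega> in M. (\<lambda>n. eig n (mat_add (X n \<omega>) (P n)) (nat \<lceil>real n * c (j - 1)\<rceil> + i))
            \<longlonglongrightarrow> b j))
   \<and> (ereal (1 / \<theta> i) \<le> G_left_edge \<mu>X a j \<longrightarrow>
        (AE \<omega> in M. (\<lambda>n. eig n (mat_add (X n \<omega>) (P n)) (nat \<lceil>real n * c (j - 1)\<rceil> + i))
            \<longlonglongrightarrow> a (j - 1)))"
    using limit(1,2)[OF _ _ _ _ _ i'] limit(3)[OF _ _ _ _ _ i', of "a (j - 1)"] by (auto simp: hi_def)
qed

end
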